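(* For every $h=2^r$ with $r\geq 10$ an integer, there is an explicitly specified word $w_h$ (namely the word $w_h$ defined in the context) over an alphabet of size $h^2+4h$ such that, writing $n_h=|w_h|$, \[ h^2+4h\leq g(w_h)\leq 600h^2, \qquad 2^h\leq n_h\leq 2^{50h}. \] Every terminal grammar $G_h$ produced by the global algorithm Greedy on $w_h$, using left-to-right occurrence replacement and any choice among maximizing factors, satisfies \[ |G_h|\geq \frac{h^3}{8(4r+1)}. \] Consequently, \[ \frac{|G_h|}{g(w_h)} \geq \frac{h}{4800(4r+1)} \geq \frac{\log n_h}{1200000\,\log\log n_h}. \] Here all logarithms are to base two.
   Context: **Straight-line programs.** A straight-line program (SLP), also called grammar here, over a finite alphabet $\Sigma$ consists of finitely many nonterminals, a designated start nonterminal $S$, and exactly one production $A\to\alpha_A$ for each nonterminal $A$, where each right-hand side $\alpha_A$ is a nonempty word over terminals and nonterminals and the dependency graph is acyclic. Every symbol then has a unique terminal expansion $\operatorname{val}(\cdot)$, and the SLP generates the word $\operatorname{val}(S)$. The size of $G$ is $|G|=\sum_A|\alpha_A|$, and $g(w)$ is the minimum size of an SLP generating $w$. Notation $A^k$ stands for $k$ literal copies of $A$ (contributing $k$ to the size). A factor of a word is a contiguous subword. **The algorithm Greedy.** On input $w$ it starts with the grammar whose only production is $S\to w$. For a factor $v$ of the right-hand sides of the current grammar $G$, let $c_G(v)$ be the sum, over all right-hand sides, of the maximum number of pairwise nonoverlapping occurrences of $v$ in that right-hand side (occurrences are literal, i.e. as words over terminals and nonterminals). The factor $v$ is eligible if $|v|\geq2$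 and $c_G(v)\geq2$. Its gain is $\Delta_G(v)=c_G(v)(|v|-1)-|v|$. In each round Greedy chooses an eligible factor $v$ maximizing $\Delta_G(v)$ among all eligible factors (ties broken arbitrarily; this is equivalent to maximizing only over eligible factors for which no strictly longer factor has at least the same occurrence count), replaces occurrences of $v$ by a fresh nonterminal $Y$ in every existing right-hand side, choosing nonoverlapping occurrences greedily from left to right, and adds the production $Y\to v$. Rounds of gain zero are allowed. The algorithm stops when no eligible factor remains; the resulting grammar is called terminal. **The word $w_h$.** Let $h=2^r$, $r\ge10$, $B=64$, $q=2r$. *Targets.* Let $D$ be the lexicographically least binary word of length $2^q=h^2$ that is a cyclic de Bruijn word of order $q$ (every binary word of length $q$ occurs at exactly one cyclic starting position). Let $\varphi(0)=01$, $\varphi(1)=10$, extended to a morphism, and write $W=\varphi(D)=C_1C_2\cdots C_h$ with $|C_s|=2h$, positions in each $C_s$ numbered from $1$. For $1\leq s\leq h$ and $h+1\leq i\leq 2h$ let $n_{s,i}=\sum_{p=1}^{i}C_s[p]B^{i-p}$. The targets are the words $a^{n_{s,i}}$, where $a$ is a letter. *Auxiliaries.* Let $\mu$ be the morphism on $\{0,1,2\}^*$ with $\mu(0)=0120212012102120210$, $\mu(1)=1201020120210201021$, $\mu(2)=2012101201021012102$. For $1\leq j\leq h$ let $e_j=7h+2-3j$ and $V_j=\mu^{e_j}(0)$. Choose three private terminal letters $b_{j,0},b_{j,1},b_{j,2}$ for each $j$, all distinct and different from $a$. Let $F_j$ be obtained from $V_j$ by replacing each letter $c$ by $a^{B^j}b_{j,c}$.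 *Input.* $w_h$ consists of the targets $a^{n_{s,i}}$ in lexicographic order of $(s,i)$, followed by $F_1,\ldots,F_h$, with a terminal separator letter between every two successive words; the $h^2+h-1$ separators are pairwise distinct and different from all other letters. *)

theory Defs
  imports Complex_Main "HOL-Library.Sublist"
begin

section \<open>Straight-line programs\<close>

text \<open>Nonterminals are natural numbers; a grammar has only finitely many of them.\<close>

datatype 't symbol = T 't | N nat

record 't grammar =
  start :: nat
  rules :: "nat \<rightharpoonup> 't symbol list"

definition depends :: "'t grammar \<Rightarrow> (nat \<times> nat) set" where
  "depends G = {(A, A'). \<exists>\<alpha>. rules G A = Some \<alpha> \<and> N A' \<in> set \<alpha>}"

definition is_slp :: "'t grammar \<Rightarrow> bool" where
  "is_slp G \<longleftrightarrow>
     finite (dom (rules G)) \<and> start G \<in> dom (rules G) \<and>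
     (\<forall>A \<alpha>. rules G A = Some \<alpha> \<longrightarrow> \<alpha> \<noteq> [] \<and> (\<forall>A'. N A' \<in> set \<alpha> \<longrightarrow> A' \<in> dom (rules G))) \<and>
     acyclic (depends G)"

inductive expands :: "'t grammar \<Rightarrow> 't symbol list \<Rightarrow> 't list \<Rightarrow> bool" for G where
  expands_Nil: "expands G [] []"
| expands_T: "expands G \<alpha> u \<Longrightarrow> expands G (T t # \<alpha>) (t # u)"
| expands_N: "rules G A = Some \<beta> \<Longrightarrow> expands G \<beta> u \<Longrightarrow> expands G \<alpha> v \<Longrightarrow>
    expands G (N A # \<alpha>) (u @ v)"

definition val :: "'t grammar \<Rightarrow> 't symbol \<Rightarrow> 't list" where
  "val G X = (THE u. expands G [X] u)"

definition generates :: "'t grammar \<Rightarrow> 't list \<Rightarrow> bool" where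
  "generates G w \<longleftrightarrow> is_slp G \<and> val G (N (start G)) = w"

definition grammar_size :: "'t grammar \<Rightarrow> nat" where
  "grammar_size G = (\<Sum>A\<in>dom (rules G). length (the (rules G A)))"

definition min_slp_size :: "'t list \<Rightarrow> nat" where
  "min_slp_size w = (LEAST m. \<exists>G. generates G w \<and> grammar_size G = m)"

text \<open>In a straight-line program the description in \<^const>\<open>val\<close> is proper.\<close>

lemma expands_unique: "expands G \<alpha> u \<Longrightarrow> expands G \<alpha> v \<Longrightarrow> u = v"
proof (induction arbitrary: v rule: expands.induct)
  case expands_Nil
  then show ?case by cases auto
next
  case (expands_T \<alpha> u t)
  from expands_T.prems show ?case by cases (auto dest: expands_T.IH)
next
  case (expands_N A \<beta> u \<alpha> u')
  from expands_N.prems show ?case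
    by cases (use expands_N.hyps expands_N.IH in auto)
qed

lemma expands_listI:
  assumes "\<And>X. X \<in> set \<alpha> \<Longrightarrow> \<exists>u. expands G [X] u"
  shows "\<exists>u. expands G \<alpha> u"
  using assms
proof (induction \<alpha>)
  case Nil
  then show ?case by (blast intro: expands_Nil)
next
  case (Cons X \<alpha>)
  obtain u where u: "expands G \<alpha> u" using Cons by auto
  obtain x where "expands G [X] x" using Cons.prems by auto
  then show ?case by cases (use u in \<open>blast intro: expands.intros\<close>)+
qed

lemma depends_subset: "is_slp G \<Longrightarrow> depends G \<subseteq> dom (rules G) \<times> dom (rules G)"
  by (fastforce simp: is_slp_def depends_def)

lemma ex_expands:
  assumes "is_slp G" "A \<in> dom (rules G)"
  shows "\<exists>u. expands G [N A] u"
proof -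
  have "finite (depends G)"
    using depends_subset[OF assms(1)] assms(1) by (auto simp: is_slp_def intro: finite_subset)
  then have "wf ((depends G)\<inverse>)"
    using assms(1) by (simp add: finite_acyclic_wf_converse is_slp_def)
  then show ?thesis using assms(2)
  proof (induction A rule: wf_induct_rule)
    case (less A)
    then obtain \<beta> where \<beta>: "rules G A = Some \<beta>" by auto
    have "\<exists>u. expands G [X] u" if X: "X \<in> set \<beta>" for X
    proof (cases X)
      case (T t)
      then show ?thesis by (blast intro: expands.intros)
    next
      case (N A')
      then have "(A, A') \<in> depends G" using X \<beta> by (auto simp: depends_def)
      then show ?thesis using less.IH[of A'] depends_subset[OF assms(1)] N by blast
    qed
    then obtain u where "expands G \<beta> u" using expands_listI by blast
    then show ?case using \<beta> by (blast intro: expands.intros)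
  qed
qed

lemma expands_val:
  assumes "is_slp G" "A \<in> dom (rules G)"
  shows "expands G [N A] (val G (N A))"
  unfolding val_def using ex_expands[OF assms] by (metis expands_unique theI)


section \<open>The algorithm Greedy\<close>

definition occurs_at :: "'a list \<Rightarrow> 'a list \<Rightarrow> nat \<Rightarrow> bool" where
  "occurs_at v \<alpha> i \<longleftrightarrow> i + length v \<le> length \<alpha> \<and> take (length v) (drop i \<alpha>) = v"

definition max_nonoverlapping :: "'a list \<Rightarrow> 'a list \<Rightarrow> nat" where
  "max_nonoverlapping v \<alpha> =
     Max (card ` {I. (\<forall>i\<in>I. occurs_at v \<alpha> i) \<and> (\<forall>i\<in>I. \<forall>j\<in>I. i < j \<longrightarrow> i + length v \<le> j)})"

definition occ_count :: "'t grammar \<Rightarrow> 't symbol list \<Rightarrow> nat" where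
  "occ_count G v = (\<Sum>A\<in>dom (rules G). max_nonoverlapping v (the (rules G A)))"

definition eligible :: "'t grammar \<Rightarrow> 't symbol list \<Rightarrow> bool" where
  "eligible G v \<longleftrightarrow>
     (\<exists>\<alpha>\<in>ran (rules G). sublist v \<alpha>) \<and> 2 \<le> length v \<and> 2 \<le> occ_count G v"

definition gain :: "'t grammar \<Rightarrow> 't symbol list \<Rightarrow> int" where
  "gain G v = int (occ_count G v) * (int (length v) - 1) - int (length v)"

text \<open>Left-to-right replacement; the guard \<open>v \<noteq> []\<close> only serves termination.\<close>

function replace_factor :: "'a list \<Rightarrow> 'a \<Rightarrow> 'a list \<Rightarrow> 'a list" where
  "replace_factor v y [] = []"
| "replace_factor v y (x # xs) =
     (if v \<noteq> [] \<and> prefix v (x # xs)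
      then y # replace_factor v y (drop (length v) (x # xs))
      else x # replace_factor v y xs)"
  by pat_completeness auto
termination
  by (relation "measure (\<lambda>(v, y, xs). length xs)") auto

definition replace_step :: "'t symbol list \<Rightarrow> nat \<Rightarrow> 't grammar \<Rightarrow> 't grammar" where
  "replace_step v Y G =
     G\<lparr>rules := (\<lambda>A. map_option (replace_factor v (N Y)) (rules G A))(Y \<mapsto> v)\<rparr>"

definition greedy_step :: "'t grammar \<Rightarrow> 't grammar \<Rightarrow> bool" where
  "greedy_step G G' \<longleftrightarrow>
     (\<exists>v Y. eligible G v \<and> (\<forall>u. eligible G u \<longrightarrow> gain G u \<le> gain G v) \<and>
            Y \<notin> dom (rules G) \<and> G' = replace_step v Y G)"

definition initial_grammar :: "'t list \<Rightarrow> 't grammar" where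
  "initial_grammar w = \<lparr>start = 0, rules = [0 \<mapsto> map T w]\<rparr>"

definition greedy_terminal :: "'t list \<Rightarrow> 't grammar \<Rightarrow> bool" where
  "greedy_terminal w G \<longleftrightarrow>
     greedy_step\<^sup>*\<^sup>* (initial_grammar w) G \<and> (\<nexists>v. eligible G v)"


section \<open>The input words\<close>

datatype letter = La | Lb nat nat | Sep nat

definition base :: nat where
  "base = 64"

text \<open>Binary and ternary words are lists of natural numbers.\<close>

definition de_bruijn :: "nat \<Rightarrow> nat list \<Rightarrow> bool" where
  "de_bruijn q d \<longleftrightarrow>
     set d \<subseteq> {0, 1} \<and> length d = 2 ^ q \<and>
     (\<forall>u. set u \<subseteq> {0, 1} \<and> length u = q \<longrightarrow>
        (\<exists>!i. i < length d \<and> map (\<lambda>k. d ! ((i + k) mod length d)) [0..<q] = u))"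

definition least_de_bruijn :: "nat \<Rightarrow> nat list" where
  "least_de_bruijn q =
     (THE d. de_bruijn q d \<and> (\<forall>d'. de_bruijn q d' \<longrightarrow> d = d' \<or> (d, d') \<in> lexord less_than))"

definition \<phi> :: "nat \<Rightarrow> nat list" where
  "\<phi> c = (if c = 0 then [0, 1] else [1, 0])"

definition \<mu> :: "nat \<Rightarrow> nat list" where
  "\<mu> c =
     (if c = 0 then [0,1,2,0,2,1,2,0,1,2,1,0,2,1,2,0,2,1,0]
      else if c = 1 then [1,2,0,1,0,2,0,1,2,0,2,1,0,2,0,1,0,2,1]
      else [2,0,1,2,1,0,1,2,0,1,0,2,1,0,1,2,1,0,2])"

definition morph :: "(nat \<Rightarrow> nat list) \<Rightarrow> nat list \<Rightarrow> nat list" where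
  "morph f u = concat (map f u)"

definition block :: "nat \<Rightarrow> nat \<Rightarrow> nat list" where
  "block r s = take (2 * 2 ^ r) (drop ((s - 1) * (2 * 2 ^ r)) (morph \<phi> (least_de_bruijn (2 * r))))"

text \<open>List indices start at 0, the positions \<open>p\<close> in a block at 1.\<close>

definition target_exp :: "nat \<Rightarrow> nat \<Rightarrow> nat \<Rightarrow> nat" where
  "target_exp r s i = (\<Sum>p = 1..i. block r s ! (p - 1) * base ^ (i - p))"

definition targets :: "nat \<Rightarrow> letter list list" where
  "targets r = [replicate (target_exp r s i) La.
     s \<leftarrow> [1..<2 ^ r + 1], i \<leftarrow> [2 ^ r + 1..<2 * 2 ^ r + 1]]"

definition aux_word :: "nat \<Rightarrow> nat \<Rightarrow> nat list" where
  "aux_word r j = (morph \<mu> ^^ (7 * 2 ^ r + 2 - 3 * j)) [0]"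

definition auxiliary :: "nat \<Rightarrow> nat \<Rightarrow> letter list" where
  "auxiliary r j = concat (map (\<lambda>c. replicate (base ^ j) La @ [Lb j c]) (aux_word r j))"

fun join_sep :: "nat \<Rightarrow> letter list list \<Rightarrow> letter list" where
  "join_sep k [] = []"
| "join_sep k [u] = u"
| "join_sep k (u # u' # us) = u @ Sep k # join_sep (Suc k) (u' # us)"

definition input_word :: "nat \<Rightarrow> letter list" where
  "input_word r = join_sep 1 (targets r @ map (auxiliary r) [1..<2 ^ r + 1])"

definition input_alphabet :: "nat \<Rightarrow> letter set" where
  "input_alphabet h =
     {La} \<union> {Lb j c | j c. j \<in> {1..h} \<and> c \<in> {0, 1, 2}} \<union> Sep ` {1..h\<^sup>2 + h - 1}"

end

theory Submission
  imports Defs "Graph_Theory.Euler"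
begin

text \<open>
  By Dejean's theorem for the morphism \<open>\<mu>\<close>, two occurrences of a word of length \<open>m\<close> in \<open>V\<^sub>j\<close> are at
  distance at least \<open>4m/3\<close>. Hence no factor of \<open>F\<^sub>j\<close> that contains a private letter covers as much as the
  power \<open>a\<^sup>6\<^sup>4\<close> does, and, as long as \<open>F\<^sub>j\<close> dominates the gain, Greedy is forced to choose in turn the
  powers \<open>Y\<^sub>j\<^sup>6\<^sup>4\<close> (with \<open>Y\<^sub>0 = a\<close>), interrupted only by rounds that involve private letters of words \<open>F\<^sub>i\<close>
  treated before. After \<open>h\<close> such rounds each target is spelled by its digits to base 64, that is, the
  places of the ones in a window of \<open>\<phi>(D)\<close>. Every later nonterminal expands to a word that occurs twice, whereas a
  factor of \<open>\<phi>(D)\<close> of length \<open>4r + 1\<close> determines its position; so every symbol that is left in a target covers at most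
  \<open>4r + 1\<close> ones, and there are about \<open>h\<^sup>3/2\<close> of them.
\<close>

section \<open>Repetitions in the fixed point of Dejean's morphism\<close>

text \<open>The obstacle is that Greedy cannot be followed exactly: between two forced rounds the
  treated words are compressed in an order that nothing controls. So the invariant keeps only one
  fact about their remains, that no two symbols Y_i are adjacent in them; they then neither contain
  a power of Y_j nor change when one is replaced. The margin is thin: on a run of length 64,
  exponent 64 scores 63 and a smaller exponent up to 62. The exponents e_j protect it. Consecutive
  V_j differ in length by the factor 19^3 = 6859 > 64^2 + 64, so after j rounds all F_i with i > j +
  1 together have at most as many symbols Y_j as V_{j+1} has letters; and even V_h, with 19^(4h + 2)
  letters, is longer than all targets together. After round h the choices of Greedy are not examined
  any more: only the expansion into the grammar of that moment is used, where every new symbol has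
  two places. \<phi> ensures that about half the letters of each window are ones, although D has
  long runs of zeros. As D is given by a definite description, its existence is needed; it comes
  from an Eulerian circuit.\<close>

function dejean :: "nat \<Rightarrow> nat" where
  "dejean n = (if n = 0 then 0 else (dejean (n div 19) + \<mu> 0 ! (n mod 19)) mod 3)"
  by auto
termination by (relation "measure id") auto

declare dejean.simps [simp del]

text \<open>\<open>\<mu> c\<close> is \<open>\<mu> 0\<close> with c added modulo 3. So letter n of
  the fixed point starting with 0 is the sum modulo 3 of the letters of \<open>\<mu> 0\<close> at
  the base 19 digits of n. \<open>dejean\<close> computes this sum, and block k is the image of
  letter k.\<close>

lemma dejean_block: "o' < 19 \<Longrightarrow> dejean (19 * k + o') = (dejean k + \<mu> 0 ! o') mod 3"
  using dejean.simps[of "19 * k + o'"] dejean.simps[of 0] by (auto simp: \<mu>_def)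

lemma dejean_lt: "dejean n < 3"
  by (subst dejean.simps) auto

lemma \<mu>_eq: "c < 3 \<Longrightarrow> \<mu> c = map (\<lambda>i. (c + \<mu> 0 ! i) mod 3) [0..<19]"
proof -
  have u: "[0..<19] = [0,1,2,3,4,5,6,7,8,9,10,11,12,13,14,15,16,17,18::nat]"
    by (simp add: upt_rec)
  assume "c < 3"
  then have "c = 0 \<or> c = 1 \<or> c = 2" by auto
  then show ?thesis unfolding u by (auto simp: \<mu>_def)
qed

lemma list_all_uptD: "list_all P [0..<n] \<Longrightarrow> i < n \<Longrightarrow> P i"
  by (simp add: list_all_iff)

lemma upt_19_mult: "concat (map (\<lambda>k. map (\<lambda>o'. 19 * k + o') [0..<19]) [0..<n]) = [0..<19 * n]"
proof (induction n)
  case (Suc n)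
  have "19 * Suc n = 19 * n + 19" by simp
  then have "[0..<19 * Suc n] = [0..<19 * n] @ [19 * n..<19 * n + 19]"
    by (simp only: upt_add_eq_append[OF le0])
  also have "[19 * n..<19 * n + 19] = map (\<lambda>o'. 19 * n + o') [0..<19]"
    using map_add_upt[of "19 * n" 19] by (simp add: add.commute)
  finally show ?case using Suc by simp
qed auto

lemma morph_\<mu>_dejean: "morph \<mu> (map dejean [0..<n]) = map dejean [0..<19 * n]"
proof -
  have "morph \<mu> (map dejean [0..<n]) = concat (map (\<lambda>k. map dejean (map (\<lambda>o'. 19 * k + o') [0..<19])) [0..<n])"
    unfolding morph_def map_map
    by (intro arg_cong[where f = concat] map_cong refl)
       (auto simp: \<mu>_eq[OF dejean_lt] dejean_block)
  also have "\<dots> = map dejean [0..<19 * n]"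
    unfolding upt_19_mult[symmetric] map_concat map_map o_def ..
  finally show ?thesis .
qed

lemma aux_word_eq: "(morph \<mu> ^^ e) [0] = map dejean [0..<19 ^ e]"
  by (induction e) (simp_all add: morph_\<mu>_dejean, simp add: dejean.simps)

text \<open>Inside a block of length 19 the differences of consecutive letters do not depend on the
  letter that the block is the image of.\<close>

definition delta :: "nat list" where
  "delta = [1, 1, 1, 2, 2, 1, 1, 1, 1, 2, 2, 2, 2, 1, 1, 2, 2, 2]"

lemma delta_check:
  "list_all (\<lambda>i. \<mu> 0 ! Suc i = (\<mu> 0 ! i + delta ! i) mod 3 \<and> (delta ! i = 1 \<or> delta ! i = 2)) [0..<18]"
  unfolding \<mu>_def delta_def by code_simp

lemma less_3_cases: "(x::nat) < 3 \<Longrightarrow> x = 0 \<or> x = 1 \<or> x = 2"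
  by linarith

lemma mod_3_cancel:
  assumes "(x + e) mod 3 = (x + e') mod 3" "e < 3" "e' < 3"
  shows "e = (e'::nat)"
proof -
  have "(x mod 3 + e) mod 3 = (x mod 3 + e') mod 3" using assms(1) by (simp add: mod_simps)
  moreover obtain y where "x mod 3 = y" "y < 3" by simp
  ultimately show ?thesis using assms(2,3) by (auto dest!: less_3_cases)
qed

lemma mod_3_neq: "e = 1 \<or> e = 2 \<Longrightarrow> (x::nat) mod 3 \<noteq> (x + e) mod 3"
  using mod_3_cancel[of x 0 e] by auto

lemma mod_3_diff: "a < 3 \<Longrightarrow> b < 3 \<Longrightarrow> a \<noteq> b \<Longrightarrow> (b + 3 - a) mod 3 \<in> {1, 2::nat}"
  by (auto dest!: less_3_cases)

text \<open>Inside a block the difference is nonzero by \<open>delta_check\<close>. Since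
  \<open>\<mu> 0\<close> begins and ends with 0, the two letters at a block border equal their
  preimages, which are adjacent at a smaller position.\<close>

lemma dejean_neq_Suc: "dejean n \<noteq> dejean (Suc n)"
proof (induction n rule: less_induct)
  case (less n)
  define k i where "k = n div 19" "i = n mod 19"
  then have n: "n = 19 * k + i" "i < 19" by auto
  show ?case
  proof (cases "i = 18")
    case True
    have "\<mu> 0 ! 18 = 0" "\<mu> 0 ! 0 = 0" by (simp_all add: \<mu>_def)
    then have "dejean (19 * k + 18) = dejean k" "dejean (19 * Suc k + 0) = dejean (Suc k)"
      using dejean_block[of 18 k] dejean_block[of 0 "Suc k"] dejean_lt[of k] dejean_lt[of "Suc k"]
      by (simp_all del: mult_Suc_right)
    moreover have "n = 19 * k + 18" "Suc n = 19 * Suc k + 0" using n True by simp_all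
    moreover have "dejean k \<noteq> dejean (Suc k)"
      using less[of k] n(1) True by linarith
    ultimately show ?thesis by (simp only:) simp
  next
    case False
    then have i: "Suc i < 19" using n by auto
    have a: "dejean n = (dejean k + \<mu> 0 ! i) mod 3" using dejean_block[OF n(2), of k] unfolding n(1) .
    have b: "dejean (Suc n) = (dejean k + \<mu> 0 ! Suc i) mod 3"
      using dejean_block[OF i, of k] unfolding n(1) by simp
    have "\<mu> 0 ! Suc i = (\<mu> 0 ! i + delta ! i) mod 3" "delta ! i = 1 \<or> delta ! i = 2"
      using list_all_uptD[OF delta_check, of i] i by auto
    then show ?thesis unfolding a b using mod_3_neq[of "delta ! i" "dejean k + \<mu> 0 ! i"]
      by (simp add: mod_simps add.assoc)
  qed
qed

lemma dejean_Suc: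
  assumes "i < 18"
  shows "dejean (Suc (19 * k + i)) = (dejean (19 * k + i) + delta ! i) mod 3"
proof -
  have "dejean (Suc (19 * k + i)) = (dejean k + \<mu> 0 ! Suc i) mod 3"
    using dejean_block[of "Suc i" k] assms by simp
  moreover have "dejean (19 * k + i) = (dejean k + \<mu> 0 ! i) mod 3"
    using dejean_block[of i k] assms by simp
  moreover have "\<mu> 0 ! Suc i = (\<mu> 0 ! i + delta ! i) mod 3"
    using list_all_uptD[OF delta_check assms] by simp
  moreover have "(dejean k + (\<mu> 0 ! i + delta ! i) mod 3) mod 3 = ((dejean k + \<mu> 0 ! i) mod 3 + delta ! i) mod 3"
    by (simp add: mod_simps add.assoc)
  ultimately show ?thesis by (simp only:)
qed

text \<open>A step from offset 18 crosses a block border, where the difference depends on the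
  preimages; such steps are ignored. Nine steps are the differences in a window of ten
  letters.\<close>

definition sync_ok :: "nat \<Rightarrow> nat \<Rightarrow> bool" where
  "sync_ok x y \<longleftrightarrow> list_ex (\<lambda>t. (x + t) mod 19 \<noteq> 18 \<and> (y + t) mod 19 \<noteq> 18 \<and>
      delta ! ((x + t) mod 19) \<noteq> delta ! ((y + t) mod 19)) [0..<9]"

lemma sync_check: "list_all (\<lambda>x. list_all (\<lambda>y. x = y \<or> sync_ok x y) [0..<19]) [0..<19]"
  unfolding sync_ok_def delta_def by code_simp

text \<open>The differences that do not depend on preimages already reveal the offset modulo 19
  (\<open>sync_check\<close>). Hence length 10 separates short repetitions from those that descend
  to the preimage.\<close>

lemma dejean_sync:
  assumes eq: "\<And>t. t < 10 \<Longrightarrow> dejean (a + t) = dejean (b + t)"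
  shows "a mod 19 = b mod 19"
proof (rule ccontr)
  assume ne: "a mod 19 \<noteq> b mod 19"
  have "list_all (\<lambda>y. a mod 19 = y \<or> sync_ok (a mod 19) y) [0..<19]"
    by (rule list_all_uptD[OF sync_check]) simp
  from list_all_uptD[OF this, of "b mod 19"] have "sync_ok (a mod 19) (b mod 19)" using ne by simp
  then obtain t where t: "t < 9" "(a + t) mod 19 \<noteq> 18" "(b + t) mod 19 \<noteq> 18"
    "delta ! ((a + t) mod 19) \<noteq> delta ! ((b + t) mod 19)"
    unfolding sync_ok_def list_ex_iff by (auto simp: mod_simps)
  have S: "dejean (Suc n) = (dejean n + delta ! (n mod 19)) mod 3" if "n mod 19 \<noteq> 18" for n
  proof -
    have "n mod 19 < 19" by simp
    then have "n mod 19 < 18" using that by linarith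
    from dejean_Suc[OF this, of "n div 19"] show ?thesis by simp
  qed
  have d: "delta ! (n mod 19) < 3" if "n mod 19 \<noteq> 18" for n
  proof -
    have "n mod 19 < 19" by simp
    then have "n mod 19 < 18" using that by linarith
    then show ?thesis using list_all_uptD[OF delta_check, of "n mod 19"] by auto
  qed
  have "dejean (Suc (a + t)) = dejean (Suc (b + t))" "dejean (a + t) = dejean (b + t)"
    using eq[of t] eq[of "Suc t"] t by auto
  then have "(dejean (a + t) + delta ! ((a + t) mod 19)) mod 3 =
      (dejean (a + t) + delta ! ((b + t) mod 19)) mod 3"
    using S[of "a + t"] S[of "b + t"] t by simp
  then show False using mod_3_cancel[OF _ d d] t(2-4) by blast
qed

text \<open>The image of the word 0e, where e is the difference of two adjacent letters: any two
  neighbouring blocks are this word up to adding the letter \<open>dejean k\<close>.\<close>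

definition two_blocks :: "nat \<Rightarrow> nat list" where
  "two_blocks e = \<mu> 0 @ map (\<lambda>x. (e + x) mod 3) (\<mu> 0)"

lemma short_check:
  "list_all (\<lambda>e. list_all (\<lambda>x. list_all (\<lambda>d.
     list_ex (\<lambda>t. two_blocks e ! (x + t) \<noteq> two_blocks e ! (x + d + t)) [0..<3 * d div 4 + 1])
     [1..<12]) [0..<19]) [1, 2]"
  unfolding two_blocks_def \<mu>_def by code_simp

lemma two_blocks_nth:
  assumes "i < 19 + 19"
  shows "dejean (19 * k + i) = (dejean k + two_blocks ((dejean (Suc k) + 3 - dejean k) mod 3) ! i) mod 3"
proof (cases "i < 19")
  case True
  have "length (\<mu> 0) = 19" by (simp add: \<mu>_def)
  then have "two_blocks e ! i = \<mu> 0 ! i" for e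
    unfolding two_blocks_def using True by (simp only: nth_append if_True)
  then show ?thesis using dejean_block[OF True, of k] by (simp only:)
next
  case False
  then obtain i' where i': "i = 19 + i'" "i' < 19"
    using assms by (metis add_less_cancel_left le_add_diff_inverse not_less)
  have "19 * k + i = 19 * Suc k + i'" using i' by simp
  then have *: "dejean (19 * k + i) = (dejean (Suc k) + \<mu> 0 ! i') mod 3"
    using dejean_block[of i' "Suc k"] i'(2) by (simp only:)
  have "length (\<mu> 0) = 19" by (simp add: \<mu>_def)
  then have **: "two_blocks e ! i = (e + \<mu> 0 ! i') mod 3" for e
    unfolding two_blocks_def using i' by (simp add: nth_append)
  have "(a + ((b + 3 - a) mod 3 + c) mod 3) mod 3 = (b + c) mod 3" if "a < 3" for a b c :: nat
  proof -
    have "(a + ((b + 3 - a) mod 3 + c) mod 3) mod 3 = (a + (b + 3 - a) + c) mod 3"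
      by (simp add: mod_simps add.assoc)
    also have "a + (b + 3 - a) + c = (b + c) + 3" using that by simp
    finally show ?thesis by simp
  qed
  then show ?thesis unfolding * ** using dejean_lt[of k] by (simp only:)
qed

text \<open>A violation contains one of length \<open>3 * d div 4 + 1\<close>, at most 9. Started at
  an offset at most 18, it and its shifted copy end by 18 + 11 + 8 = 37, so both lie in two adjacent
  blocks, where \<open>short_check\<close> excludes them.\<close>

lemma dejean_repetition_short:
  assumes "0 < d" "d < 12" and eq: "\<And>t. t < m \<Longrightarrow> dejean (a + t) = dejean (a + d + t)"
  shows "4 * m \<le> 3 * d"
proof (rule ccontr)
  assume "\<not> 4 * m \<le> 3 * d"
  then have m: "3 * d div 4 + 1 \<le> m" by auto
  define k i where "k = a div 19" "i = a mod 19"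
  define e where "e = (dejean (Suc k) + 3 - dejean k) mod 3"
  have a: "a = 19 * k + i" "i < 19" by (auto simp: k_i_def)
  have "e \<in> {1, 2}"
    unfolding e_def using mod_3_diff[OF dejean_lt dejean_lt dejean_neq_Suc] .
  then have "list_ex (\<lambda>t. two_blocks e ! (i + t) \<noteq> two_blocks e ! (i + d + t)) [0..<3 * d div 4 + 1]"
  proof -
    have d: "d \<in> set [1..<12]" using assms(1,2) by auto
    have "list_all (\<lambda>x. list_all (\<lambda>d. list_ex (\<lambda>t. two_blocks e ! (x + t) \<noteq> two_blocks e ! (x + d + t))
        [0..<3 * d div 4 + 1]) [1..<12]) [0..<19]"
      using short_check \<open>e \<in> {1, 2}\<close> unfolding list_all_iff[of _ "[1, 2]"] by auto
    from list_all_uptD[OF this a(2)] show ?thesis using d unfolding list_all_iff[of _ "[1..<12]"] by blast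
  qed
  then obtain t where t: "t < 3 * d div 4 + 1" "two_blocks e ! (i + t) \<noteq> two_blocks e ! (i + d + t)"
    unfolding list_ex_iff set_upt by (meson atLeastLessThan_iff)
  have lt: "i + d + t < 19 + 19" using t(1) assms(2) a(2) by linarith
  have "dejean (19 * k + (i + t)) = dejean (19 * k + (i + d + t))"
    using eq[of t] t(1) m a(1) by (simp add: ac_simps)
  then have "(dejean k + two_blocks e ! (i + t)) mod 3 = (dejean k + two_blocks e ! (i + d + t)) mod 3"
    using two_blocks_nth[of "i + t" k] two_blocks_nth[of "i + d + t" k] lt unfolding e_def by simp
  moreover have "two_blocks e ! x < 3" if "x < 38" for x
  proof -
    have "\<forall>y\<in>set (two_blocks e). y < 3" by (auto simp: two_blocks_def \<mu>_def)
    moreover have "length (two_blocks e) = 38" by (simp add: two_blocks_def \<mu>_def)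
    ultimately show ?thesis using that by auto
  qed
  then have "two_blocks e ! (i + t) < 3" "two_blocks e ! (i + d + t) < 3" using lt by auto
  ultimately show False using t(2) mod_3_cancel by blast
qed

text \<open>Descent along \<open>\<mu>\<close>: a repetition of length at least 10 has a shift
  divisible by 19 by \<open>dejean_sync\<close>, and comes from a repetition of preimages with shift
  d/19 and length at least m/19.\<close>

lemma dejean_repetition:
  assumes "0 < d" and eq: "\<And>t. t < m \<Longrightarrow> dejean (a + t) = dejean (a + d + t)"
  shows "4 * m \<le> 3 * d"
  using assms
proof (induction d arbitrary: m a rule: less_induct)
  case (less d)
  show ?case
  proof (cases "m < 10")
    case True
    \<comment> \<open>For d \<ge> 12 the claim is trivial: 4m \<le> 36 \<le> 3d.\<close>
    then show ?thesis
      using dejean_repetition_short[of d m a] less.prems by (cases "d < 12") auto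
  next
    case False
    have "a mod 19 = (a + d) mod 19"
      using less.prems(2) False by (intro dejean_sync) auto
    then have "19 dvd d" by (metis add_diff_cancel_left' mod_eq_dvd_iff_nat le_add1)
    then obtain d' where d: "d = 19 * d'" by auto
    define k0 k1 where "k0 = a div 19" "k1 = (a + m - 1) div 19"
    \<comment> \<open>Partially covered blocks are counted too, since a single letter at a known
      offset determines the preimage of its block. This gives 19m' \<ge> m.\<close>
    define m' where "m' = k1 + 1 - k0"
    have "k0 \<le> k1" unfolding k0_k1_def using False by (intro div_le_mono) auto
    have "dejean (k0 + t) = dejean (k0 + d' + t)" if "t < m'" for t
    proof -
      have "k0 + t \<le> k1" using that \<open>k0 \<le> k1\<close> by (simp add: m'_def)
      define b where "b = max a (19 * (k0 + t))"
      define i where "i = b - 19 * (k0 + t)"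
      have ma: "a < 19 * (k0 + 1)" unfolding k0_k1_def
        by (metis Suc_eq_plus1 dividend_less_times_div mult_Suc_right zero_less_numeral add.commute)
      have i: "i < 19" unfolding i_def b_def using ma by auto
      have b: "b = 19 * (k0 + t) + i" by (simp add: i_def b_def)
      have "19 * k1 \<le> a + m - 1" unfolding k0_k1_def by simp
      then have "b < a + m" unfolding b_def using \<open>k0 + t \<le> k1\<close> False
        by (auto simp: max_def)
      then have "dejean b = dejean (b + d)"
        using less.prems(2)[of "b - a"] by (auto simp: b_def ac_simps)
      moreover have "b + d = 19 * (k0 + d' + t) + i" using b d by simp
      ultimately have "(dejean (k0 + t) + \<mu> 0 ! i) mod 3 = (dejean (k0 + d' + t) + \<mu> 0 ! i) mod 3"
        using dejean_block[OF i] b by metis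
      then show ?thesis
        using mod_3_cancel[OF _ dejean_lt dejean_lt] by (simp only: add.commute[of _ "\<mu> 0 ! i"])
    qed
    moreover have "0 < d'" "d' < d" using d less.prems(1) by auto
    ultimately have "4 * m' \<le> 3 * d'" using less.IH by blast
    moreover have "m \<le> 19 * m'"
    proof -
      have "a + m - 1 < 19 * (k1 + 1)" unfolding k0_k1_def
        by (metis Suc_eq_plus1 dividend_less_times_div mult_Suc_right zero_less_numeral add.commute)
      moreover have "19 * k0 \<le> a" unfolding k0_k1_def by simp
      ultimately show ?thesis unfolding m'_def using \<open>k0 \<le> k1\<close> by simp
    qed
    ultimately show ?thesis using d by simp
  qed
qed

section \<open>Densities of letters and factors in the fixed point\<close>

lemma card_blocks:
  assumes "\<And>k. k < n \<Longrightarrow> card {i. i < 19 \<and> 19 * k + i \<in> A} \<le> b"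
  shows "card (A \<inter> {..<19 * n}) \<le> b * n"
  using assms
proof (induction n)
  case (Suc n)
  have "A \<inter> {..<19 * Suc n} = (A \<inter> {..<19 * n}) \<union> (\<lambda>i. 19 * n + i) ` {i. i < 19 \<and> 19 * n + i \<in> A}"
    (is "_ = _ \<union> ?B")
  proof (intro set_eqI iffI)
    fix x assume "x \<in> A \<inter> {..<19 * Suc n}"
    then show "x \<in> (A \<inter> {..<19 * n}) \<union> ?B"
      by (cases "x < 19 * n") (auto intro!: image_eqI[of _ _ "x - 19 * n"])
  qed auto
  then have "card (A \<inter> {..<19 * Suc n}) \<le> card (A \<inter> {..<19 * n}) + card ?B"
    by (simp add: card_Un_le)
  also have "card ?B \<le> b"
    using Suc.prems[of n] card_image_le[of "{i. i < 19 \<and> 19 * n + i \<in> A}" "\<lambda>i. 19 * n + i"] by simp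
  finally show ?case using Suc by simp
qed auto

lemma filter_upt_card: "card {i. i < n \<and> P i} = length (filter P [0..<n])"
  by (subst distinct_length_filter) (auto intro: arg_cong[where f = card])

lemma letter_check: "list_all (\<lambda>c. list_all (\<lambda>x.
    length (filter (\<lambda>i. (c + \<mu> 0 ! i) mod 3 = x) [0..<19]) \<le> 7) [0..<3]) [0..<3]"
  unfolding \<mu>_def by code_simp

lemma pair_check: "list_all (\<lambda>c. list_all (\<lambda>e. list_all (\<lambda>x. list_all (\<lambda>y.
    length (filter (\<lambda>i. (c + two_blocks e ! i) mod 3 = x \<and> (c + two_blocks e ! Suc i) mod 3 = y) [0..<19]) \<le> 4)
    [0..<3]) [0..<3]) [1, 2]) [0..<3]"
  unfolding \<mu>_def two_blocks_def by code_simp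

lemma card_letter: "card {a. a < 19 * n \<and> dejean a = x} \<le> 7 * n"
proof -
  have "card ({a. dejean a = x} \<inter> {..<19 * n}) \<le> 7 * n"
  proof (rule card_blocks)
    fix k
    have "{i. i < 19 \<and> 19 * k + i \<in> {a. dejean a = x}} = {i. i < 19 \<and> (dejean k + \<mu> 0 ! i) mod 3 = x}"
      by (auto simp: dejean_block)
    then have *: "card {i. i < 19 \<and> 19 * k + i \<in> {a. dejean a = x}} =
        length (filter (\<lambda>i. (dejean k + \<mu> 0 ! i) mod 3 = x) [0..<19])"
      by (simp add: filter_upt_card)
    show "card {i. i < 19 \<and> 19 * k + i \<in> {a. dejean a = x}} \<le> 7"
    proof (cases "x < 3")
      case True
      from list_all_uptD[OF list_all_uptD[OF letter_check dejean_lt[of k]] True]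
      show ?thesis unfolding * .
    next
      case False
      then have "{a. dejean a = x} = {}" using dejean_lt by auto
      then show ?thesis by simp
    qed
  qed
  then show ?thesis by (simp add: Int_def conj_commute)
qed

lemma card_pair: "card {a. a < 19 * n \<and> dejean a = x \<and> dejean (Suc a) = y} \<le> 4 * n"
proof -
  let ?A = "{a. dejean a = x \<and> dejean (Suc a) = y}"
  have "card (?A \<inter> {..<19 * n}) \<le> 4 * n"
  proof (rule card_blocks)
    fix k
    define e where "e = (dejean (Suc k) + 3 - dejean k) mod 3"
    have "e \<in> {1, 2}"
      unfolding e_def using mod_3_diff[OF dejean_lt dejean_lt dejean_neq_Suc] .
    have "{i. i < 19 \<and> 19 * k + i \<in> ?A} =
      {i. i < 19 \<and> (dejean k + two_blocks e ! i) mod 3 = x \<and> (dejean k + two_blocks e ! Suc i) mod 3 = y}"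
      using two_blocks_nth[of _ k] two_blocks_nth[of "Suc _" k] by (auto simp: e_def)
    then have *: "card {i. i < 19 \<and> 19 * k + i \<in> ?A} =
        length (filter (\<lambda>i. (dejean k + two_blocks e ! i) mod 3 = x \<and>
          (dejean k + two_blocks e ! Suc i) mod 3 = y) [0..<19])"
      by (simp add: filter_upt_card)
    show "card {i. i < 19 \<and> 19 * k + i \<in> ?A} \<le> 4"
    proof (cases "x < 3 \<and> y < 3")
      case True
      have "list_all (\<lambda>x. list_all (\<lambda>y.
          length (filter (\<lambda>i. (dejean k + two_blocks e ! i) mod 3 = x \<and>
            (dejean k + two_blocks e ! Suc i) mod 3 = y) [0..<19]) \<le> 4) [0..<3]) [0..<3]"
        using list_all_uptD[OF pair_check dejean_lt[of k]] \<open>e \<in> {1, 2}\<close>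
        unfolding list_all_iff[of _ "[1, 2]"] by auto
      from list_all_uptD[OF list_all_uptD[OF this]] True show ?thesis unfolding * by blast
    next
      case False
      then have "\<not> (dejean a = x \<and> dejean (Suc a) = y)" for a using dejean_lt by auto
      then have "{i. i < 19 \<and> 19 * k + i \<in> ?A} = {}" by blast
      then show ?thesis by (simp only: card.empty)
    qed
  qed
  then show ?thesis by (simp add: Int_def conj_commute)
qed

lemma card_gapped:
  fixes A :: "nat set"
  assumes "finite A" "\<And>a b. a \<in> A \<Longrightarrow> b \<in> A \<Longrightarrow> a < b \<Longrightarrow> a + d \<le> b" "\<And>a. a \<in> A \<Longrightarrow> a < n" "0 < d"
  shows "card A * d < n + d"
  using assms
proof (induction A arbitrary: n rule: finite_linorder_max_induct)
  case (insert b A)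
  then have b: "b < n" and A: "\<And>a. a \<in> A \<Longrightarrow> a + d \<le> b" by auto
  show ?case
  proof (cases "A = {}")
    case False
    then have db: "d \<le> b" using A by fastforce
    have "a < b + 1 - d" if "a \<in> A" for a using A[OF that] by linarith
    then have "card A * d < b + 1 - d + d" using insert by blast
    then show ?thesis using insert.hyps b db \<open>0 < d\<close> by (auto simp: less_irrefl)
  qed (use b in simp)
qed simp

text \<open>A factor of F_{j+1} with m private letters has length at most 65m + 64, whereas 64
  copies of Y_j occur at least M times and gain at least 63M - 64; so this says that the factor
  loses. The spacing 4m/3 bounds what it covers by about 65 times 3M/4, and M \<ge> 10000 absorbs
  the additive terms.\<close>

lemma dejean_factor_card:
  assumes A: "A \<subseteq> {..<M}" and M: "M = 19 ^ e" "M \<ge> 10000" and m: "0 < m" "\<And>a. a \<in> A \<Longrightarrow> a + m \<le> M"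
    and eq: "\<And>a b t. a \<in> A \<Longrightarrow> b \<in> A \<Longrightarrow> t < m \<Longrightarrow> dejean (a + t) = dejean (b + t)"
    and two: "2 \<le> card A"
  shows "card A * (65 * m + 63) + 64 < 63 * M"
proof -
  let ?K = "card A"
  have fin: "finite A" using A finite_subset by blast
  have "e \<noteq> 0" using M by (cases e) auto
  then obtain n where n: "M = 19 * n" using M by (cases e) auto
  obtain a0 where a0: "a0 \<in> A" using two by fastforce
  \<comment> \<open>For m = 1, 2, 3 the spacing is only 2, 3, 4, and 128/2, 193/3, 258/4 all exceed
    63. The densities 7/19 of a letter and 4/19 of a pair replace it there.\<close>
  consider "m = 1" | "m = 2 \<or> m = 3" | "4 \<le> m" using m by linarith
  then show ?thesis
  proof cases
    case 1
    have "A \<subseteq> {a. a < 19 * n \<and> dejean a = dejean a0}"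
      using A[unfolded n] eq[OF _ a0, of _ 0] 1 by auto
    then have "?K \<le> 7 * n" by (rule order_trans[OF card_mono card_letter, rotated]) simp
    then have "?K * (65 * m + 63) \<le> 7 * n * 128" using 1 by simp
    then show ?thesis using n M(2) by simp
  next
    case 2
    have "A \<subseteq> {a. a < 19 * n \<and> dejean a = dejean a0 \<and> dejean (Suc a) = dejean (Suc a0)}" (is "_ \<subseteq> ?B")
      using A[unfolded n] eq[OF _ a0, of _ 0] eq[OF _ a0, of _ 1] 2 by auto
    then have K: "?K \<le> 4 * n" by (rule order_trans[OF card_mono card_pair, rotated]) simp
    have "?K * (65 * m + 63) \<le> 4 * n * 258" by (rule mult_mono[OF K]) (use 2 in auto)
    then show ?thesis using n M(2) by simp
  next
    case 3
    \<comment> \<open>The least integer that is at least 4m/3.\<close>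
    define d where "d = (4 * m + 2) div 3"
    have gap: "a + d \<le> b" if "a \<in> A" "b \<in> A" "a < b" for a b
    proof -
      have "dejean (a + t) = dejean (a + (b - a) + t)" if "t < m" for t
        using eq[OF \<open>a \<in> A\<close> \<open>b \<in> A\<close> that] \<open>a < b\<close> by simp
      then have "4 * m \<le> 3 * (b - a)" using dejean_repetition[of "b - a" m a] \<open>a < b\<close> by auto
      then show ?thesis unfolding d_def using \<open>a < b\<close> by linarith
    qed
    have mN: "m \<le> M" using m a0 by fastforce
    have "?K * d < (M + 1 - m) + d"
    proof (rule card_gapped[OF fin gap])
      show "\<And>a. a \<in> A \<Longrightarrow> a < M + 1 - m" using m mN by fastforce
    qed (use 3 in \<open>auto simp: d_def\<close>)
    then have "?K * d + m \<le> M + d" using mN by linarith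
    moreover obtain k where k: "?K = k + 2" using two by (metis add.commute le_Suc_ex)
    moreover have d3: "4 * m \<le> 3 * d" unfolding d_def by linarith
    ultimately have *: "k * d + d + m \<le> M" by (simp add: algebra_simps)
    have "4 * (k * m) \<le> 3 * (k * d)"
      using mult_left_mono[OF d3, of k] by (simp add: algebra_simps)
    then have **: "4 * (k * m) + 7 * m \<le> 3 * M" using * d3 by linarith
    have km: "4 * k \<le> k * m" using 3 by (simp add: mult.commute)
    have "?K * (65 * m + 63) = 65 * (k * m) + 63 * k + 130 * m + 126"
      unfolding k by (simp add: algebra_simps)
    then show ?thesis
    proof (cases "64 \<le> m")
      case True
      then have "64 * k \<le> k * m" by (simp add: mult.commute)
      then show ?thesis using \<open>_ = 65 * (k * m) + _ + _ + _\<close> ** M(2) by linarith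
    next
      case False
      then show ?thesis using \<open>_ = 65 * (k * m) + _ + _ + _\<close> ** km M(2) by linarith
    qed
  qed
qed

section \<open>Occurrences\<close>

lemma occurs_at_iff: "occurs_at v \<alpha> i \<longleftrightarrow> (\<exists>x y. \<alpha> = x @ v @ y \<and> length x = i)"
proof
  assume *: "occurs_at v \<alpha> i"
  have "\<alpha> = take i \<alpha> @ take (length v) (drop i \<alpha>) @ drop (length v) (drop i \<alpha>)"
    by (simp only: append_take_drop_id)
  then have "\<alpha> = take i \<alpha> @ v @ drop (length v) (drop i \<alpha>)"
    using * by (simp only: occurs_at_def)
  moreover have "length (take i \<alpha>) = i" using * by (simp add: occurs_at_def)
  ultimately show "\<exists>x y. \<alpha> = x @ v @ y \<and> length x = i" by blast
qed (auto simp: occurs_at_def)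

lemma occurs_at_nth: "occurs_at v \<alpha> i \<longleftrightarrow> i + length v \<le> length \<alpha> \<and> (\<forall>t<length v. \<alpha> ! (i + t) = v ! t)"
  unfolding occurs_at_def by (auto simp: list_eq_iff_nth_eq)

lemma occurs_at_sublist: "occurs_at v \<alpha> i \<Longrightarrow> sublist v \<alpha>"
  by (auto simp: occurs_at_iff sublist_def)

lemma sublist_occurs_at: "sublist v \<alpha> \<Longrightarrow> \<exists>i. occurs_at v \<alpha> i"
  by (auto simp: occurs_at_iff sublist_def)

definition packing :: "'a list \<Rightarrow> 'a list \<Rightarrow> nat set \<Rightarrow> bool" where
  "packing v \<alpha> I \<longleftrightarrow> (\<forall>i\<in>I. occurs_at v \<alpha> i) \<and> (\<forall>i\<in>I. \<forall>j\<in>I. i < j \<longrightarrow> i + length v \<le> j)"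

lemma packing_subset: "packing v \<alpha> I \<Longrightarrow> I \<subseteq> {..length \<alpha>}"
  by (auto simp: packing_def occurs_at_def)

lemma packing_finite: "packing v \<alpha> I \<Longrightarrow> finite I"
  by (rule finite_subset[OF packing_subset]) auto

lemma finite_packings: "finite {I. packing v \<alpha> I}"
proof (rule finite_subset)
  show "{I. packing v \<alpha> I} \<subseteq> Pow {..length \<alpha>}"
  proof
    fix I assume "I \<in> {I. packing v \<alpha> I}"
    then show "I \<in> Pow {..length \<alpha>}" using packing_subset[of v \<alpha> I] by simp
  qed
qed simp

lemma max_nonoverlapping_packing: "max_nonoverlapping v \<alpha> = Max (card ` {I. packing v \<alpha> I})"
  by (simp add: max_nonoverlapping_def packing_def)

lemma ex_packing: "\<exists>I. packing v \<alpha> I \<and> card I = max_nonoverlapping v \<alpha>"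
proof -
  have "packing v \<alpha> {}" by (simp add: packing_def)
  then have "card ` {I. packing v \<alpha> I} \<noteq> {}" by blast
  then have "Max (card ` {I. packing v \<alpha> I}) \<in> card ` {I. packing v \<alpha> I}"
    using finite_packings by (intro Max_in) auto
  then show ?thesis unfolding max_nonoverlapping_packing by auto
qed

lemma packing_card_le: "packing v \<alpha> I \<Longrightarrow> card I \<le> max_nonoverlapping v \<alpha>"
  unfolding max_nonoverlapping_packing using finite_packings by (intro Max_ge) auto

lemma max_nonoverlapping_length: "v \<noteq> [] \<Longrightarrow> max_nonoverlapping v \<alpha> * length v \<le> length \<alpha>"
proof -
  assume v: "v \<noteq> []"
  obtain I where I: "packing v \<alpha> I" "card I = max_nonoverlapping v \<alpha>" using ex_packing by blast
  show ?thesis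
  proof (cases "I = {}")
    case False
    then have le: "length v \<le> length \<alpha>" using I(1) by (auto simp: packing_def occurs_at_def)
    have "card I * length v < length \<alpha> + 1 - length v + length v"
      by (rule card_gapped) (use I v packing_finite in \<open>auto simp: packing_def occurs_at_def\<close>)
    then show ?thesis using I(2) le by simp
  qed (use I in auto)
qed

lemma max_nonoverlapping_eq_0: "\<not> sublist v \<alpha> \<Longrightarrow> max_nonoverlapping v \<alpha> = 0"
  using ex_packing[of v \<alpha>] occurs_at_sublist[of v \<alpha>] unfolding packing_def
  by (metis card.empty equals0I)

lemma max_nonoverlapping_pos_iff: "0 < max_nonoverlapping v \<alpha> \<longleftrightarrow> sublist v \<alpha>"
proof
  assume "sublist v \<alpha>"
  then obtain i where "occurs_at v \<alpha> i" using sublist_occurs_at by blast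
  then have "packing v \<alpha> {i}" by (simp add: packing_def)
  from packing_card_le[OF this] show "0 < max_nonoverlapping v \<alpha>" by simp
next
  show "0 < max_nonoverlapping v \<alpha> \<Longrightarrow> sublist v \<alpha>"
    using max_nonoverlapping_eq_0[of v \<alpha>] by auto
qed

text \<open>No occurrence of v covers the letter b, so a packing splits into one on each
  side.\<close>

lemma max_nonoverlapping_separator:
  assumes "b \<notin> set v"
  shows "max_nonoverlapping v (x @ b # y) \<le> max_nonoverlapping v x + max_nonoverlapping v y"
proof -
  obtain I where I: "packing v (x @ b # y) I" "card I = max_nonoverlapping v (x @ b # y)"
    using ex_packing by blast
  define I1 where "I1 = {i \<in> I. i + length v \<le> length x}"
  define I2 where "I2 = {i \<in> I. length x < i}"
  have "i + length v \<le> length x \<or> length x < i" if "i \<in> I" for i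
  proof (rule ccontr)
    assume *: "\<not> (i + length v \<le> length x \<or> length x < i)"
    have "occurs_at v (x @ b # y) i" using I that by (auto simp: packing_def)
    then have "\<forall>t<length v. (x @ b # y) ! (i + t) = v ! t" unfolding occurs_at_nth by blast
    moreover have "length x - i < length v" using * by linarith
    ultimately have "(x @ b # y) ! (i + (length x - i)) = v ! (length x - i)" by blast
    moreover have "i + (length x - i) = length x" using * by simp
    ultimately have "b = v ! (length x - i)" by (simp only: nth_append_length)
    then show False using assms * by auto
  qed
  then have "I = I1 \<union> I2" by (auto simp: I1_def I2_def)
  then have "card I \<le> card I1 + card I2" by (simp add: card_Un_le)
  moreover have "packing v x I1"
    using I(1) unfolding packing_def I1_def occurs_at_nth by (auto simp: nth_append)
  then have "card I1 \<le> max_nonoverlapping v x" by (rule packing_card_le)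
  moreover have "packing v y ((\<lambda>i. i - Suc (length x)) ` I2)"
    unfolding packing_def
  proof (intro conjI ballI impI)
    fix i assume "i \<in> (\<lambda>i. i - Suc (length x)) ` I2"
    then obtain k where "k \<in> I" "k = Suc (length x) + i" by (force simp: I2_def)
    then have "occurs_at v (x @ b # y) (Suc (length x) + i)" using I(1) by (auto simp: packing_def)
    then show "occurs_at v y i" unfolding occurs_at_nth by (auto simp: nth_append)
  next
    fix i j assume "i \<in> (\<lambda>i. i - Suc (length x)) ` I2" "j \<in> (\<lambda>i. i - Suc (length x)) ` I2" "i < j"
    then obtain k l where "k \<in> I" "k = Suc (length x) + i" "l \<in> I" "l = Suc (length x) + j"
      by (force simp: I2_def)
    then show "i + length v \<le> j" using I(1) \<open>i < j\<close> unfolding packing_def by fastforce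
  qed
  then have "card ((\<lambda>i. i - Suc (length x)) ` I2) \<le> max_nonoverlapping v y" by (rule packing_card_le)
  moreover have "inj_on (\<lambda>i. i - Suc (length x)) I2" by (auto simp: I2_def inj_on_def)
  ultimately show ?thesis using I(2) by (simp add: card_image)
qed

lemma max_nonoverlapping_append_ge:
  assumes "v \<noteq> []"
  shows "max_nonoverlapping v x + max_nonoverlapping v y \<le> max_nonoverlapping v (x @ y)"
proof -
  obtain I where I: "packing v x I" "card I = max_nonoverlapping v x" using ex_packing by blast
  obtain J where J: "packing v y J" "card J = max_nonoverlapping v y" using ex_packing by blast
  let ?J = "(\<lambda>i. length x + i) ` J"
  have lt: "i + length v \<le> length x" if "i \<in> I" for i
    using I(1) that by (auto simp: packing_def occurs_at_def)
  have "packing v (x @ y) (I \<union> ?J)"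
    unfolding packing_def
  proof (intro conjI ballI impI)
    fix i assume "i \<in> I \<union> ?J"
    then show "occurs_at v (x @ y) i"
      using I(1) J(1) unfolding packing_def occurs_at_nth by (auto simp: nth_append)
  next
    fix i j assume *: "i \<in> I \<union> ?J" "j \<in> I \<union> ?J" "i < j"
    show "i + length v \<le> j"
    proof (cases "i \<in> I")
      case True
      then show ?thesis using * I(1) lt[of i] by (auto simp: packing_def)
    next
      case False
      then obtain i' where i': "i' \<in> J" "i = length x + i'" using * by auto
      have "j \<notin> I" using lt[of j] * i' by auto
      then obtain j' where "j' \<in> J" "j = length x + j'" using * by auto
      then show ?thesis using i' J(1) * unfolding packing_def by fastforce
    qed
  qed
  then have "card (I \<union> ?J) \<le> max_nonoverlapping v (x @ y)" by (rule packing_card_le)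
  moreover have "I \<inter> ?J = {}" using lt assms by fastforce
  then have "card (I \<union> ?J) = card I + card ?J"
    using packing_finite[OF I(1)] packing_finite[OF J(1)] by (intro card_Un_disjoint) auto
  moreover have "card ?J = card J" by (rule card_image) (auto simp: inj_on_def)
  ultimately show ?thesis using I(2) J(2) by simp
qed

lemma max_nonoverlapping_replicate:
  assumes "0 < k"
  shows "max_nonoverlapping (replicate k a) (replicate m a) = m div k"
proof (rule antisym)
  have "max_nonoverlapping (replicate k a) (replicate m a) * k \<le> m"
    using max_nonoverlapping_length[of "replicate k a" "replicate m a"] assms by simp
  then show "max_nonoverlapping (replicate k a) (replicate m a) \<le> m div k"
    using assms by (simp add: less_eq_div_iff_mult_less_eq)
next
  let ?I = "(\<lambda>t. t * k) ` {..<m div k}"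
  have *: "t * k + k \<le> m" if "t < m div k" for t
  proof -
    have "Suc t * k \<le> m div k * k" by (rule mult_le_mono1) (use that in simp)
    also have "\<dots> \<le> m" by simp
    finally show ?thesis by simp
  qed
  have "packing (replicate k a) (replicate m a) ?I"
    unfolding packing_def occurs_at_nth
  proof (intro conjI ballI impI)
    fix i j assume "i \<in> ?I" "j \<in> ?I" "i < j"
    then obtain t u where tu: "i = t * k" "j = u * k" "t < u" by auto
    then have "Suc t * k \<le> u * k" by (intro mult_le_mono1) auto
    then show "i + length (replicate k a) \<le> j" using tu by simp
  qed (use * in \<open>fastforce+\<close>)
  moreover have "card ?I = m div k" using assms by (subst card_image) (auto simp: inj_on_def)
  ultimately show "m div k \<le> max_nonoverlapping (replicate k a) (replicate m a)"
    using packing_card_le by metis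
qed

definition places :: "'t grammar \<Rightarrow> 't symbol list \<Rightarrow> (nat \<times> nat) set" where
  "places G v = {(A, i). A \<in> dom (rules G) \<and> occurs_at v (the (rules G A)) i}"

text \<open>The weak form in which eligibility is used after the forced rounds: the two places may
  lie in one right-hand side or in two, and overlaps are not looked at.\<close>

lemma occ_count_two_places:
  assumes "2 \<le> occ_count G v"
  shows "\<exists>p\<in>places G v. \<exists>q\<in>places G v. p \<noteq> q"
proof (rule ccontr)
  assume "\<not> ?thesis"
  then have uniq: "p = q" if "p \<in> places G v" "q \<in> places G v" for p q using that by blast
  have "occ_count G v = (\<Sum>A\<in>dom (rules G). max_nonoverlapping v (the (rules G A)))"
    by (simp add: occ_count_def)
  have le1: "max_nonoverlapping v (the (rules G A)) \<le> 1" if "A \<in> dom (rules G)" for A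
  proof -
    obtain I where I: "packing v (the (rules G A)) I" "card I = max_nonoverlapping v (the (rules G A))"
      using ex_packing by blast
    have "i = j" if "i \<in> I" "j \<in> I" for i j
      using uniq[of "(A, i)" "(A, j)"] that I(1) \<open>A \<in> _\<close> by (auto simp: packing_def places_def)
    then have "card I \<le> 1" using card_le_Suc0_iff_eq[OF packing_finite[OF I(1)]] by auto
    then show ?thesis using I by simp
  qed
  let ?S = "{A \<in> dom (rules G). max_nonoverlapping v (the (rules G A)) \<noteq> 0}"
  have "A = B" if "A \<in> ?S" "B \<in> ?S" for A B
  proof -
    have "\<exists>i. (C, i) \<in> places G v" if "C \<in> ?S" for C
      using that sublist_occurs_at[of v "the (rules G C)"]
        max_nonoverlapping_eq_0[of v "the (rules G C)"] by (auto simp: places_def)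
    from this[OF that(1)] this[OF that(2)] show ?thesis using uniq by blast
  qed
  then have S: "?S = {} \<or> (\<exists>A. ?S = {A})" by blast
  \<comment> \<open>A sum over an infinite set is 0, so a count of at least 2 forces
    finiteness.\<close>
  have fin: "finite (dom (rules G))"
    using assms unfolding occ_count_def by (metis sum.infinite not_numeral_le_zero)
  have "occ_count G v = sum (\<lambda>A. max_nonoverlapping v (the (rules G A))) ?S"
    unfolding occ_count_def by (rule sum.mono_neutral_right) (use fin in auto)
  also have "\<dots> \<le> 1" using S le1
  proof (elim disjE exE)
    fix A assume "?S = {A}"
    moreover then have "A \<in> dom (rules G)" by blast
    ultimately show ?thesis using le1[of A] by simp
  next
    assume "?S = {}" then show ?thesis by simp
  qed
  finally show False using assms by simp
qed


section \<open>Replacement\<close>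

lemma replace_factor_no_sublist: "\<not> sublist v \<alpha> \<Longrightarrow> replace_factor v y \<alpha> = \<alpha>"
proof (induction v y \<alpha> rule: replace_factor.induct)
  case (2 v y x xs)
  have "\<not> prefix v (x # xs)" using 2(3) prefix_imp_sublist by blast
  moreover have "\<not> sublist v xs" using 2(3) by (simp add: sublist_Cons_right)
  ultimately show ?case using 2(2) by simp
qed auto

lemma replace_factor_no_set: "v \<noteq> [] \<Longrightarrow> \<not> set v \<subseteq> set \<alpha> \<Longrightarrow> replace_factor v y \<alpha> = \<alpha>"
  using replace_factor_no_sublist[of v \<alpha> y] set_mono_sublist[of v \<alpha>] by auto

lemma prefix_separator: "b \<notin> set v \<Longrightarrow> prefix v (x @ b # z) \<longleftrightarrow> prefix v x"
proof (induction x arbitrary: v)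
  case Nil
  then show ?case by (cases v) auto
next
  case (Cons a x)
  then show ?case by (cases v) auto
qed

lemma replace_factor_separator:
  assumes "b \<notin> set v"
  shows "replace_factor v y (x @ b # z) = replace_factor v y x @ b # replace_factor v y z"
proof (induction "length x" arbitrary: x rule: less_induct)
  case less
  show ?case
  proof (cases x)
    case Nil
    then show ?thesis using prefix_separator[OF assms, of "[]" z] by simp
  next
    case (Cons a x')
    have p: "prefix v (a # x' @ b # z) \<longleftrightarrow> prefix v (a # x')"
      using prefix_separator[OF assms, of "a # x'" z] by simp
    show ?thesis
    proof (cases "v \<noteq> [] \<and> prefix v (a # x')")
      case True
      then have "length v \<le> length (a # x')" using prefix_length_le by blast
      then have d: "drop (length v) (a # x' @ b # z) = drop (length v) (a # x') @ b # z"
        using drop_append[of "length v" "a # x'" "b # z"] by simp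
      have "length (drop (length v) (a # x')) < length x" using True Cons by simp
      from less[OF this] show ?thesis using True p d Cons by simp
    next
      case False
      then show ?thesis using less[of x'] Cons p by auto
    qed
  qed
qed

text \<open>Scanning from the left puts the new symbols first and the remainder behind them; this is
  why targets turn into base 64 expansions with the leading digit first.
  \<open>a \<notin> set w\<close> keeps the remainder from being completed.\<close>

lemma replace_factor_replicate:
  assumes "0 < k" "a \<notin> set w"
  shows "replace_factor (replicate k a) y (replicate m a @ w) =
    replicate (m div k) y @ replicate (m mod k) a @ w"
proof (induction m rule: less_induct)
  case (less m)
  have "\<not> set (replicate k a) \<subseteq> set w" using assms by simp
  then have w: "replace_factor (replicate k a) y w = w"
    using assms(1) by (intro replace_factor_no_set) auto
  show ?case
  proof (cases "m < k")
    case True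
    have "replace_factor (replicate k a) y (replicate n a @ w) = replicate n a @ w" if "n < k" for n
      using that
    proof (induction n)
      case (Suc n)
      have "\<not> prefix (replicate k a) (replicate (Suc n) a @ w)"
      proof
        assume "prefix (replicate k a) (replicate (Suc n) a @ w)"
        then obtain z where z: "replicate (Suc n) a @ w = replicate k a @ z" by (auto simp: prefix_def)
        then have "(replicate (Suc n) a @ w) ! Suc n = a" using Suc.prems by (simp add: nth_append)
        moreover have "length (replicate (Suc n) a @ w) = length (replicate k a @ z)" using z by (rule arg_cong)
        then have "w \<noteq> []" using Suc.prems by auto
        ultimately have "w ! 0 = a" "w \<noteq> []" by (simp_all add: nth_append)
        then show False using assms(2) by (metis length_greater_0_conv nth_mem)
      qed
      then show ?case using Suc by simp
    qed (use w in simp)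
    then show ?thesis using True by simp
  next
    case False
    have p: "prefix (replicate k a) (replicate m a @ w)"
      using False by (metis append_assoc le_add_diff_inverse not_less prefixI replicate_add)
    have d: "drop k (replicate m a @ w) = replicate (m - k) a @ w" using False by simp
    obtain m' where m': "m = Suc m'" using False assms by (cases m) auto
    have "replace_factor (replicate k a) y (replicate m a @ w) =
        y # replace_factor (replicate k a) y (replicate (m - k) a @ w)"
      using p d assms(1) unfolding m' by simp
    also have "\<dots> = y # replicate ((m - k) div k) y @ replicate ((m - k) mod k) a @ w"
      using less[of "m - k"] False assms by simp
    also have "\<dots> = replicate (m div k) y @ replicate (m mod k) a @ w"
      using False assms(1) by (simp add: le_div_geq le_mod_geq)
    finally show ?thesis .
  qed
qed

lemma set_replace_factor: "set (replace_factor v y \<alpha>) \<subseteq> insert y (set \<alpha>)"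
proof (induction v y \<alpha> rule: replace_factor.induct)
  case (2 v y x xs)
  show ?case
  proof (cases "v \<noteq> [] \<and> prefix v (x # xs)")
    case True
    then show ?thesis using 2(1) set_drop_subset[of "length v" "x # xs"] by fastforce
  next
    case False
    then show ?thesis using 2(2) by auto
  qed
qed simp

lemma replace_factor_eq_Nil: "replace_factor v y \<alpha> = [] \<longleftrightarrow> \<alpha> = []"
  by (cases \<alpha>) auto

lemma hd_replace_factor: "\<alpha> \<noteq> [] \<Longrightarrow> hd (replace_factor v y \<alpha>) \<in> {hd \<alpha>, y}"
  by (cases \<alpha>) auto

text \<open>To be applied with P forbidding two adjacent symbols Y_i, and with y a fresh nonterminal
  that is none of them.\<close>

lemma successively_replace_factor:
  assumes "successively P \<alpha>" "\<And>x. P x y" "\<And>x. P y x"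
  shows "successively P (replace_factor v y \<alpha>)"
  using assms
proof (induction v y \<alpha> rule: replace_factor.induct)
  case (2 v y x xs)
  show ?case
  proof (cases "v \<noteq> [] \<and> prefix v (x # xs)")
    case True
    obtain z where "x # xs = z @ drop (length v) (x # xs)" by (metis append_take_drop_id)
    then have "successively P (drop (length v) (x # xs))"
      using 2(3) by (metis successively_append_iff)
    then have "successively P (replace_factor v y (drop (length v) (x # xs)))"
      using 2(1) True 2(4,5) by blast
    then show ?thesis using True 2(5) by (auto simp: successively_Cons)
  next
    case False
    have "successively P (replace_factor v y xs)"
      using 2(2) False 2(3-5) by (auto simp: successively_Cons)
    moreover have "xs \<noteq> [] \<Longrightarrow> P x (hd (replace_factor v y xs))"
      using hd_replace_factor[of xs v y] 2(3,4) by (auto simp: successively_Cons)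
    ultimately show ?thesis using False by (auto simp: successively_Cons replace_factor_eq_Nil)
  qed
qed auto

lemma concat_map_replace_factor:
  assumes "y \<notin> set \<alpha>"
  shows "concat (map (f(y := concat (map f v))) (replace_factor v y \<alpha>)) = concat (map f \<alpha>)"
  using assms
proof (induction v y \<alpha> rule: replace_factor.induct)
  case (2 v y x xs)
  show ?case
  proof (cases "v \<noteq> [] \<and> prefix v (x # xs)")
    case True
    then obtain z where z: "x # xs = v @ z" by (auto simp: prefix_def)
    then have d: "drop (length v) (x # xs) = z" by simp
    then have r: "replace_factor v y (x # xs) = y # replace_factor v y z" using True by simp
    have "y \<notin> set z" using 2(3) z by (metis Un_iff set_append)
    then have IH: "concat (map (f(y := concat (map f v))) (replace_factor v y z)) = concat (map f z)"
      using 2(1)[OF True] \<open>y \<notin> set z\<close> unfolding d by blast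
    have "concat (map f (x # xs)) = concat (map f v) @ concat (map f z)" unfolding z by simp
    then show ?thesis unfolding r by (simp only: list.map concat.simps fun_upd_same IH)
  next
    case False
    then show ?thesis using 2 by auto
  qed
qed simp


section \<open>Separators\<close>

text \<open>\<open>join_sep\<close> for words of symbols. Eligible factors will contain no
  separator, so the start rule keeps this shape and rounds act on the segments one by one.\<close>

fun sep_join :: "nat \<Rightarrow> letter symbol list list \<Rightarrow> letter symbol list" where
  "sep_join k [] = []"
| "sep_join k [u] = u"
| "sep_join k (u # u' # us) = u @ T (Sep k) # sep_join (Suc k) (u' # us)"

definition no_sep :: "letter symbol list \<Rightarrow> bool" where
  "no_sep u \<longleftrightarrow> (\<forall>k. T (Sep k) \<notin> set u)"

lemma map_T_join_sep: "map T (join_sep k us) = sep_join k (map (map T) us)"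
  by (induction k us rule: join_sep.induct) auto

lemma max_nonoverlapping_sep_join_le:
  assumes "no_sep v" "v \<noteq> []"
  shows "max_nonoverlapping v (sep_join k us) \<le> (\<Sum>u\<leftarrow>us. max_nonoverlapping v u)"
proof (induction k us rule: sep_join.induct)
  case (1 k)
  then show ?case using max_nonoverlapping_length[OF assms(2), of "[]"] assms(2) by simp
next
  case (3 k u u' us)
  have "T (Sep k) \<notin> set v" using assms by (simp add: no_sep_def)
  from max_nonoverlapping_separator[OF this, of u "sep_join (Suc k) (u' # us)"] 3
  show ?case by simp
qed simp

lemma max_nonoverlapping_sep_join_ge:
  assumes "v \<noteq> []"
  shows "(\<Sum>u\<leftarrow>us. max_nonoverlapping v u) \<le> max_nonoverlapping v (sep_join k us)"
proof (induction k us rule: sep_join.induct)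
  case (3 k u u' us)
  have "max_nonoverlapping v u + max_nonoverlapping v ([T (Sep k)] @ sep_join (Suc k) (u' # us))
      \<le> max_nonoverlapping v (sep_join k (u # u' # us))"
    using max_nonoverlapping_append_ge[OF assms] by simp
  moreover have "max_nonoverlapping v (sep_join (Suc k) (u' # us))
      \<le> max_nonoverlapping v ([T (Sep k)] @ sep_join (Suc k) (u' # us))"
    using max_nonoverlapping_append_ge[OF assms, of "[T (Sep k)]" "sep_join (Suc k) (u' # us)"] by linarith
  ultimately show ?case using 3 by simp
qed simp_all

lemma replace_factor_sep_join:
  assumes "no_sep v"
  shows "replace_factor v y (sep_join k us) = sep_join k (map (replace_factor v y) us)"
  by (induction k us rule: sep_join.induct)
    (use assms in \<open>auto simp: replace_factor_separator no_sep_def\<close>)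

lemma set_sep_join: "set (sep_join k us) \<subseteq> (\<Union>u\<in>set us. set u) \<union> T ` Sep ` {k..<k + length us - 1}"
  by (induction k us rule: sep_join.induct) auto

lemma sublist_sep_join:
  assumes "sublist v (sep_join k us)" "no_sep v" "v \<noteq> []"
  shows "\<exists>u\<in>set us. sublist v u"
proof -
  have "0 < (\<Sum>u\<leftarrow>us. max_nonoverlapping v u)"
    using assms max_nonoverlapping_sep_join_le[of v k us] max_nonoverlapping_pos_iff[of v "sep_join k us"]
    by simp
  moreover have "0 < (\<Sum>u\<leftarrow>us. f u) \<Longrightarrow> \<exists>u\<in>set us. 0 < f u" for f :: "letter symbol list \<Rightarrow> nat"
    by (induction us) auto
  ultimately obtain u where "u \<in> set us" "0 < max_nonoverlapping v u" by blast
  then show ?thesis using max_nonoverlapping_pos_iff by blast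
qed

text \<open>\<open>Suc\<close> accounts for the separator behind each segment.\<close>

definition sep_start :: "'a list list \<Rightarrow> nat \<Rightarrow> nat" where
  "sep_start us i = (\<Sum>u\<leftarrow>take i us. Suc (length u))"

lemma occurs_at_sep_join:
  assumes "occurs_at v (sep_join k us) p" "no_sep v" "v \<noteq> []"
  shows "\<exists>i x. i < length us \<and> occurs_at v (us ! i) x \<and> p = sep_start us i + x"
  using assms(1)
proof (induction k us arbitrary: p rule: sep_join.induct)
  case (1 k)
  then show ?case using assms by (auto simp: occurs_at_def)
next
  case (2 k u)
  then show ?case by (auto simp: sep_start_def)
next
  case (3 k u u' us)
  show ?case
  proof (cases "p + length v \<le> length u")
    case True
    then have "occurs_at v u p" using 3(2) unfolding occurs_at_nth by (auto simp: nth_append)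
    then have "0 < length (u # u' # us) \<and> occurs_at v ((u # u' # us) ! 0) p \<and> p = sep_start (u # u' # us) 0 + p"
      by (auto simp: sep_start_def)
    then show ?thesis by blast
  next
    case False
    have lt: "length u < p"
    proof (rule ccontr)
      assume *: "\<not> length u < p"
      have "\<forall>t<length v. (u @ T (Sep k) # sep_join (Suc k) (u' # us)) ! (p + t) = v ! t"
        using 3(2) unfolding occurs_at_nth by simp
      moreover have "length u - p < length v" using False * by linarith
      ultimately have "(u @ T (Sep k) # sep_join (Suc k) (u' # us)) ! (p + (length u - p)) = v ! (length u - p)"
        by blast
      moreover have "p + (length u - p) = length u" using * by simp
      ultimately have "T (Sep k) = v ! (length u - p)" by (simp only: nth_append_length)
      then show False using assms(2) \<open>length u - p < length v\<close> unfolding no_sep_def by (metis nth_mem)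
    qed
    then obtain p' where p': "p = Suc (length u) + p'" by (metis Suc_leI le_Suc_ex)
    have "occurs_at v (sep_join (Suc k) (u' # us)) p'"
      using 3(2) unfolding p' occurs_at_nth by (auto simp: nth_append)
    from 3(1)[OF this] obtain i x where "i < length (u' # us)" "occurs_at v ((u' # us) ! i) x"
      "p' = sep_start (u' # us) i + x" by blast
    then have "Suc i < length (u # u' # us) \<and> occurs_at v ((u # u' # us) ! Suc i) x \<and>
        p = sep_start (u # u' # us) (Suc i) + x"
      by (auto simp: p' sep_start_def)
    then show ?thesis by blast
  qed
qed

text \<open>The separators are pairwise distinct. This is why a repeated factor contains
  none.\<close>

lemma sep_join_nth_inj:
  assumes "\<And>u. u \<in> set us \<Longrightarrow> no_sep u"
    and "p < length (sep_join k us)" "q < length (sep_join k us)"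
    and "sep_join k us ! p = T (Sep l)" "sep_join k us ! q = T (Sep l)"
  shows "p = q"
  using assms
proof (induction k us arbitrary: p q rule: sep_join.induct)
  case (2 k u)
  then show ?case by (metis list.set_intros(1) no_sep_def nth_mem sep_join.simps(2))
next
  case (3 k u u' us)
  let ?r = "sep_join (Suc k) (u' # us)"
  have u: "T (Sep l) \<notin> set u" using 3(2)[of u] by (auto simp: no_sep_def)
  have "length u \<le> s" if "sep_join k (u # u' # us) ! s = T (Sep l)" for s
  proof (rule ccontr)
    assume "\<not> length u \<le> s"
    then have "s < length u" "u ! s = T (Sep l)" using that by (simp_all add: nth_append)
    then show False using u nth_mem by metis
  qed
  from this[OF 3(5)] this[OF 3(6)] have ge: "length u \<le> p \<and> length u \<le> q" by simp
  have r: "T (Sep k) \<notin> set ?r"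
  proof
    assume "T (Sep k) \<in> set ?r"
    then show False using set_sep_join[of "Suc k" "u' # us"] 3(2) by (auto simp: no_sep_def)
  qed
  show ?case
  proof (cases "l = k")
    case True
    have "s = length u" if "length u \<le> s" "s < length (sep_join k (u # u' # us))"
      "sep_join k (u # u' # us) ! s = T (Sep l)" for s
    proof (rule ccontr)
      assume "s \<noteq> length u"
      then have "s = Suc (length u) + (s - Suc (length u))" using that(1) by linarith
      then obtain s' where "s = Suc (length u) + s'" by blast
      then have "?r ! s' = T (Sep k)" "s' < length ?r" using that True by (auto simp: nth_append)
      then show False using r nth_mem by metis
    qed
    then show ?thesis using ge 3(3-6) by metis
  next
    case False
    have "\<exists>s'. s = Suc (length u) + s' \<and> s' < length ?r \<and> ?r ! s' = T (Sep l)" if "length u \<le> s"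
      "s < length (sep_join k (u # u' # us))" "sep_join k (u # u' # us) ! s = T (Sep l)" for s
    proof -
      have "s \<noteq> length u" using that False by (auto simp: nth_append)
      then have "s = Suc (length u) + (s - Suc (length u))" using that(1) by linarith
      then obtain s' where "s = Suc (length u) + s'" by blast
      then show ?thesis using that by (auto simp: nth_append)
    qed
    from this[of p] this[of q] ge 3(3-6) obtain p' q' where
      "p = Suc (length u) + p'" "p' < length ?r" "?r ! p' = T (Sep l)"
      "q = Suc (length u) + q'" "q' < length ?r" "?r ! q' = T (Sep l)" by blast
    then show ?thesis using 3(1)[of p' q'] 3(2) by auto
  qed
qed auto

section \<open>The expansion of a grammar into an earlier one\<close>

definition closed :: "'t grammar \<Rightarrow> bool" where
  "closed G \<longleftrightarrow> (\<forall>A \<alpha> B. rules G A = Some \<alpha> \<longrightarrow> N B \<in> set \<alpha> \<longrightarrow> B \<in> dom (rules G))"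

text \<open>\<open>grammar_refines G0 f G\<close>: expanding by \<open>f\<close> the nonterminals that \<open>G\<close> has in addition to those of
  \<open>G0\<close> turns the rules of \<open>G\<close> into the rules of \<open>G0\<close>.\<close>

definition grammar_refines :: "'t grammar \<Rightarrow> ('t symbol \<Rightarrow> 't symbol list) \<Rightarrow> 't grammar \<Rightarrow> bool" where
  "grammar_refines G0 f G \<longleftrightarrow> closed G \<and> dom (rules G0) \<subseteq> dom (rules G) \<and>
    (\<forall>t. f (T t) = [T t]) \<and> (\<forall>A\<in>dom (rules G0). f (N A) = [N A]) \<and> (\<forall>X. f X \<noteq> []) \<and>
    (\<forall>A\<in>dom (rules G0). concat (map f (the (rules G A))) = the (rules G0 A)) \<and>
    (\<forall>A\<in>dom (rules G) - dom (rules G0). concat (map f (the (rules G A))) = f (N A) \<and>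
      (\<exists>p\<in>places G0 (f (N A)). \<exists>q\<in>places G0 (f (N A)). p \<noteq> q))"

lemma grammar_refines_refl: "closed G \<Longrightarrow> grammar_refines G (\<lambda>X. [X]) G"
proof -
  have "concat (map (\<lambda>X. [X]) \<alpha>) = \<alpha>" for \<alpha> :: "'a symbol list" by (induction \<alpha>) auto
  then show "closed G \<Longrightarrow> ?thesis" by (simp add: grammar_refines_def)
qed

lemma occurs_at_concat_map:
  assumes "occurs_at v \<alpha> i"
  shows "occurs_at (concat (map f v)) (concat (map f \<alpha>)) (length (concat (map f (take i \<alpha>))))"
proof -
  obtain x y where "\<alpha> = x @ v @ y" "length x = i" using assms by (auto simp: occurs_at_iff)
  then show ?thesis unfolding occurs_at_iff by auto
qed

lemma occurs_at_trans: "occurs_at u v i \<Longrightarrow> occurs_at v w j \<Longrightarrow> occurs_at u w (j + i)"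
  unfolding occurs_at_nth by (auto simp: add.assoc)

lemma length_concat_map_strict:
  assumes "\<And>X. f X \<noteq> []" "i < j" "j \<le> length \<alpha>"
  shows "length (concat (map f (take i \<alpha>))) < length (concat (map f (take j \<alpha>)))"
proof -
  obtain k where k: "j = i + Suc k" using assms(2) by (metis less_imp_Suc_add add_Suc_right)
  have i: "i < length \<alpha>" using assms by simp
  then have "take j \<alpha> = take i \<alpha> @ \<alpha> ! i # take k (drop (Suc i) \<alpha>)"
    unfolding k take_add by (simp add: Cons_nth_drop_Suc[symmetric])
  then show ?thesis using assms(1)[of "\<alpha> ! i"] by simp
qed

text \<open>A place of v inside a new rule is carried along by the two places of the expansion of
  that rule. Two places inside old rules stay distinct because \<open>f\<close> never yields the
  empty word.\<close>

lemma grammar_refines_two_places: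
  assumes ref: "grammar_refines G0 f G" and two: "2 \<le> occ_count G v" and v: "v \<noteq> []"
  shows "\<exists>p\<in>places G0 (concat (map f v)). \<exists>q\<in>places G0 (concat (map f v)). p \<noteq> q"
proof -
  obtain A i B j where pq: "(A, i) \<in> places G v" "(B, j) \<in> places G v" "(A, i) \<noteq> (B, j)"
    using occ_count_two_places[OF two] by (metis surj_pair)
  have new: ?thesis if C: "(C, k) \<in> places G v" "C \<notin> dom (rules G0)" for C k
  proof -
    have "C \<in> dom (rules G) - dom (rules G0)" "occurs_at v (the (rules G C)) k"
      using C by (auto simp: places_def)
    then obtain p q where "p \<in> places G0 (f (N C))" "q \<in> places G0 (f (N C))" "p \<noteq> q"
      and e: "concat (map f (the (rules G C))) = f (N C)"
      using ref unfolding grammar_refines_def by blast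
    moreover obtain x where x: "occurs_at (concat (map f v)) (f (N C)) x"
      using occurs_at_concat_map[OF \<open>occurs_at v (the (rules G C)) k\<close>, of f] unfolding e by blast
    have "(fst p, snd p + x) \<in> places G0 (concat (map f v))" if "p \<in> places G0 (f (N C))" for p
      using that occurs_at_trans[OF x] by (auto simp: places_def)
    ultimately have "(fst p, snd p + x) \<in> places G0 (concat (map f v))"
      "(fst q, snd q + x) \<in> places G0 (concat (map f v))" "(fst p, snd p + x) \<noteq> (fst q, snd q + x)"
      by (auto simp: prod_eq_iff)
    then show ?thesis by blast
  qed
  show ?thesis
  proof (cases "A \<in> dom (rules G0) \<and> B \<in> dom (rules G0)")
    case True
    let ?l = "\<lambda>A i. length (concat (map f (take i (the (rules G A)))))"
    have old: "(C, ?l C k) \<in> places G0 (concat (map f v))"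
      if "(C, k) \<in> places G v" "C \<in> dom (rules G0)" for C k
      using that ref occurs_at_concat_map[of v "the (rules G C)" k f]
      unfolding grammar_refines_def places_def by auto
    have ne: "f X \<noteq> []" for X using ref by (simp add: grammar_refines_def)
    have "(A, ?l A i) \<noteq> (B, ?l B j)"
    proof
      assume *: "(A, ?l A i) = (B, ?l B j)"
      have "i \<le> length (the (rules G A))" "j \<le> length (the (rules G B))"
        using pq by (auto simp: places_def occurs_at_def)
      then show False using * pq(3) length_concat_map_strict[of f, OF ne]
        by (metis less_irrefl nat_neq_iff prod.inject)
    qed
    then show ?thesis using old[OF pq(1)] old[OF pq(2)] True by blast
  next
    case False
    then show ?thesis using new pq by blast
  qed
qed

lemma grammar_refines_step:
  assumes ref: "grammar_refines G0 f G" and step: "greedy_step G G'"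
  shows "\<exists>f'. grammar_refines G0 f' G'"
proof -
  obtain v Y where v: "eligible G v" and Y: "Y \<notin> dom (rules G)" and G': "G' = replace_step v Y G"
    using step unfolding greedy_step_def by blast
  have cl: "closed G" using ref by (simp add: grammar_refines_def)
  have v2: "v \<noteq> []" "2 \<le> occ_count G v" using v by (auto simp: eligible_def)
  \<comment> \<open>The new nonterminal expands to the expansion of v, which undoes the replacement
    in every rule.\<close>
  define f' where "f' = f(N Y := concat (map f v))"
  have Y0: "Y \<notin> dom (rules G0)" using ref Y by (auto simp: grammar_refines_def)
  have fresh: "N Y \<notin> set (the (rules G A))" if "A \<in> dom (rules G)" for A
    using cl that Y unfolding closed_def by force
  obtain A \<alpha> where A: "rules G A = Some \<alpha>" "sublist v \<alpha>" using v by (auto simp: eligible_def ran_def)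
  have setv: "set v \<subseteq> set \<alpha>" using A set_mono_sublist by blast
  then have fv: "N Y \<notin> set v" using fresh[of A] A by auto
  have map_v: "map f' v = map f v" using fv by (auto simp: f'_def)
  have dom': "dom (rules G') = insert Y (dom (rules G))"
    unfolding G' replace_step_def by (auto split: if_splits)
  have rules': "the (rules G' C) = replace_factor v (N Y) (the (rules G C))" if "C \<in> dom (rules G)" for C
    using that Y unfolding G' replace_step_def by auto
  have rulesY: "rules G' Y = Some v" unfolding G' replace_step_def by simp
  have exp: "concat (map f' (the (rules G' C))) = concat (map f (the (rules G C)))" if "C \<in> dom (rules G)" for C
    unfolding rules'[OF that] f'_def by (rule concat_map_replace_factor) (rule fresh[OF that])
  have "grammar_refines G0 f' G'"
    unfolding grammar_refines_def
  proof (intro conjI ballI allI)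
    show "closed G'"
      unfolding closed_def
    proof (intro allI impI)
      fix C \<beta> B assume C: "rules G' C = Some \<beta>" "N B \<in> set \<beta>"
      show "B \<in> dom (rules G')"
      proof (cases "C = Y")
        case True
        then have "N B \<in> set \<alpha>" using C rulesY setv by auto
        then show ?thesis using cl A(1) dom' unfolding closed_def by blast
      next
        case False
        then have Cd: "C \<in> dom (rules G)" using C(1) dom' by blast
        then have "N B \<in> insert (N Y) (set (the (rules G C)))"
          using C rules'[OF Cd] set_replace_factor[of v "N Y" "the (rules G C)"] by auto
        moreover have "N B \<in> set (the (rules G C)) \<Longrightarrow> B \<in> dom (rules G)"
          using cl Cd unfolding closed_def by (metis domIff option.collapse)
        ultimately show ?thesis using dom' by auto
      qed
    qed
    show "dom (rules G0) \<subseteq> dom (rules G')" using ref dom' by (auto simp: grammar_refines_def)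
    show "f' (T t) = [T t]" for t using ref by (simp add: grammar_refines_def f'_def)
    show "f' (N A) = [N A]" if "A \<in> dom (rules G0)" for A
      using ref that Y0 by (auto simp: grammar_refines_def f'_def)
    show "f' X \<noteq> []" for X using ref v2(1) by (cases v) (auto simp: grammar_refines_def f'_def)
    show "concat (map f' (the (rules G' A))) = the (rules G0 A)" if "A \<in> dom (rules G0)" for A
      using exp[of A] that ref unfolding grammar_refines_def by (metis subsetD)
    fix C assume C: "C \<in> dom (rules G') - dom (rules G0)"
    show "concat (map f' (the (rules G' C))) = f' (N C)"
    proof (cases "C = Y")
      case True
      then have "the (rules G' C) = v" "f' (N C) = concat (map f v)" using rulesY by (simp_all add: f'_def)
      then show ?thesis by (simp only: map_v)
    next
      case False
      then show ?thesis using C dom' exp[of C] ref by (simp add: grammar_refines_def f'_def)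
    qed
    show "\<exists>p\<in>places G0 (f' (N C)). \<exists>q\<in>places G0 (f' (N C)). p \<noteq> q"
    proof (cases "C = Y")
      case True
      then show ?thesis using grammar_refines_two_places[OF ref v2(2,1)] by (simp add: f'_def)
    next
      case False
      then show ?thesis using C dom' ref by (simp add: grammar_refines_def f'_def)
    qed
  qed
  then show ?thesis by blast
qed

lemma grammar_refines_steps:
  assumes "greedy_step\<^sup>*\<^sup>* G0 G" "closed G0"
  shows "\<exists>f. grammar_refines G0 f G"
  using assms by (induction rule: rtranclp_induct) (blast intro: grammar_refines_refl grammar_refines_step)+

section \<open>Words of runs and digits\<close>

lemma run_nth:
  fixes b :: "'c \<Rightarrow> 'a" and y :: 'a
  defines "F \<equiv> \<lambda>xs. concat (map (\<lambda>c. replicate 64 y @ [b c]) xs)"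
  shows "length (F xs) = 65 * length xs"
    and "p < length (F xs) \<Longrightarrow> F xs ! p = (if p mod 65 = 64 then b (xs ! (p div 65)) else y)"
proof -
  have len: "length (F xs) = 65 * length xs" for xs by (induction xs) (auto simp: F_def)
  show "length (F xs) = 65 * length xs" by (rule len)
  show "F xs ! p = (if p mod 65 = 64 then b (xs ! (p div 65)) else y)" if "p < length (F xs)"
    using that
  proof (induction xs arbitrary: p)
    case Nil
    then show ?case by (simp add: F_def)
  next
    case (Cons x xs)
    have F: "F (x # xs) = replicate 64 y @ b x # F xs" by (simp add: F_def)
    consider "p < 64" | "p = 64" | "65 \<le> p" by linarith
    then show ?case
    proof cases
      case 1
      then show ?thesis unfolding F by (simp add: nth_append)
    next
      case 2
      then show ?thesis unfolding F by (simp add: nth_append)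
    next
      case 3
      then obtain q where q: "p = 65 + q" by (metis le_Suc_ex)
      have "q < length (F xs)" using Cons.prems q unfolding F by simp
      from Cons.IH[OF this] show ?thesis unfolding F q by (simp add: nth_append)
    qed
  qed
qed

text \<open>Traces a factor with a private letter back to a factor of \<open>xs\<close>: A holds the
  index of the first private letter of each occurrence, and m is the number of private letters in v.
  At most 64 symbols precede the first of them and at most 64 follow the last.\<close>

lemma run_packing:
  fixes b :: "'c \<Rightarrow> 'a" and y :: 'a and xs :: "'c list"
  defines "F \<equiv> concat (map (\<lambda>c. replicate 64 y @ [b c]) xs)"
  assumes b: "inj b" "\<And>c. b c \<noteq> y" and v: "b c \<in> set v" and two: "2 \<le> max_nonoverlapping v F"
  shows "\<exists>A m. A \<subseteq> {..<length xs} \<and> card A = max_nonoverlapping v F \<and> 0 < m \<and>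
    (\<forall>a\<in>A. a + m \<le> length xs) \<and> (\<forall>a\<in>A. \<forall>a'\<in>A. \<forall>t<m. xs ! (a + t) = xs ! (a' + t)) \<and>
    length v \<le> 65 * m + 64"
proof -
  obtain I where I: "packing v F I" "card I = max_nonoverlapping v F" using ex_packing by blast
  define q where "q = (LEAST t. t < length v \<and> v ! t \<in> range b)"
  have "\<exists>t. t < length v \<and> v ! t \<in> range b" using v by (metis in_set_conv_nth rangeI)
  then have q: "q < length v" "v ! q \<in> range b"
    unfolding q_def using LeastI_ex[of "\<lambda>t. t < length v \<and> v ! t \<in> range b"] by auto
  have q_least: "\<not> (t < length v \<and> v ! t \<in> range b)" if "t < q" for t
    using that not_less_Least unfolding q_def by blast
  define m where "m = (length v - 1 - q) div 65 + 1"
  define pos where "pos p = (p + q) div 65" for p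
  have lenF: "length F = 65 * length xs" unfolding F_def by (rule run_nth)
  have nthF: "F ! p = (if p mod 65 = 64 then b (xs ! (p div 65)) else y)" if "p < length F" for p
    using that unfolding F_def by (rule run_nth)
  have occ: "p + length v \<le> length F" "\<And>t. t < length v \<Longrightarrow> F ! (p + t) = v ! t" if "p \<in> I" for p
    using I(1) that unfolding packing_def occurs_at_nth by auto
  have yb: "y \<notin> range b" using b(2) by (metis rangeE)
  have mod64: "(p + t) mod 65 = 64" if "p \<in> I" "t < length v" "v ! t \<in> range b" for p t
    using occ[OF that(1)] that(2,3) nthF[of "p + t"] yb by (auto split: if_splits)
  have pq: "p + q = 65 * pos p + 64" if "p \<in> I" for p
    using mod64[OF that q] unfolding pos_def by (metis mult_div_mod_eq)
  have nonempty: "I \<noteq> {}" using I(2) two by auto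
  \<comment> \<open>Private letters recur with period 65: a first one at an index above 64 would
    have another one 65 places earlier, still inside v.\<close>
  have "q \<le> 64"
  proof (rule ccontr)
    assume "\<not> q \<le> 64"
    obtain p where p: "p \<in> I" using nonempty by blast
    have "p + (q - 65) < length F" using occ(1)[OF p] q(1) by linarith
    moreover have "p + (q - 65) + 65 = p + q" using \<open>\<not> q \<le> 64\<close> by simp
    then have "(p + (q - 65)) mod 65 = 64" using mod64[OF p q] by (metis mod_add_self2)
    ultimately have "F ! (p + (q - 65)) \<in> range b" using nthF by simp
    then have "v ! (q - 65) \<in> range b" using occ(2)[OF p, of "q - 65"] q(1) by simp
    then show False using q_least[of "q - 65"] q(1) \<open>\<not> q \<le> 64\<close> by auto
  qed
  have step: "b (xs ! (pos p + t)) = v ! (q + 65 * t)" "pos p + t < length xs"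
    if "p \<in> I" "t < m" for p t
  proof -
    have "t \<le> (length v - 1 - q) div 65" using that by (simp add: m_def)
    then have "65 * t \<le> length v - 1 - q" by (simp add: less_eq_div_iff_mult_less_eq mult.commute)
    then have lt: "q + 65 * t < length v" using q(1) by linarith
    have e: "p + (q + 65 * t) = 65 * (pos p + t) + 64" using pq[OF that(1)] by simp
    have l: "p + (q + 65 * t) < length F" using occ(1)[OF that(1)] lt by linarith
    then show "pos p + t < length xs" unfolding e lenF by simp
    have "(65 * x + 64) mod 65 = 64" "(65 * x + 64) div 65 = x" for x :: nat by simp_all
    then have "F ! (65 * (pos p + t) + 64) = b (xs ! (pos p + t))"
      using nthF[of "65 * (pos p + t) + 64"] l unfolding e by metis
    then show "b (xs ! (pos p + t)) = v ! (q + 65 * t)" using occ(2)[OF that(1) lt] e by metis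
  qed
  have "0 < m" by (simp add: m_def)
  have "inj_on pos I"
  proof (rule inj_onI)
    fix p p' assume "p \<in> I" "p' \<in> I" "pos p = pos p'"
    then show "p = p'" using pq[of p] pq[of p'] by simp
  qed
  then have card: "card (pos ` I) = max_nonoverlapping v F" using I(2) by (simp add: card_image)
  have "pos ` I \<subseteq> {..<length xs}" using step(2)[of _ 0] \<open>0 < m\<close> by auto
  moreover have "\<forall>a\<in>pos ` I. a + m \<le> length xs"
    using step(2)[of _ "m - 1"] \<open>0 < m\<close> by fastforce
  moreover have "\<forall>a\<in>pos ` I. \<forall>a'\<in>pos ` I. \<forall>t<m. xs ! (a + t) = xs ! (a' + t)"
    using step(1) b(1) unfolding inj_def by (metis imageE)
  moreover have "length v \<le> 65 * m + 64"
  proof -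
    have "length v - 1 - q < 65 * m" unfolding m_def
      using dividend_less_times_div[of 65 "length v - 1 - q"] by simp
    then show ?thesis using \<open>q \<le> 64\<close> by linarith
  qed
  ultimately show ?thesis using card \<open>0 < m\<close> by blast
qed

lemma max_nonoverlapping_runs:
  assumes "0 < k" "\<And>c. b c \<noteq> y"
  shows "max_nonoverlapping (replicate k y) (concat (map (\<lambda>c. replicate l y @ [b c]) xs)) = length xs * (l div k)"
proof (induction xs)
  case Nil
  then show ?case using assms(1) max_nonoverlapping_length[of "replicate k y" "[]"] by simp
next
  case (Cons x xs)
  let ?F = "concat (map (\<lambda>c. replicate l y @ [b c]) xs)"
  have eq: "concat (map (\<lambda>c. replicate l y @ [b c]) (x # xs)) = replicate l y @ b x # ?F" by simp
  have "max_nonoverlapping (replicate k y) (replicate l y @ b x # ?F)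
      \<le> max_nonoverlapping (replicate k y) (replicate l y) + max_nonoverlapping (replicate k y) ?F"
    using assms by (intro max_nonoverlapping_separator) (auto dest: in_set_replicate[THEN iffD1])
  moreover have "max_nonoverlapping (replicate k y) (replicate l y) + max_nonoverlapping (replicate k y) ([b x] @ ?F)
      \<le> max_nonoverlapping (replicate k y) (replicate l y @ [b x] @ ?F)"
    using assms(1) by (intro max_nonoverlapping_append_ge) simp
  moreover have "max_nonoverlapping (replicate k y) [b x] + max_nonoverlapping (replicate k y) ?F
      \<le> max_nonoverlapping (replicate k y) ([b x] @ ?F)"
    using assms(1) by (intro max_nonoverlapping_append_ge) simp
  ultimately show ?case unfolding eq using Cons max_nonoverlapping_replicate[OF assms(1), of y l] by simp
qed

lemma replace_factor_runs:
  assumes "0 < k" "\<And>c. b c \<noteq> y"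
  shows "replace_factor (replicate k y) z (concat (map (\<lambda>c. replicate l y @ [b c]) xs)) =
    concat (map (\<lambda>c. replicate (l div k) z @ replicate (l mod k) y @ [b c]) xs)"
proof (induction xs)
  case (Cons x xs)
  have "b x \<notin> set (replicate k y)" using assms by auto
  from replace_factor_separator[OF this] Cons
  show ?case using replace_factor_replicate[OF assms(1), of y "[]" z l] by simp
qed simp

section \<open>Base 64 digits\<close>

primrec low_digits :: "(nat \<Rightarrow> 'a) \<Rightarrow> nat \<Rightarrow> nat \<Rightarrow> 'a list" where
  "low_digits Y 0 n = []"
| "low_digits Y (Suc j) n = replicate (n div 64 ^ j mod 64) (Y j) @ low_digits Y j n"

text \<open>The shape of the target of exponent n after j forced rounds: the quotient by 64^j as
  copies of Y_j, then the lower digits in descending order.\<close>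

definition digits :: "(nat \<Rightarrow> 'a) \<Rightarrow> nat \<Rightarrow> nat \<Rightarrow> 'a list" where
  "digits Y j n = replicate (n div 64 ^ j) (Y j) @ low_digits Y j n"

lemma set_low_digits: "set (low_digits Y j n) \<subseteq> Y ` {..<j}"
  by (induction j) (auto simp: less_Suc_eq)

lemma set_digits: "set (digits Y j n) \<subseteq> Y ` {..j}"
  using set_low_digits[of Y j n] by (auto simp: digits_def)

lemma low_digits_cong: "(\<And>i. i < j \<Longrightarrow> Y i = Z i) \<Longrightarrow> low_digits Y j n = low_digits Z j n"
  by (induction j) auto

lemma length_digits: "length (digits Y j n) \<le> n"
proof -
  have "64 ^ j * (n div 64 ^ j) + length (low_digits Y j n) \<le> n"
  proof (induction j)
    case (Suc j)
    have "n div 64 ^ j = 64 * (n div 64 ^ Suc j) + n div 64 ^ j mod 64"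
      by (simp add: div_mult2_eq mult.commute[of 64])
    then have "64 ^ j * (n div 64 ^ j) = 64 ^ Suc j * (n div 64 ^ Suc j) + 64 ^ j * (n div 64 ^ j mod 64)"
      by (metis distrib_left mult.assoc power_Suc2)
    moreover have "n div 64 ^ j mod 64 \<le> 64 ^ j * (n div 64 ^ j mod 64)" by simp
    moreover have "length (low_digits Y (Suc j) n) = n div 64 ^ j mod 64 + length (low_digits Y j n)" by simp
    ultimately show ?case using Suc by linarith
  qed simp
  moreover have "n div 64 ^ j \<le> 64 ^ j * (n div 64 ^ j)" by simp
  ultimately have "n div 64 ^ j + length (low_digits Y j n) \<le> n" by linarith
  then show ?thesis by (simp add: digits_def)
qed

lemma replace_factor_digits:
  assumes "inj_on Y {..j}"
  shows "replace_factor (replicate 64 (Y j)) z (digits Y j n) = digits (Y(Suc j := z)) (Suc j) n"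
proof -
  have "Y j \<notin> set (low_digits Y j n)"
  proof
    assume "Y j \<in> set (low_digits Y j n)"
    then obtain i where "i < j" "Y j = Y i" using set_low_digits[of Y j n] by auto
    then show False using inj_onD[OF assms, of j i] by simp
  qed
  then have "replace_factor (replicate 64 (Y j)) z (digits Y j n) =
      replicate (n div 64 ^ j div 64) z @ replicate (n div 64 ^ j mod 64) (Y j) @ low_digits Y j n"
    unfolding digits_def by (intro replace_factor_replicate) auto
  moreover have "n div 64 ^ j div 64 = n div 64 ^ Suc j" by (simp only: power_Suc2 div_mult2_eq)
  moreover have "low_digits (Y(Suc j := z)) j n = low_digits Y j n" by (rule low_digits_cong) simp
  ultimately show ?thesis by (simp add: digits_def)
qed

lemma rules_replace_step:
  "rules (replace_step v Z G) A = (if A = Z then Some v else map_option (replace_factor v (N Z)) (rules G A))"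
  by (simp add: replace_step_def)

lemma dom_replace_step: "dom (rules (replace_step v Z G)) = insert Z (dom (rules G))"
  by (auto simp: rules_replace_step split: if_splits)

text \<open>All comparisons below bound the product on the right instead of the gain itself.\<close>

lemma gain_le: "gain G v \<le> int ((length v - 1) * occ_count G v)"
proof (cases v)
  case (Cons x w)
  then have "gain G v = int (occ_count G v) * int (length w) - int (length v)" by (simp add: gain_def)
  also have "\<dots> \<le> int (occ_count G v) * int (length w)" by simp
  finally show ?thesis using Cons by (simp add: mult.commute)
qed (simp add: gain_def)

lemma div_power_64: "j < i \<Longrightarrow> 64 ^ (i - j) div 64 = (64::nat) ^ (i - Suc j)"
  by (metis Suc_diff_Suc nonzero_mult_div_cancel_left power_Suc zero_neq_numeral)

lemma max_nonoverlapping_length_pred: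
  "(length v - 1) * max_nonoverlapping v u \<le> length u"
proof (cases "v = []")
  case False
  have "(length v - 1) * max_nonoverlapping v u \<le> max_nonoverlapping v u * length v"
    by (simp add: diff_mult_distrib mult.commute)
  then show ?thesis using max_nonoverlapping_length[OF False, of u] by linarith
qed simp

text \<open>Exponents k < 64 against exponent 64. On a run of length 64 they score at most 62
  instead of 63; on a run of length 64 times 64^e with e \<ge> 1 they do not exceed the score 63
  times 64^e of exponent 64.\<close>

lemma run_short:
  assumes "2 \<le> k" "k < 64"
  shows "(k - 1) * (64 div k) \<le> 62" and "1 \<le> e \<Longrightarrow> (k - 1) * (64 * 64 ^ e div k) \<le> 63 * (64::nat) ^ e"
proof -
  have gen: "(k - 1) * (l div k) \<le> l - l div k" for l :: nat
  proof -
    have "(k - 1) * (l div k) = k * (l div k) - l div k" by (simp add: diff_mult_distrib)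
    also have "\<dots> \<le> l - l div k" by (rule diff_le_mono) simp
    finally show ?thesis .
  qed
  show "(k - 1) * (64 div k) \<le> 62"
  proof (cases "64 div k \<ge> 2")
    case True
    then show ?thesis using gen[of 64] by linarith
  next
    case False
    then have "64 div k \<le> 1" by simp
    then have "(k - 1) * (64 div k) \<le> (k - 1) * 1" by (rule mult_left_mono) simp
    then show ?thesis using assms by linarith
  qed
  show "(k - 1) * (64 * 64 ^ e div k) \<le> 63 * (64::nat) ^ e" if e: "1 \<le> e"
  proof -
    obtain e' where "e = Suc e'" using e by (cases e) auto
    let ?q = "64 * 64 ^ e div k"
    have a: "k * ?q \<le> 64 * 64 ^ e" by simp
    have "63 * ((k - 1) * ?q) = (63 * (k - 1)) * ?q" by simp
    \<comment> \<open>k \<le> 63 gives 63(k - 1) \<le> 62k. The chain closes with 62 times 64 = 3968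
      \<le> 3969 = 63 times 63.\<close>
    also have "\<dots> \<le> (62 * k) * ?q" by (rule mult_right_mono) (use assms in linarith, simp)
    also have "\<dots> \<le> 62 * (64 * 64 ^ e)" using mult_left_mono[OF a, of 62] by simp
    also have "\<dots> \<le> 63 * (63 * 64 ^ e)" by simp
    finally show ?thesis by simp
  qed
qed

section \<open>Greedy on the input words\<close>

text \<open>\<open>19 ^ (4 * h + 2)\<close> is the length of V_h, the shortest of the V_j. The left
  side collects what the targets and the at most h rules of Y_1, ..., Y_h (64 symbols each) can
  contribute to a score, and the 64 that is subtracted in the gain of the power.\<close>

locale greedy_input =
  fixes h :: nat and ns :: "nat list"
  assumes h_pos: "0 < h" and small: "sum_list ns + 64 * h + 64 < 19 ^ (4 * h + 2)"
begin

section \<open>Sizes of the auxiliary words\<close>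

definition M :: "nat \<Rightarrow> nat" where
  "M i = 19 ^ (7 * h + 2 - 3 * i)"

lemma M_Suc: "i \<le> h \<Longrightarrow> M i = 6859 * M (Suc i)"
proof -
  assume "i \<le> h"
  then have "7 * h + 2 - 3 * i = Suc (Suc (Suc (7 * h + 2 - 3 * Suc i)))" using h_pos by simp
  then show ?thesis by (simp add: M_def)
qed

lemma M_ge: "i \<le> h \<Longrightarrow> 19 ^ (4 * h + 2) \<le> M i"
  unfolding M_def by (intro power_increasing) auto

lemma M_large: "i \<le> h \<Longrightarrow> 10000 \<le> M i"
proof -
  assume "i \<le> h"
  have "(10000::nat) \<le> 19 ^ 6" by simp
  also have "(19::nat) ^ 6 \<le> 19 ^ (4 * h + 2)" by (rule power_increasing) (use h_pos in auto)
  finally show ?thesis using M_ge[OF \<open>i \<le> h\<close>] by linarith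
qed

text \<open>The reason for 3j in e_j. The next index has runs 64 times as long but a word V shorter
  by the factor 6859, and 64^2 + 64 = 4160 stays below that. The left side counts the symbols Y_j in
  the F_i with i > j + 1 after j rounds.\<close>

lemma M_tail: "j < h \<Longrightarrow> (\<Sum>i\<in>{Suc (Suc j)..h}. M i * 64 ^ (i - j)) \<le> M (Suc j)"
proof (induction "h - j" arbitrary: j)
  case (Suc x)
  show ?case
  proof (cases "Suc j < h")
    case True
    have "(\<Sum>i\<in>{Suc (Suc j)..h}. M i * 64 ^ (i - j)) =
        M (Suc (Suc j)) * 64 ^ 2 + (\<Sum>i\<in>{Suc (Suc (Suc j))..h}. M i * 64 ^ (i - j))"
      using True by (subst sum.atLeast_Suc_atMost) (auto simp: numeral_2_eq_2)
    also have "(\<Sum>i\<in>{Suc (Suc (Suc j))..h}. M i * 64 ^ (i - j)) =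
        64 * (\<Sum>i\<in>{Suc (Suc (Suc j))..h}. M i * 64 ^ (i - Suc j))"
      unfolding sum_distrib_left
    proof (rule sum.cong)
      fix i assume "i \<in> {Suc (Suc (Suc j))..h}"
      then have "i - j = Suc (i - Suc j)" by auto
      then show "M i * 64 ^ (i - j) = 64 * (M i * 64 ^ (i - Suc j))" by simp
    qed simp
    also have "\<dots> \<le> 64 * M (Suc (Suc j))" using Suc True by (intro mult_left_mono) auto
    finally show ?thesis using M_Suc[of "Suc j"] True by simp
  qed simp
qed simp

text \<open>F_i with i \<ge> j after j forced rounds: a run of 64^i letters a has become 64^(i - j)
  symbols Y_j.\<close>

definition aux_at :: "(nat \<Rightarrow> letter symbol) \<Rightarrow> nat \<Rightarrow> nat \<Rightarrow> letter symbol list" where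
  "aux_at Y j i = concat (map (\<lambda>c. replicate (64 ^ (i - j)) (Y j) @ [T (Lb i c)]) (map dejean [0..<M i]))"

text \<open>The symbols that can take part in uncontrolled rounds: the private letters of words
  already treated, and every nonterminal other than the start symbol and the Y_i.\<close>

definition priv :: "(nat \<Rightarrow> letter symbol) \<Rightarrow> nat \<Rightarrow> letter grammar \<Rightarrow> letter symbol set" where
  "priv Y j G = {T (Lb i c) | i c. i \<le> j} \<union> {N A | A. A \<in> dom (rules G) \<and> A \<noteq> 0 \<and> N A \<notin> Y ` {..j}}"

text \<open>As no two symbols Y_i are adjacent, such a word has no factor of length 2 over them: it
  adds nothing to the count of a power and is unchanged when a power is replaced.\<close>

definition private_word :: "(nat \<Rightarrow> letter symbol) \<Rightarrow> nat \<Rightarrow> letter grammar \<Rightarrow> letter symbol list \<Rightarrow> bool" where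
  "private_word Y j G u \<longleftrightarrow> set u \<subseteq> Y ` {..j} \<union> priv Y j G \<and>
    successively (\<lambda>a b. \<not> (a \<in> Y ` {..j} \<and> b \<in> Y ` {..j})) u"

text \<open>\<open>cs\<close> holds what the treated words F_1, ..., F_j have become. Their form
  depends on choices of Greedy and is left open up to \<open>private_word\<close>; everything else
  in the start rule is known exactly.\<close>

definition stage :: "nat \<Rightarrow> (nat \<Rightarrow> letter symbol) \<Rightarrow> letter symbol list list \<Rightarrow> letter grammar \<Rightarrow> bool" where
  "stage j Y cs G \<longleftrightarrow> finite (dom (rules G)) \<and> Y 0 = T La \<and> inj_on Y {..j} \<and>
    (\<forall>i\<in>{1..j}. \<exists>A. Y i = N A \<and> A \<noteq> 0 \<and> rules G A = Some (replicate 64 (Y (i - 1)))) \<and>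
    length cs = j \<and>
    rules G 0 = Some (sep_join 1 (map (digits Y j) ns @ cs @ map (aux_at Y j) [Suc j..<Suc h])) \<and>
    (\<forall>u\<in>set cs. private_word Y j G u) \<and>
    (\<forall>A\<in>dom (rules G). A \<noteq> 0 \<longrightarrow> N A \<notin> Y ` {..j} \<longrightarrow> private_word Y j G (the (rules G A)))"


section \<open>Consequences of the invariant\<close>

lemma stage_Y:
  assumes "stage j Y cs G" "i \<le> j"
  shows "Y i = T La \<or> (\<exists>A. Y i = N A \<and> A \<noteq> 0 \<and> A \<in> dom (rules G))"
proof (cases "i = 0")
  case False
  then have "i \<in> {1..j}" using assms(2) by simp
  then show ?thesis using assms(1) unfolding stage_def by blast
qed (use assms in \<open>simp add: stage_def\<close>)

lemma stage_Y_T: "stage j Y cs G \<Longrightarrow> T t \<in> Y ` {..j} \<Longrightarrow> t = La"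
  using stage_Y by (metis atMost_iff imageE symbol.distinct(1) symbol.inject(1))

lemma stage_Y_N: "stage j Y cs G \<Longrightarrow> N A \<in> Y ` {..j} \<Longrightarrow> A \<noteq> 0 \<and> A \<in> dom (rules G)"
  using stage_Y[of j Y cs G] by fastforce

lemma stage_private_disjoint: "stage j Y cs G \<Longrightarrow> Y ` {..j} \<inter> priv Y j G = {}"
proof -
  assume st: "stage j Y cs G"
  have "x \<notin> priv Y j G" if "x \<in> Y ` {..j}" for x
    using that stage_Y_T[OF st] by (cases x) (auto simp: priv_def simp del: imageE image_iff)
  then show ?thesis by blast
qed

lemma private_word_T: "stage j Y cs G \<Longrightarrow> private_word Y j G u \<Longrightarrow> T t \<in> set u \<Longrightarrow> t = La \<or> (\<exists>i c. i \<le> j \<and> t = Lb i c)"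
  using stage_Y_T unfolding private_word_def priv_def by blast

lemma set_aux_at: "set (aux_at Y j i) \<subseteq> {Y j} \<union> range (\<lambda>c. T (Lb i c))"
  unfolding aux_at_def by (auto dest: in_set_replicate[THEN iffD1])

lemma stage_no_sep:
  assumes "stage j Y cs G"
  shows "no_sep (digits Y j n)" "no_sep (aux_at Y j i)" "private_word Y j G u \<Longrightarrow> no_sep u"
    "l \<le> j \<Longrightarrow> no_sep (replicate k (Y l))"
proof -
  show "no_sep (digits Y j n)"
    using set_digits[of Y j n] stage_Y_T[OF assms] unfolding no_sep_def by blast
  show "no_sep (aux_at Y j i)"
    using set_aux_at[of Y j i] stage_Y_T[OF assms] unfolding no_sep_def by fastforce
  show "private_word Y j G u \<Longrightarrow> no_sep u"
    using private_word_T[OF assms] unfolding no_sep_def by blast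
  show "l \<le> j \<Longrightarrow> no_sep (replicate k (Y l))"
    using stage_Y_T[OF assms] unfolding no_sep_def by (metis atMost_iff imageI in_set_replicate letter.distinct(3))
qed

lemma stage_rule_cases:
  assumes "stage j Y cs G" "rules G A = Some \<alpha>"
  shows "A = 0 \<and> \<alpha> = sep_join 1 (map (digits Y j) ns @ cs @ map (aux_at Y j) [Suc j..<Suc h]) \<or>
    A \<noteq> 0 \<and> (\<exists>i\<in>{1..j}. Y i = N A \<and> \<alpha> = replicate 64 (Y (i - 1))) \<or>
    A \<noteq> 0 \<and> N A \<notin> Y ` {..j} \<and> private_word Y j G \<alpha>"
proof (cases "A = 0")
  case True
  then show ?thesis using assms unfolding stage_def by simp
next
  case False
  show ?thesis
  proof (cases "N A \<in> Y ` {..j}")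
    case True
    then obtain i where i: "i \<le> j" "Y i = N A" by auto
    moreover have "i \<noteq> 0"
    proof
      assume "i = 0" then show False using assms(1) i(2) by (simp add: stage_def)
    qed
    ultimately have "i \<in> {1..j}" by simp
    then obtain A' where "Y i = N A'" "rules G A' = Some (replicate 64 (Y (i - 1)))"
      using assms(1) unfolding stage_def by blast
    then show ?thesis using i \<open>i \<in> {1..j}\<close> assms(2) False by auto
  next
    case False
    then have "private_word Y j G (the (rules G A))"
      using assms \<open>A \<noteq> 0\<close> unfolding stage_def by blast
    then show ?thesis using False \<open>A \<noteq> 0\<close> assms(2) by simp
  qed
qed

lemma stage_segs_no_sep:
  assumes "stage j Y cs G" "u \<in> set (map (digits Y j) ns @ cs @ map (aux_at Y j) [Suc j..<Suc h])"
  shows "no_sep u"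
proof -
  have "u \<in> digits Y j ` set ns \<or> u \<in> set cs \<or> u \<in> range (aux_at Y j)" using assms(2) by auto
  then show ?thesis
    using stage_no_sep[OF assms(1)] assms(1) unfolding stage_def by blast
qed

lemma stage_sublist:
  assumes st: "stage j Y cs G" and A: "rules G A = Some \<alpha>" "sublist v \<alpha>" and v: "no_sep v" "v \<noteq> []"
  shows "(\<exists>n\<in>set ns. sublist v (digits Y j n)) \<or> (\<exists>i\<in>{Suc j..h}. sublist v (aux_at Y j i)) \<or>
    (\<exists>i<j. sublist v (replicate 64 (Y i))) \<or> (\<exists>u. private_word Y j G u \<and> sublist v u)"
  using stage_rule_cases[OF st A(1)]
proof (elim disjE conjE bexE)
  assume "\<alpha> = sep_join 1 (map (digits Y j) ns @ cs @ map (aux_at Y j) [Suc j..<Suc h])"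
  then obtain u where u: "u \<in> set (map (digits Y j) ns @ cs @ map (aux_at Y j) [Suc j..<Suc h])" "sublist v u"
    using sublist_sep_join[OF _ v] A(2) by blast
  then have "u \<in> digits Y j ` set ns \<or> u \<in> set cs \<or> u \<in> aux_at Y j ` {Suc j..h}" by auto
  moreover have "\<forall>u\<in>set cs. private_word Y j G u" using st by (simp add: stage_def)
  ultimately show ?thesis using u(2) by blast
next
  fix i assume "i \<in> {1..j}" "\<alpha> = replicate 64 (Y (i - 1))"
  then have "i - 1 < j" "sublist v (replicate 64 (Y (i - 1)))" using A(2) by auto
  then show ?thesis by blast
qed (use A(2) in blast)

lemma stage_closed:
  assumes st: "stage j Y cs G"
  shows "A \<in> dom (rules G) \<Longrightarrow> N B \<in> set (the (rules G A)) \<Longrightarrow> B \<noteq> 0 \<and> B \<in> dom (rules G)"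
proof -
  assume A: "A \<in> dom (rules G)" "N B \<in> set (the (rules G A))"
  then obtain \<alpha> where \<alpha>: "rules G A = Some \<alpha>" "N B \<in> set \<alpha>" by auto
  then have "sublist [N B] \<alpha>" by (metis append_Cons append_Nil in_set_conv_decomp sublist_appendI)
  moreover have "no_sep [N B]" by (simp add: no_sep_def)
  ultimately consider n where "sublist [N B] (digits Y j n)" | i where "sublist [N B] (aux_at Y j i)" |
    i where "i < j" "sublist [N B] (replicate 64 (Y i))" | u where "private_word Y j G u" "sublist [N B] u"
    using stage_sublist[OF st \<alpha>(1)] by blast
  then have "N B \<in> Y ` {..j} \<union> priv Y j G"
  proof cases
    case 1
    then show ?thesis using set_mono_sublist[OF 1] set_digits[of Y j n] by auto
  next
    case 2
    then show ?thesis using set_mono_sublist[OF 2] set_aux_at[of Y j i] by auto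
  next
    case 3
    then show ?thesis using set_mono_sublist[OF 3(2)] by auto
  next
    case 4
    then show ?thesis using set_mono_sublist[OF 4(2)] by (auto simp: private_word_def)
  qed
  then show ?thesis using stage_Y_N[OF st] by (auto simp: priv_def)
qed

text \<open>A separator is found only in the start rule and at one position there, while two places
  of v would put it at two.\<close>

lemma stage_two_places_no_sep:
  assumes st: "stage j Y cs G" and pl: "(A, p) \<in> places G v" "(B, q) \<in> places G v" "(A, p) \<noteq> (B, q)"
  shows "no_sep v"
proof (rule ccontr)
  assume "\<not> no_sep v"
  then obtain k t where t: "t < length v" "v ! t = T (Sep k)" unfolding no_sep_def by (metis in_set_conv_nth)
  let ?S = "sep_join 1 (map (digits Y j) ns @ cs @ map (aux_at Y j) [Suc j..<Suc h])"
  have only: "A = 0 \<and> p + t < length ?S \<and> ?S ! (p + t) = T (Sep k)" if "(A, p) \<in> places G v" for A p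
  proof -
    have "A \<in> dom (rules G)" "occurs_at v (the (rules G A)) p" using that by (simp_all add: places_def)
    then obtain \<alpha> where \<alpha>: "rules G A = Some \<alpha>" "occurs_at v \<alpha> p" by (metis domD option.sel)
    then have *: "p + t < length \<alpha>" "\<alpha> ! (p + t) = T (Sep k)" using t unfolding occurs_at_nth by auto
    then have "\<not> no_sep \<alpha>" unfolding no_sep_def by (metis nth_mem)
    then have "A = 0 \<and> \<alpha> = ?S"
      using stage_rule_cases[OF st \<alpha>(1)] stage_no_sep(3,4)[OF st] by (metis atLeastAtMost_iff diff_le_self le_trans)
    then show ?thesis using * by simp
  qed
  have "p + t = q + t"
    using sep_join_nth_inj[where p = "p + t" and q = "q + t" and l = k and k = 1, OF stage_segs_no_sep[OF st]]
      only[OF pl(1)] only[OF pl(2)] by metis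
  then show False using only[OF pl(1)] only[OF pl(2)] pl(3) by simp
qed

lemma stage_eligible_no_sep:
  assumes "stage j Y cs G" "2 \<le> occ_count G v"
  shows "no_sep v"
  using stage_two_places_no_sep[OF assms(1)] occ_count_two_places[OF assms(2)] by (metis surj_pair)

lemma private_word_no_run:
  assumes "private_word Y j G u" "set v \<subseteq> Y ` {..j}" "2 \<le> length v"
  shows "max_nonoverlapping v u = 0"
proof (rule max_nonoverlapping_eq_0)
  obtain a b w where v: "v = a # b # w" using assms(3)
    by (metis One_nat_def Suc_1 Suc_le_length_iff)
  show "\<not> sublist v u"
  proof
    assume "sublist v u"
    then obtain x y where "u = x @ v @ y" by (auto simp: sublist_def)
    then show False using assms(1,2) unfolding private_word_def v by (auto simp: successively_append_iff)
  qed
qed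

lemma stage_occ_count_le:
  assumes st: "stage j Y cs G" and v: "no_sep v" "v \<noteq> []"
  shows "occ_count G v \<le> (\<Sum>n\<leftarrow>ns. max_nonoverlapping v (digits Y j n)) + (\<Sum>u\<leftarrow>cs. max_nonoverlapping v u) +
    (\<Sum>i\<in>{Suc j..h}. max_nonoverlapping v (aux_at Y j i)) +
    (\<Sum>A\<in>dom (rules G) - {0}. max_nonoverlapping v (the (rules G A)))"
proof -
  have fin: "finite (dom (rules G))" and 0: "0 \<in> dom (rules G)" and
    r: "the (rules G 0) = sep_join 1 (map (digits Y j) ns @ cs @ map (aux_at Y j) [Suc j..<Suc h])"
    using st by (auto simp: stage_def)
  have "occ_count G v = max_nonoverlapping v (the (rules G 0)) +
      (\<Sum>A\<in>dom (rules G) - {0}. max_nonoverlapping v (the (rules G A)))"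
    unfolding occ_count_def using fin 0 by (simp add: sum.remove)
  moreover have "max_nonoverlapping v (the (rules G 0)) \<le>
      (\<Sum>u\<leftarrow>map (digits Y j) ns @ cs @ map (aux_at Y j) [Suc j..<Suc h]. max_nonoverlapping v u)"
    unfolding r by (rule max_nonoverlapping_sep_join_le[OF v])
  moreover have "(\<Sum>i\<leftarrow>[Suc j..<Suc h]. max_nonoverlapping v (aux_at Y j i)) =
      (\<Sum>i\<in>{Suc j..h}. max_nonoverlapping v (aux_at Y j i))"
    by (simp add: interv_sum_list_conv_sum_set_nat atLeastLessThanSuc_atLeastAtMost del: upt_Suc)
  ultimately show ?thesis by (simp add: o_def del: upt_Suc)
qed

text \<open>For i > j the word F_i is still untreated: treated words and the rules of nonterminals
  contain only private letters of index at most j.\<close>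

lemma stage_occ_count_letter:
  assumes st: "stage j Y cs G" and v: "no_sep v" "T (Lb i c) \<in> set v" and i: "j < i" "i \<le> h"
  shows "occ_count G v \<le> max_nonoverlapping v (aux_at Y j i)"
proof -
  have z: "max_nonoverlapping v u = 0" if "T (Lb i c) \<notin> set u" for u
    using v(2) that set_mono_sublist by (intro max_nonoverlapping_eq_0) blast
  have dg: "T (Lb i c) \<notin> set (digits Y j n)" for n
    using set_digits[of Y j n] stage_Y_T[OF st, of "Lb i c"] by blast
  have pw: "T (Lb i c) \<notin> set u" if "private_word Y j G u" for u
    using private_word_T[OF st that] i by fastforce
  have rl: "T (Lb i c) \<notin> set (the (rules G A))" if "A \<in> dom (rules G) - {0}" for A
  proof -
    have "A \<in> dom (rules G)" and A0: "A \<noteq> 0" using that by simp_all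
    then obtain \<alpha> where \<alpha>: "rules G A = Some \<alpha>" by blast
    then consider l where "l \<in> {1..j}" "\<alpha> = replicate 64 (Y (l - 1))" | "private_word Y j G \<alpha>"
      using stage_rule_cases[OF st \<alpha>] A0 by blast
    then show ?thesis
    proof cases
      case 1
      then have "Y (l - 1) \<in> Y ` {..j}" by auto
      then have "T (Lb i c) \<noteq> Y (l - 1)" using stage_Y_T[OF st, of "Lb i c"] by auto
      then show ?thesis using \<alpha> 1 by simp
    qed (use pw \<alpha> in simp)
  qed
  have ax: "(\<Sum>l\<in>{Suc j..h}. max_nonoverlapping v (aux_at Y j l)) = max_nonoverlapping v (aux_at Y j i)"
  proof -
    have "T (Lb i c) \<notin> set (aux_at Y j l)" if "l \<noteq> i" for l
    proof -
      have "Y j \<noteq> T (Lb i c)" using stage_Y_T[OF st, of "Lb i c"] by (metis atMost_iff imageI le_refl letter.distinct(1))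
      then show ?thesis using set_aux_at[of Y j l] that by auto
    qed
    then have "(\<Sum>l\<in>{Suc j..h}. max_nonoverlapping v (aux_at Y j l)) =
        (\<Sum>l\<in>{Suc j..h}. if l = i then max_nonoverlapping v (aux_at Y j i) else 0)"
      using z by (intro sum.cong) auto
    then show ?thesis using i by simp
  qed
  have "(\<Sum>n\<leftarrow>ns. max_nonoverlapping v (digits Y j n)) = 0"
    using z[OF dg] by simp
  moreover have "(\<Sum>u\<leftarrow>cs. max_nonoverlapping v u) = 0"
    using z pw st by (auto simp: sum_list_eq_0_iff stage_def)
  moreover have "(\<Sum>A\<in>dom (rules G) - {0}. max_nonoverlapping v (the (rules G A))) = 0"
    using z[OF rl] by (rule sum.neutral[OF ballI])
  moreover have "v \<noteq> []" using v(2) by auto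
  ultimately show ?thesis using stage_occ_count_le[OF st v(1)] ax by linarith
qed

lemma sum_list_mult_le:
  assumes "\<And>x. x \<in> set xs \<Longrightarrow> (k::nat) * f x \<le> g x"
  shows "k * (\<Sum>x\<leftarrow>xs. f x) \<le> (\<Sum>x\<leftarrow>xs. g x)"
  using assms by (induction xs) (auto simp: algebra_simps add_mono)

text \<open>Outside the untreated F_i, a word over the Y_i occurs only in the targets, of total
  length at most \<open>sum_list ns\<close>, and in at most h rules of length 64. Private words have
  no room for it.\<close>

lemma stage_occ_count_runs:
  assumes st: "stage j Y cs G" and j: "j \<le> h" and v: "set v \<subseteq> Y ` {..j}" "2 \<le> length v"
  shows "(length v - 1) * occ_count G v \<le> sum_list ns + 64 * h +
    (length v - 1) * (\<Sum>i\<in>{Suc j..h}. max_nonoverlapping v (aux_at Y j i))"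
proof -
  let ?k = "length v - 1"
  have v0: "v \<noteq> []" using v(2) by auto
  have ns: "no_sep v" using v(1) stage_Y_T[OF st] unfolding no_sep_def by blast
  have len: "?k * max_nonoverlapping v u \<le> length u" for u
  proof -
    have "?k * max_nonoverlapping v u \<le> max_nonoverlapping v u * length v"
      by (simp add: diff_mult_distrib mult.commute)
    then show ?thesis using max_nonoverlapping_length[OF v0, of u] by linarith
  qed
  have f1: "?k * (\<Sum>n\<leftarrow>ns. max_nonoverlapping v (digits Y j n)) \<le> sum_list ns"
  proof -
    have "?k * max_nonoverlapping v (digits Y j n) \<le> n" for n
      using len[of "digits Y j n"] length_digits[of Y j n] by (rule le_trans)
    then show ?thesis
      using sum_list_mult_le[of ns ?k "\<lambda>n. max_nonoverlapping v (digits Y j n)" "\<lambda>n. n"] by simp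
  qed
  have cs: "(\<Sum>u\<leftarrow>cs. max_nonoverlapping v u) = 0"
    using st private_word_no_run[OF _ v] unfolding stage_def by (auto simp: sum_list_eq_0_iff)
  have f2: "?k * (\<Sum>A\<in>dom (rules G) - {0}. max_nonoverlapping v (the (rules G A))) \<le> 64 * h"
  proof -
    \<comment> \<open>The nonterminals Y_1, ..., Y_j; apart from the start rule, all other rules are
      private words.\<close>
    let ?D = "{A. N A \<in> Y ` {1..j}}"
    have fin: "finite (dom (rules G))" using st by (simp add: stage_def)
    have "N ` ?D \<subseteq> Y ` {1..j}" by auto
    moreover have inj: "inj_on N ?D" by (simp add: inj_on_def)
    ultimately have "card ?D \<le> card (Y ` {1..j})" by (intro card_inj_on_le) auto
    also have "\<dots> \<le> j" using card_image_le[of "{1..j}" Y] by simp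
    finally have cD: "card ?D \<le> h" using j by simp
    have "finite ?D" using finite_imageD[OF _ inj] finite_subset[OF \<open>N ` ?D \<subseteq> Y ` {1..j}\<close>] by simp
    have "(\<Sum>A\<in>dom (rules G) - {0}. max_nonoverlapping v (the (rules G A))) =
        (\<Sum>A\<in>(dom (rules G) - {0}) \<inter> ?D. max_nonoverlapping v (the (rules G A)))"
    proof (rule sum.mono_neutral_right)
      show "\<forall>A\<in>dom (rules G) - {0} - (dom (rules G) - {0}) \<inter> ?D. max_nonoverlapping v (the (rules G A)) = 0"
      proof
        fix A assume A: "A \<in> dom (rules G) - {0} - (dom (rules G) - {0}) \<inter> ?D"
        then obtain \<alpha> where \<alpha>: "rules G A = Some \<alpha>" by auto
        then have "private_word Y j G \<alpha>" using stage_rule_cases[OF st \<alpha>] A by force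
        then show "max_nonoverlapping v (the (rules G A)) = 0" using private_word_no_run[OF _ v] \<alpha> by simp
      qed
    qed (use fin in auto)
    moreover have "?k * (\<Sum>A\<in>(dom (rules G) - {0}) \<inter> ?D. max_nonoverlapping v (the (rules G A)))
        \<le> (\<Sum>A\<in>(dom (rules G) - {0}) \<inter> ?D. 64)"
      unfolding sum_distrib_left
    proof (rule sum_mono)
      fix A assume A: "A \<in> (dom (rules G) - {0}) \<inter> ?D"
      then obtain \<alpha> where \<alpha>: "rules G A = Some \<alpha>" by auto
      have "N A \<in> Y ` {..j}" using A by auto
      then have "length \<alpha> = 64" using stage_rule_cases[OF st \<alpha>] A by auto
      then show "?k * max_nonoverlapping v (the (rules G A)) \<le> 64" using len[of \<alpha>] \<alpha> by simp
    qed
    moreover have "card ((dom (rules G) - {0}) \<inter> ?D) \<le> h"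
      using card_mono[OF \<open>finite ?D\<close>, of "(dom (rules G) - {0}) \<inter> ?D"] cD by simp
    ultimately show ?thesis by simp
  qed
  have f3: "?k * occ_count G v \<le> ?k * ((\<Sum>n\<leftarrow>ns. max_nonoverlapping v (digits Y j n)) + (\<Sum>u\<leftarrow>cs. max_nonoverlapping v u) +
    (\<Sum>i\<in>{Suc j..h}. max_nonoverlapping v (aux_at Y j i)) +
    (\<Sum>A\<in>dom (rules G) - {0}. max_nonoverlapping v (the (rules G A))))"
    by (rule mult_left_mono[OF stage_occ_count_le[OF st ns v0]]) simp
  from f1 f2 f3 show ?thesis unfolding cs distrib_left by linarith
qed

lemma stage_aux_replicate:
  assumes "stage j Y cs G" "0 < k"
  shows "max_nonoverlapping (replicate k (Y j)) (aux_at Y j i) = M i * (64 ^ (i - j) div k)"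
proof -
  have "T (Lb i c) \<noteq> Y j" for c
    using stage_Y_T[OF assms(1), of "Lb i c"] by (metis atMost_iff imageI le_refl letter.distinct(1))
  then show ?thesis unfolding aux_at_def using assms(2) by (subst max_nonoverlapping_runs) auto
qed

end

section \<open>The power of 64 copies beats all factors without private symbols\<close>

context greedy_input
begin

text \<open>Occurrences of 64 copies of Y_j in the untreated auxiliary words alone. Targets may add
  more, so this bounds the count from below.\<close>

definition run_sum :: "nat \<Rightarrow> nat" where
  "run_sum j = (\<Sum>i\<in>{Suc j..h}. M i * 64 ^ (i - Suc j))"

lemma run_sum_split:
  assumes "j < h"
  shows "run_sum j = M (Suc j) + (\<Sum>i\<in>{Suc (Suc j)..h}. M i * 64 ^ (i - Suc j))"
  unfolding run_sum_def using assms by (subst sum.atLeast_Suc_atMost) auto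

lemma stage_run:
  assumes st: "stage j Y cs G" and j: "j < h"
  shows "eligible G (replicate 64 (Y j))"
    and "63 * int (run_sum j) - 64 \<le> gain G (replicate 64 (Y j))"
proof -
  let ?v = "replicate 64 (Y j)"
  let ?segs = "map (digits Y j) ns @ cs @ map (aux_at Y j) [Suc j..<Suc h]"
  have v0: "?v \<noteq> []" by simp
  have r0: "rules G 0 = Some (sep_join 1 ?segs)" and fin: "finite (dom (rules G))"
    using st by (auto simp: stage_def)
  have "(\<Sum>i\<leftarrow>[Suc j..<Suc h]. max_nonoverlapping ?v (aux_at Y j i)) =
      (\<Sum>i\<in>{Suc j..h}. max_nonoverlapping ?v (aux_at Y j i))"
    by (simp add: interv_sum_list_conv_sum_set_nat atLeastLessThanSuc_atLeastAtMost del: upt_Suc)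
  also have "\<dots> = run_sum j"
    unfolding run_sum_def
  proof (rule sum.cong)
    fix i assume "i \<in> {Suc j..h}"
    then show "max_nonoverlapping ?v (aux_at Y j i) = M i * 64 ^ (i - Suc j)"
      using stage_aux_replicate[OF st, of 64 i] div_power_64[of j i] by simp
  qed simp
  finally have "run_sum j \<le> (\<Sum>u\<leftarrow>?segs. max_nonoverlapping ?v u)"
    by (simp add: o_def del: upt_Suc)
  also have "\<dots> \<le> max_nonoverlapping ?v (sep_join 1 ?segs)"
    by (rule max_nonoverlapping_sep_join_ge[OF v0])
  finally have mno: "run_sum j \<le> max_nonoverlapping ?v (the (rules G 0))" using r0 by simp
  also have "\<dots> \<le> occ_count G ?v"
    unfolding occ_count_def using fin r0 by (intro member_le_sum) auto
  finally have occ: "run_sum j \<le> occ_count G ?v" .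
  have "M (Suc j) \<le> run_sum j" using run_sum_split[OF j] by simp
  then have large: "10000 \<le> run_sum j" using M_large[of "Suc j"] j by linarith
  have "sublist ?v (the (rules G 0))" using max_nonoverlapping_pos_iff mno large by (metis not_less le_zero_eq not_numeral_le_zero gr0I)
  then have "\<exists>\<alpha>\<in>ran (rules G). sublist ?v \<alpha>" using r0 by (auto simp: ran_def)
  then show "eligible G ?v" unfolding eligible_def using occ large by simp
  show "63 * int (run_sum j) - 64 \<le> gain G ?v"
    using occ unfolding gain_def by simp
qed

lemma length_aux_at: "length (aux_at Y j i) = M i * (64 ^ (i - j) + 1)"
proof -
  have "length (concat (map (\<lambda>c. replicate l y @ [b c]) xs)) = length xs * (l + 1)"
    for l and y :: "letter symbol" and b and xs :: "nat list" by (induction xs) auto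
  then show ?thesis unfolding aux_at_def by (metis diff_zero length_map length_upt)
qed

text \<open>For i = j + 1 the factor is traced back to V_{j+1}, where the repetition bound applies
  (\<open>run_packing\<close>, \<open>dejean_factor_card\<close>). For larger i the whole length of
  F_i is small enough by \<open>M_tail\<close>.\<close>

lemma stage_letter_bound:
  assumes st: "stage j Y cs G" and j: "j < h" and v: "eligible G v" "T (Lb i c) \<in> set v" "i \<in> {Suc j..h}"
  shows "(length v - 1) * occ_count G v + 64 < 63 * M (Suc j)"
proof -
  have two: "2 \<le> occ_count G v" using v(1) by (simp add: eligible_def)
  have "no_sep v" using stage_eligible_no_sep[OF st two] .
  then have occ: "occ_count G v \<le> max_nonoverlapping v (aux_at Y j i)"
    using v(2,3) by (intro stage_occ_count_letter[OF st]) auto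
  have Ml: "10000 \<le> M (Suc j)" using M_large j by simp
  show ?thesis
  proof (cases "i = Suc j")
    case True
    have aux: "aux_at Y j i = concat (map (\<lambda>c. replicate 64 (Y j) @ [T (Lb i c)]) (map dejean [0..<M i]))"
      unfolding aux_at_def True by simp
    have ne: "T (Lb i c) \<noteq> Y j" for c
      using stage_Y_T[OF st, of "Lb i c"] by (metis atMost_iff imageI le_refl letter.distinct(1))
    have inj: "inj (\<lambda>c. T (Lb i c))" by (simp add: inj_def)
    have "2 \<le> max_nonoverlapping v (aux_at Y j i)" using occ two by linarith
    from run_packing[OF inj ne v(2) this[unfolded aux]] obtain A m where
      A: "A \<subseteq> {..<length (map dejean [0..<M i])}" "card A = max_nonoverlapping v (aux_at Y j i)" "0 < m"
      "\<forall>a\<in>A. a + m \<le> length (map dejean [0..<M i])"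
      "\<forall>a\<in>A. \<forall>a'\<in>A. \<forall>t<m. map dejean [0..<M i] ! (a + t) = map dejean [0..<M i] ! (a' + t)"
      "length v \<le> 65 * m + 64" unfolding aux by blast
    have "card A * (65 * m + 63) + 64 < 63 * M i"
    proof (rule dejean_factor_card)
      show "A \<subseteq> {..<M i}" "0 < m" "\<And>a. a \<in> A \<Longrightarrow> a + m \<le> M i" using A by auto
      show "M i = 19 ^ (7 * h + 2 - 3 * i)" by (simp add: M_def)
      show "10000 \<le> M i" using Ml True by simp
      show "2 \<le> card A" using A occ two by linarith
      fix a b t assume ab: "a \<in> A" "b \<in> A" "t < m"
      then have "a + t < M i" "b + t < M i" using A(4) by fastforce+
      then show "dejean (a + t) = dejean (b + t)" using A(5) ab by (metis diff_zero length_upt nth_map nth_upt add_0)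
    qed
    moreover have "(length v - 1) * occ_count G v \<le> (65 * m + 63) * card A"
      using A occ by (intro mult_mono) auto
    ultimately show ?thesis using True by (simp add: mult.commute)
  next
    case False
    then have i: "i \<in> {Suc (Suc j)..h}" using v(3) by auto
    have "(length v - 1) * occ_count G v \<le> (length v - 1) * max_nonoverlapping v (aux_at Y j i)"
      using occ by (rule mult_left_mono) simp
    also have "\<dots> \<le> length (aux_at Y j i)" by (rule max_nonoverlapping_length_pred)
    also have "\<dots> \<le> M i * (2 * 64 ^ (i - j))" unfolding length_aux_at by (rule mult_left_mono) simp_all
    also have "\<dots> = 2 * (M i * 64 ^ (i - j))" by simp
    also have "M i * 64 ^ (i - j) \<le> (\<Sum>i\<in>{Suc (Suc j)..h}. M i * 64 ^ (i - j))"
      using i by (intro member_le_sum) auto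
    also have "\<dots> \<le> M (Suc j)" by (rule M_tail[OF j])
    finally show ?thesis using Ml by simp
  qed
qed

text \<open>An exponent k \<noteq> 64 falls behind by at least M (j + 1): for k < 64 by one unit on
  each run of F_{j+1}, for k > 64 because it misses these runs altogether and the later words are
  outweighed by \<open>M_tail\<close>.\<close>

lemma sum_aux_short:
  assumes st: "stage j Y cs G" and j: "j < h" and k: "2 \<le> k" "k \<noteq> 64"
  shows "(k - 1) * (\<Sum>i\<in>{Suc j..h}. max_nonoverlapping (replicate k (Y j)) (aux_at Y j i)) + M (Suc j)
    \<le> 63 * run_sum j"
proof -
  have eq: "max_nonoverlapping (replicate k (Y j)) (aux_at Y j i) = M i * (64 ^ (i - j) div k)" for i
    using stage_aux_replicate[OF st] k by simp
  let ?S = "\<Sum>i\<in>{Suc (Suc j)..h}. M i * (64 ^ (i - j) div k)"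
  have "(\<Sum>i\<in>{Suc j..h}. max_nonoverlapping (replicate k (Y j)) (aux_at Y j i)) =
      M (Suc j) * (64 div k) + ?S"
    unfolding eq using j by (subst sum.atLeast_Suc_atMost) auto
  then have split: "(k - 1) * (\<Sum>i\<in>{Suc j..h}. max_nonoverlapping (replicate k (Y j)) (aux_at Y j i)) =
      M (Suc j) * ((k - 1) * (64 div k)) + (k - 1) * ?S" by (simp add: distrib_left)
  show ?thesis
  proof (cases "k < 64")
    case True
    have "M (Suc j) * ((k - 1) * (64 div k)) \<le> M (Suc j) * 62"
      using run_short(1)[OF k(1) True] by (rule mult_left_mono) simp
    moreover have "(k - 1) * ?S \<le> 63 * (\<Sum>i\<in>{Suc (Suc j)..h}. M i * 64 ^ (i - Suc j))"
      unfolding sum_distrib_left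
    proof (rule sum_mono)
      fix i assume i: "i \<in> {Suc (Suc j)..h}"
      then have e: "64 ^ (i - j) = 64 * (64::nat) ^ (i - Suc j)"
        by (metis Suc_diff_Suc Suc_le_lessD atLeastAtMost_iff Suc_lessD power_Suc)
      have "(k - 1) * (64 * 64 ^ (i - Suc j) div k) \<le> 63 * 64 ^ (i - Suc j)"
        using run_short(2)[OF k(1) True, of "i - Suc j"] i by auto
      from mult_left_mono[OF this, of "M i"]
      show "(k - 1) * (M i * (64 ^ (i - j) div k)) \<le> 63 * (M i * 64 ^ (i - Suc j))"
        unfolding e by (simp add: ac_simps)
    qed
    ultimately show ?thesis unfolding split run_sum_split[OF j] distrib_left by linarith
  next
    case False
    then have "64 div k = 0" using k by simp
    moreover have "(k - 1) * ?S \<le> M (Suc j)"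
    proof -
      have "(k - 1) * ?S \<le> (\<Sum>i\<in>{Suc (Suc j)..h}. M i * 64 ^ (i - j))"
        unfolding sum_distrib_left
      proof (rule sum_mono)
        fix i
        have "(k - 1) * (64 ^ (i - j) div k) \<le> k * (64 ^ (i - j) div k)" by (rule mult_right_mono) simp_all
        also have "\<dots> \<le> 64 ^ (i - j)" by simp
        finally have "(k - 1) * (64 ^ (i - j) div k) \<le> 64 ^ (i - j)" .
        from mult_left_mono[OF this, of "M i"]
        show "(k - 1) * (M i * (64 ^ (i - j) div k)) \<le> M i * 64 ^ (i - j)" by (simp add: ac_simps)
      qed
      then show ?thesis using M_tail[OF j] by linarith
    qed
    ultimately show ?thesis unfolding split run_sum_split[OF j] by simp
  qed
qed

text \<open>The deficit M (j + 1) of \<open>sum_aux_short\<close> exceeds all that targets and rules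
  can contribute, by \<open>small\<close>. Factors with a private symbol are not compared: they may
  win, and \<open>stage_private_step\<close> handles the round in that case.\<close>

lemma stage_gain_less:
  assumes st: "stage j Y cs G" and j: "j < h" and v: "eligible G v" "set v \<inter> priv Y j G = {}"
    and ne: "v \<noteq> replicate 64 (Y j)"
  shows "gain G v < gain G (replicate 64 (Y j))"
proof -
  have two: "2 \<le> occ_count G v" "2 \<le> length v" using v(1) by (simp_all add: eligible_def)
  have v0: "v \<noteq> []" using two by auto
  have ns: "no_sep v" using stage_eligible_no_sep[OF st two(1)] .
  obtain A \<alpha> where A: "rules G A = Some \<alpha>" "sublist v \<alpha>" using v(1) by (auto simp: eligible_def ran_def)
  have sm: "sum_list ns + 64 * h + 64 < M (Suc j)" using small M_ge[of "Suc j"] j by linarith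
  have MR: "M (Suc j) \<le> run_sum j" using run_sum_split[OF j] by simp
  have bound: "(length v - 1) * occ_count G v + 64 < 63 * run_sum j"
  proof (cases "\<exists>i\<in>{Suc j..h}. \<exists>c. T (Lb i c) \<in> set v")
    case True
    then show ?thesis using stage_letter_bound[OF st j v(1)] MR by (metis (no_types, lifting) less_le_trans mult_le_mono2)
  next
    case False
    have sub: "set v \<subseteq> Y ` {..j}"
      using stage_sublist[OF st A ns v0]
    proof (elim disjE bexE exE conjE)
      fix n assume "sublist v (digits Y j n)"
      then show ?thesis using set_mono_sublist[of v] set_digits[of Y j n] by blast
    next
      fix i assume i: "i \<in> {Suc j..h}" "sublist v (aux_at Y j i)"
      then have "set v \<subseteq> {Y j} \<union> range (\<lambda>c. T (Lb i c))" using set_mono_sublist[OF i(2)] set_aux_at[of Y j i] by blast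
      moreover have "set v \<inter> range (\<lambda>c. T (Lb i c)) = {}" using False i(1) by blast
      ultimately show ?thesis by blast
    next
      fix i assume i: "i < j" "sublist v (replicate 64 (Y i))"
      then have "set v \<subseteq> {Y i}" using set_mono_sublist[OF i(2)] by (auto)
      then show ?thesis using i(1) by auto
    next
      fix u assume u: "private_word Y j G u" "sublist v u"
      then show ?thesis using set_mono_sublist[OF u(2)] v(2) unfolding private_word_def by blast
    qed
    have runs: "(length v - 1) * occ_count G v \<le> sum_list ns + 64 * h +
        (length v - 1) * (\<Sum>i\<in>{Suc j..h}. max_nonoverlapping v (aux_at Y j i))"
      using stage_occ_count_runs[OF st _ sub two(2)] j by simp
    show ?thesis
    proof (cases "set v \<subseteq> {Y j}")
      case True
      then have r: "v = replicate (length v) (Y j)"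
        by (metis replicate_length_same singletonD subsetD)
      then have "length v \<noteq> 64" using ne by metis
      then have "(length v - 1) * (\<Sum>i\<in>{Suc j..h}. max_nonoverlapping v (aux_at Y j i)) + M (Suc j) \<le> 63 * run_sum j"
        using sum_aux_short[OF st j two(2)] r by metis
      then show ?thesis using runs sm by linarith
    next
      case F: False
      have "max_nonoverlapping v (aux_at Y j i) = 0" if "i \<in> {Suc j..h}" for i
      proof (rule max_nonoverlapping_eq_0)
        show "\<not> sublist v (aux_at Y j i)"
        proof
          assume "sublist v (aux_at Y j i)"
          then have "set v \<subseteq> {Y j} \<union> range (\<lambda>c. T (Lb i c))" using set_mono_sublist[of v] set_aux_at[of Y j i] by blast
          then show False using F False that by blast
        qed
      qed
      then have "(\<Sum>i\<in>{Suc j..h}. max_nonoverlapping v (aux_at Y j i)) = 0" by simp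
      then show ?thesis using runs sm MR by simp
    qed
  qed
  have "gain G v \<le> int ((length v - 1) * occ_count G v)" by (rule gain_le)
  also have "\<dots> < 63 * int (run_sum j) - 64" using bound by linarith
  also have "\<dots> \<le> gain G (replicate 64 (Y j))" by (rule stage_run[OF st j])
  finally show ?thesis .
qed

section \<open>Preservation of the invariant\<close>

lemma stage_fresh:
  assumes "stage j Y cs G" "Z \<notin> dom (rules G)"
  shows "Z \<noteq> 0" "N Z \<notin> Y ` {..j}" "N Z \<notin> priv Y j G"
  using assms stage_Y_N[OF assms(1)] by (auto simp: stage_def priv_def)

text \<open>Targets, untreated words and the rules of the Y_i contain no private symbol, so the
  round leaves them alone. v is a factor of a private word, and its nonterminal counts as private
  from now on.\<close>

lemma stage_private_step:
  assumes st: "stage j Y cs G" and v: "eligible G v" "set v \<inter> priv Y j G \<noteq> {}" and Z: "Z \<notin> dom (rules G)"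
  shows "\<exists>cs'. stage j Y cs' (replace_step v Z G)"
proof -
  let ?G = "replace_step v Z G" and ?r = "replace_factor v (N Z)"
  have two: "2 \<le> occ_count G v" "2 \<le> length v" using v(1) by (simp_all add: eligible_def)
  have v0: "v \<noteq> []" using two by auto
  have ns: "no_sep v" using stage_eligible_no_sep[OF st two(1)] .
  obtain A \<alpha> where A: "rules G A = Some \<alpha>" "sublist v \<alpha>" using v(1) by (auto simp: eligible_def ran_def)
  have fr: "Z \<noteq> 0" "N Z \<notin> Y ` {..j}" "N Z \<notin> priv Y j G" using stage_fresh[OF st Z] by auto
  have disj: "Y ` {..j} \<inter> priv Y j G = {}" by (rule stage_private_disjoint[OF st])
  have aux_disj: "set (aux_at Y j i) \<inter> priv Y j G = {}" if "j < i" for i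
  proof -
    have "range (\<lambda>c. T (Lb i c)) \<inter> priv Y j G = {}" using that by (auto simp: priv_def)
    then show ?thesis using set_aux_at[of Y j i] disj by blast
  qed
  have dig_disj: "set (digits Y j n) \<inter> priv Y j G = {}" for n using set_digits[of Y j n] disj by blast
  have rep_disj: "set (replicate 64 (Y i)) \<inter> priv Y j G = {}" if "i \<le> j" for i
    using disj that by (auto)
  have same: "?r u = u" if "set u \<inter> priv Y j G = {}" for u
    using that v(2) by (intro replace_factor_no_set[OF v0]) blast
  have nsub: "\<not> sublist v u" if "set u \<inter> priv Y j G = {}" for u
    using that v(2) set_mono_sublist[of v u] by blast
  obtain u where u: "private_word Y j G u" "sublist v u"
    using stage_sublist[OF st A ns v0] nsub[OF dig_disj] nsub[OF aux_disj] nsub[OF rep_disj] by fastforce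
  have pr: "priv Y j ?G = insert (N Z) (priv Y j G)"
    using fr(1,2) by (auto simp: priv_def dom_replace_step)
  have pv: "private_word Y j ?G v"
  proof -
    obtain x y where "u = x @ v @ y" using u(2) by (auto simp: sublist_def)
    then show ?thesis using u(1) unfolding private_word_def pr by (auto simp: successively_append_iff)
  qed
  have pw: "private_word Y j ?G (?r w)" if "private_word Y j G w" for w
    using that set_replace_factor[of v "N Z" w] fr(2)
      successively_replace_factor[of "\<lambda>a b. \<not> (a \<in> Y ` {..j} \<and> b \<in> Y ` {..j})" w "N Z" v]
    unfolding private_word_def pr by blast
  have "stage j Y (map ?r cs) ?G"
    unfolding stage_def
  proof (intro conjI ballI impI)
    show "finite (dom (rules ?G))" using st by (simp add: stage_def dom_replace_step)
    show "Y 0 = T La" "inj_on Y {..j}" "length (map ?r cs) = j" using st by (simp_all add: stage_def)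
    show "\<exists>A. Y i = N A \<and> A \<noteq> 0 \<and> rules ?G A = Some (replicate 64 (Y (i - 1)))" if i: "i \<in> {1..j}" for i
    proof -
      obtain A where A: "Y i = N A" "A \<noteq> 0" "rules G A = Some (replicate 64 (Y (i - 1)))"
        using st i unfolding stage_def by blast
      have "i - 1 \<le> j" using i by auto
      then have "?r (replicate 64 (Y (i - 1))) = replicate 64 (Y (i - 1))" by (intro same rep_disj)
      moreover have "A \<noteq> Z" using A(3) Z by auto
      ultimately show ?thesis using A by (simp add: rules_replace_step)
    qed
    have "map ?r (map (digits Y j) ns @ cs @ map (aux_at Y j) [Suc j..<Suc h]) =
        map (digits Y j) ns @ map ?r cs @ map (aux_at Y j) [Suc j..<Suc h]"
      using same[OF dig_disj] same[OF aux_disj] by (auto simp del: upt_Suc)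
    then show "rules ?G 0 = Some (sep_join 1 (map (digits Y j) ns @ map ?r cs @ map (aux_at Y j) [Suc j..<Suc h]))"
      using st fr(1) replace_factor_sep_join[OF ns]
      by (simp add: rules_replace_step stage_def del: upt_Suc map_append)
    show "private_word Y j ?G w" if "w \<in> set (map ?r cs)" for w
      using that pw st unfolding stage_def by auto
    show "private_word Y j ?G (the (rules ?G A))" if "A \<in> dom (rules ?G)" "A \<noteq> 0" "N A \<notin> Y ` {..j}" for A
    proof (cases "A = Z")
      case True
      then show ?thesis using pv by (simp add: rules_replace_step)
    next
      case False
      then have "A \<in> dom (rules G)" using that(1) unfolding dom_replace_step by simp
      then obtain \<beta> where "rules G A = Some \<beta>" by blast
      moreover then have "private_word Y j G (the (rules G A))"
        using st that(2,3) unfolding stage_def by blast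
      ultimately show ?thesis using pw False by (simp add: rules_replace_step)
    qed
  qed
  then show ?thesis by blast
qed

lemma successively_runs:
  assumes "\<And>c. b c \<notin> S"
  shows "successively (\<lambda>a a'. \<not> (a \<in> S \<and> a' \<in> S)) (concat (map (\<lambda>c. [y, b c]) xs))"
  by (induction xs) (use assms in \<open>auto simp: successively_Cons\<close>)

text \<open>The round turns F_{j+1} into an alternation of Y_{j+1} and private letters. This is a
  private word, so it moves from the untreated words to \<open>cs\<close>.\<close>

lemma stage_run_step:
  assumes st: "stage j Y cs G" and j: "j < h" and Z: "Z \<notin> dom (rules G)"
  shows "\<exists>cs'. stage (Suc j) (Y(Suc j := N Z)) cs' (replace_step (replicate 64 (Y j)) Z G)"
proof -
  define v where "v = replicate 64 (Y j)"
  let ?G = "replace_step v Z G" and ?r = "replace_factor v (N Z)" and ?Y = "Y(Suc j := N Z)"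
  have v: "v \<noteq> []" "2 \<le> length v" "set v \<subseteq> Y ` {..j}" "Y j \<in> set v"
    unfolding v_def by (auto)
  have inj: "inj_on Y {..j}" using st by (simp add: stage_def)
  have fr: "Z \<noteq> 0" "N Z \<notin> Y ` {..j}" "N Z \<notin> priv Y j G" using stage_fresh[OF st Z] by auto
  have Ys: "?Y ` {..Suc j} = insert (N Z) (Y ` {..j})" by (auto simp: atMost_Suc)
  have ns: "no_sep v" unfolding v_def by (rule stage_no_sep(4)[OF st]) simp
  have ne: "T (Lb i c) \<noteq> Y j" for i c
    using stage_Y_T[OF st, of "Lb i c"] by (metis atMost_iff imageI le_refl letter.distinct(1))
  have pr: "priv Y j G \<subseteq> priv ?Y (Suc j) ?G"
    using fr unfolding priv_def Ys by (auto simp: dom_replace_step)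
  have rpw: "?r u = u" if "private_word Y j G u" for u
    using private_word_no_run[OF that v(3,2)] max_nonoverlapping_pos_iff[of v u]
    by (intro replace_factor_no_sublist) simp
  have pw: "private_word ?Y (Suc j) ?G u" if u: "private_word Y j G u" for u
  proof -
    have "N Z \<notin> set u" using u fr by (auto simp: private_word_def)
    then have "successively (\<lambda>a b. \<not> (a \<in> ?Y ` {..Suc j} \<and> b \<in> ?Y ` {..Suc j})) u \<longleftrightarrow>
        successively (\<lambda>a b. \<not> (a \<in> Y ` {..j} \<and> b \<in> Y ` {..j})) u"
      unfolding Ys by (intro successively_cong) auto
    then show ?thesis using u pr unfolding private_word_def Ys by blast
  qed
  have r_aux: "?r (aux_at Y j i) = aux_at ?Y (Suc j) i" if "j < i" for i
  proof -
    have "?r (aux_at Y j i) = concat (map (\<lambda>c. replicate (64 ^ (i - j) div 64) (N Z) @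
        replicate (64 ^ (i - j) mod 64) (Y j) @ [T (Lb i c)]) (map dejean [0..<M i]))"
      unfolding aux_at_def v_def by (rule replace_factor_runs) (use ne in auto)
    moreover have "64 ^ (i - j) mod 64 = (0::nat)"
      using that by (metis dvd_imp_mod_0 dvd_power zero_less_diff)
    ultimately show ?thesis using div_power_64[OF that] by (simp add: aux_at_def)
  qed
  have r_dig: "?r (digits Y j n) = digits ?Y (Suc j) n" for n
    unfolding v_def by (rule replace_factor_digits[OF inj])
  let ?cs = "cs @ [aux_at ?Y (Suc j) (Suc j)]"
  have "stage (Suc j) ?Y ?cs ?G"
    unfolding stage_def
  proof (intro conjI ballI impI)
    show "finite (dom (rules ?G))" using st by (simp add: stage_def dom_replace_step)
    show "?Y 0 = T La" "length ?cs = Suc j" using st by (simp_all add: stage_def)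
    show "inj_on ?Y {..Suc j}"
    proof -
      have "Y x \<noteq> N Z" if "x \<le> j" for x using fr(2) that by (metis atMost_iff image_eqI)
      then show ?thesis using inj unfolding atMost_Suc by (fastforce simp: inj_on_def)
    qed
    show "\<exists>A. ?Y i = N A \<and> A \<noteq> 0 \<and> rules ?G A = Some (replicate 64 (?Y (i - 1)))" if i: "i \<in> {1..Suc j}" for i
    proof (cases "i = Suc j")
      case True
      then show ?thesis using fr(1) by (auto simp: rules_replace_step v_def)
    next
      case False
      then have i': "i \<in> {1..j}" using i by auto
      then obtain A where A: "Y i = N A" "A \<noteq> 0" "rules G A = Some (replicate 64 (Y (i - 1)))"
        using st unfolding stage_def by blast
      have "Y j \<noteq> Y (i - 1)"
      proof
        assume "Y j = Y (i - 1)"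
        moreover have "i - 1 \<in> {..j}" using i' by (meson atLeastAtMost_iff atMost_iff diff_le_self le_trans)
        ultimately have "j = i - 1" using inj_onD[OF inj] by blast
        then show False using i' by auto
      qed
      then have "?r (replicate 64 (Y (i - 1))) = replicate 64 (Y (i - 1))"
        using v(4) by (intro replace_factor_no_set[OF v(1)]) (auto)
      moreover have "A \<noteq> Z" using A(3) Z by auto
      moreover have "i - 1 \<noteq> Suc j" "i \<noteq> Suc j" using i' by auto
      ultimately show ?thesis using A by (simp add: rules_replace_step)
    qed
    have up: "[Suc j..<Suc h] = Suc j # [Suc (Suc j)..<Suc h]" using j by (simp add: upt_conv_Cons)
    have "map ?r (map (digits Y j) ns @ cs @ map (aux_at Y j) [Suc j..<Suc h]) =
        map (digits ?Y (Suc j)) ns @ ?cs @ map (aux_at ?Y (Suc j)) [Suc (Suc j)..<Suc h]"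
    proof -
      have "map ?r cs = cs" using rpw st unfolding stage_def by (intro map_idI) blast
      moreover have "map ?r (map (aux_at Y j) [Suc j..<Suc h]) = map (aux_at ?Y (Suc j)) [Suc j..<Suc h]"
        using r_aux by (auto simp del: upt_Suc)
      ultimately show ?thesis using r_dig unfolding up by simp
    qed
    then show "rules ?G 0 = Some (sep_join 1 (map (digits ?Y (Suc j)) ns @ ?cs @
        map (aux_at ?Y (Suc j)) [Suc (Suc j)..<Suc h]))"
      using st fr(1) replace_factor_sep_join[OF ns]
      by (simp add: rules_replace_step stage_def del: upt_Suc map_append)
    show "private_word ?Y (Suc j) ?G u" if "u \<in> set ?cs" for u
    proof (cases "u \<in> set cs")
      case True
      then show ?thesis using pw st unfolding stage_def by blast
    next
      case False
      then have u: "u = concat (map (\<lambda>c. [N Z, T (Lb (Suc j) c)]) (map dejean [0..<M (Suc j)]))"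
        using that by (simp add: aux_at_def)
      have b: "T (Lb (Suc j) c) \<notin> ?Y ` {..Suc j}" for c
        unfolding Ys using stage_Y_T[OF st, of "Lb (Suc j) c"] by auto
      have "T (Lb (Suc j) c) \<in> priv ?Y (Suc j) ?G" for c by (auto simp: priv_def)
      then have "set u \<subseteq> ?Y ` {..Suc j} \<union> priv ?Y (Suc j) ?G" unfolding u Ys by auto
      then show ?thesis unfolding private_word_def using successively_runs[of "\<lambda>c. T (Lb (Suc j) c)", OF b] u by blast
    qed
    show "private_word ?Y (Suc j) ?G (the (rules ?G A))"
      if A: "A \<in> dom (rules ?G)" "A \<noteq> 0" "N A \<notin> ?Y ` {..Suc j}" for A
    proof -
      have "A \<noteq> Z" "N A \<notin> Y ` {..j}" using A(3) unfolding Ys by auto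
      then have "A \<in> dom (rules G)" using A(1) unfolding dom_replace_step by simp
      then have "private_word Y j G (the (rules G A))"
        using st A(2) \<open>N A \<notin> Y ` {..j}\<close> unfolding stage_def by blast
      moreover obtain \<beta> where \<beta>: "rules G A = Some \<beta>" using \<open>A \<in> dom (rules G)\<close> by blast
      ultimately have "private_word Y j G \<beta>" by simp
      then show ?thesis using rpw pw \<beta> \<open>A \<noteq> Z\<close> by (simp add: rules_replace_step)
    qed
  qed
  then show ?thesis unfolding v_def by blast
qed

definition staged :: "nat \<Rightarrow> letter grammar \<Rightarrow> bool" where
  "staged j G \<longleftrightarrow> (\<exists>Y cs. stage j Y cs G)"

lemma staged_step:
  assumes "staged j G" "j < h" "greedy_step G G'"
  shows "staged j G' \<or> staged (Suc j) G'"
proof -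
  obtain Y cs where st: "stage j Y cs G" using assms(1) by (auto simp: staged_def)
  obtain v Z where v: "eligible G v" "\<And>u. eligible G u \<Longrightarrow> gain G u \<le> gain G v" "Z \<notin> dom (rules G)"
    "G' = replace_step v Z G" using assms(3) unfolding greedy_step_def by blast
  show ?thesis
  proof (cases "set v \<inter> priv Y j G = {}")
    case True
    have "v = replicate 64 (Y j)"
    proof (rule ccontr)
      assume "v \<noteq> replicate 64 (Y j)"
      then have "gain G v < gain G (replicate 64 (Y j))" by (rule stage_gain_less[OF st assms(2) v(1) True])
      then show False using v(2)[OF stage_run(1)[OF st assms(2)]] by simp
    qed
    then show ?thesis using stage_run_step[OF st assms(2) v(3)] v(4) unfolding staged_def by blast
  next
    case False
    then show ?thesis using stage_private_step[OF st v(1) _ v(3)] v(4) unfolding staged_def by blast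
  qed
qed

text \<open>The second alternative fixes a moment at which stage h is reached; the rounds after it
  remain arbitrary.\<close>

lemma staged_steps:
  assumes "greedy_step\<^sup>*\<^sup>* G G'" "staged 0 G"
  shows "(\<exists>j<h. staged j G') \<or> (\<exists>G0. staged h G0 \<and> greedy_step\<^sup>*\<^sup>* G0 G')"
  using assms
proof (induction rule: rtranclp_induct)
  case base
  then show ?case using h_pos by blast
next
  case (step G1 G2)
  from step.IH[OF step.prems] show ?case
  proof (elim disjE exE conjE)
    fix j assume "j < h" "staged j G1"
    then have "staged j G2 \<or> staged (Suc j) G2" using staged_step step.hyps(2) by blast
    then show ?case using \<open>j < h\<close> by (metis Suc_lessI rtranclp.rtrancl_refl)
  next
    fix G0 assume "staged h G0" "greedy_step\<^sup>*\<^sup>* G0 G1"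
    then show ?case using step.hyps(2) by (meson rtranclp.rtrancl_into_rtrancl)
  qed
qed

lemma stage_initial:
  "stage 0 (\<lambda>_. T La) [] (initial_grammar (join_sep 1 (map (\<lambda>n. replicate n La) ns @
     map (\<lambda>i. concat (map (\<lambda>c. replicate (64 ^ i) La @ [Lb i c]) (map dejean [0..<M i]))) [1..<Suc h])))"
proof -
  have "map T (replicate n La) = digits (\<lambda>_. T La) 0 n" for n by (simp add: digits_def)
  moreover have "map T (concat (map (\<lambda>c. replicate (64 ^ i) La @ [Lb i c]) (map dejean [0..<M i]))) =
      aux_at (\<lambda>_. T La) 0 i" for i
    by (simp add: aux_at_def map_concat o_def)
  ultimately show ?thesis
    unfolding stage_def initial_grammar_def by (simp add: map_T_join_sep o_def del: upt_Suc)
qed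

text \<open>In a stage j < h the power of Y_j is eligible, so Greedy cannot stop there.\<close>

lemma greedy_terminal_staged:
  assumes "greedy_terminal (join_sep 1 (map (\<lambda>n. replicate n La) ns @
     map (\<lambda>i. concat (map (\<lambda>c. replicate (64 ^ i) La @ [Lb i c]) (map dejean [0..<M i]))) [1..<Suc h])) G"
  shows "\<exists>G0 Y cs. stage h Y cs G0 \<and> greedy_step\<^sup>*\<^sup>* G0 G"
proof -
  have "\<not> (\<exists>j<h. staged j G)"
    using assms stage_run(1) unfolding greedy_terminal_def staged_def by blast
  then show ?thesis
    using staged_steps[OF _ staged_def[THEN iffD2]] stage_initial assms unfolding greedy_terminal_def staged_def
    by meson
qed

end

section \<open>The targets after the forced rounds\<close>

text \<open>The letter s is the whole expansion of any symbol that produces it, so no symbol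
  straddles the cut in front of s.\<close>

lemma split_expansion:
  assumes "concat (map f \<alpha>) = x @ s # y" "\<And>X. X \<in> set \<alpha> \<Longrightarrow> s \<in> set (f X) \<Longrightarrow> f X = [s]"
  shows "\<exists>\<alpha>1 \<alpha>2. \<alpha> = \<alpha>1 @ \<alpha>2 \<and> concat (map f \<alpha>1) = x"
  using assms
proof (induction \<alpha> arbitrary: x)
  case (Cons X \<alpha>)
  have e: "f X @ concat (map f \<alpha>) = x @ s # y" using Cons.prems(1) by simp
  show ?case
  proof (cases "length (f X) \<le> length x")
    case True
    then obtain x' where x: "x = f X @ x'"
      using e by (metis append_eq_append_conv_if append_take_drop_id)
    then have "concat (map f \<alpha>) = x' @ s # y" using e by simp
    then obtain \<alpha>1 \<alpha>2 where "\<alpha> = \<alpha>1 @ \<alpha>2" "concat (map f \<alpha>1) = x'"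
      using Cons.IH[of x'] Cons.prems(2) by auto
    then show ?thesis using x by (intro exI[of _ "X # \<alpha>1"] exI[of _ \<alpha>2]) simp
  next
    case False
    then have "(f X @ concat (map f \<alpha>)) ! length x = f X ! length x" by (simp add: nth_append)
    then have "f X ! length x = s" using e by simp
    then have "s \<in> set (f X)" using False by (metis not_less nth_mem)
    then have "f X = [s]" using Cons.prems(2) by simp
    then have "x = []" using False by (cases x) auto
    then show ?thesis by (intro exI[of _ "[]"] exI[of _ "X # \<alpha>"]) simp
  qed
qed simp

lemma map_eq_append3: "map f xs = x @ w @ y \<Longrightarrow> \<exists>a g b. xs = a @ g @ b \<and> map f g = w"
proof -
  assume "map f xs = x @ w @ y"
  then obtain a c where "xs = a @ c" "map f c = w @ y" by (metis map_eq_append_conv)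
  moreover from this(2) obtain g b where "c = g @ b" "map f g = w" by (metis map_eq_append_conv)
  ultimately show ?thesis by blast
qed

lemma sep_join_append:
  assumes "xs \<noteq> []" "ys \<noteq> []"
  shows "\<exists>l y. sep_join k (xs @ ys) = sep_join k xs @ T (Sep l) # y"
  using assms
proof (induction k xs rule: sep_join.induct)
  case (2 k u)
  then show ?case by (cases ys) auto
next
  case (3 k u u' us)
  then show ?case by simp
qed simp

lemma low_digits_binary:
  assumes "\<And>t. t < j \<Longrightarrow> n div 64 ^ t mod 64 \<in> {0, 1}"
  shows "low_digits Y j n = map Y (filter (\<lambda>t. n div 64 ^ t mod 64 = 1) (rev [0..<j]))"
  using assms by (induction j) auto

lemma sorted_wrt_rev_upt: "sorted_wrt (>) (rev [0..<j])"
  by (induction j) (auto simp: sorted_wrt_append)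

text \<open>A factor of a decreasing list misses no member of the list within its range of values.
  For the places of ones this means that the factor also determines the zeros of that range.\<close>

lemma sorted_between:
  assumes "sorted_wrt (>) (x @ g @ y)" "g \<noteq> []" "last g \<le> t" "t \<le> hd g"
  shows "(t :: nat) \<in> set (x @ g @ y) \<longleftrightarrow> t \<in> set g"
proof -
  have "t \<notin> set x"
  proof
    assume "t \<in> set x"
    then have "hd g < t" using assms(1,2) by (auto simp: sorted_wrt_append)
    then show False using assms(4) by simp
  qed
  moreover have "t \<notin> set y"
  proof
    assume "t \<in> set y"
    then have "t < last g" using assms(1,2) by (auto simp: sorted_wrt_append)
    then show False using assms(3) by simp
  qed
  ultimately show ?thesis by auto
qed

lemma sorted_length_le:
  assumes "sorted_wrt (>) g" "g \<noteq> []"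
  shows "length g \<le> hd g - last g + (1 :: nat)" "last g \<le> hd g"
proof -
  have "distinct g" using assms(1) by (induction g) auto
  have "x \<le> hd g \<and> last g \<le> x" if "x \<in> set g" for x
    using assms that by (induction g) (auto split: if_splits intro: less_imp_le)
  then have sub: "set g \<subseteq> {last g..hd g}" by auto
  then show "last g \<le> hd g" using assms(2) by (meson atLeastAtMost_iff last_in_set subsetD)
  have "length g = card (set g)" using \<open>distinct g\<close> by (simp add: distinct_card)
  also have "\<dots> \<le> card {last g..hd g}" using sub by (rule card_mono[rotated]) simp
  finally show "length g \<le> hd g - last g + 1" using \<open>last g \<le> hd g\<close> by simp
qed

context greedy_input
begin

text \<open>Y_h is left out because a target may begin with many copies of it; a lower symbol occurs
  at most once in a target, its digit being 0 or 1.\<close>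

definition low_count :: "(nat \<Rightarrow> letter symbol) \<Rightarrow> letter symbol list \<Rightarrow> nat" where
  "low_count Y u = length (filter (\<lambda>X. X \<in> Y ` {..<h}) u)"

definition bits :: "nat \<Rightarrow> nat list" where
  "bits n = filter (\<lambda>t. n div 64 ^ t mod 64 = 1) (rev [0..<h])"

lemma bits_sorted: "sorted_wrt (>) (bits n)"
  unfolding bits_def by (intro sorted_wrt_filter sorted_wrt_rev_upt)

lemma set_bits: "t \<in> set (bits n) \<longleftrightarrow> t < h \<and> n div 64 ^ t mod 64 = 1"
  by (auto simp: bits_def)

text \<open>K will be 4r + 1. \<open>windows\<close> compares two targets at equal digit places
  only. This is enough because Y_t names its place t, so a common factor lies at the same places in
  both targets.\<close>

context
  fixes Y cs G0 K
  assumes st: "stage h Y cs G0"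
    and binary: "\<And>n t. n \<in> set ns \<Longrightarrow> t < h \<Longrightarrow> n div 64 ^ t mod 64 \<in> {0, 1}"
    and windows: "\<And>k l a. k < length ns \<Longrightarrow> l < length ns \<Longrightarrow> k \<noteq> l \<Longrightarrow> a + K \<le> h \<Longrightarrow>
      \<exists>t<K. (ns ! k) div 64 ^ (a + t) mod 64 \<noteq> (ns ! l) div 64 ^ (a + t) mod 64"
    and K2: "2 \<le> K"
begin

lemma inj_Y: "inj_on Y {..h}"
  using st by (simp add: stage_def)

lemma Y_h_not_low: "Y h \<notin> Y ` {..<h}"
  using inj_onD[OF inj_Y] by fastforce

lemma digits_bits: "n \<in> set ns \<Longrightarrow> digits Y h n = replicate (n div 64 ^ h) (Y h) @ map Y (bits n)"
  using low_digits_binary[of h n Y] binary by (simp add: digits_def bits_def)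

lemma filter_low_bits: "filter (\<lambda>X. X \<in> Y ` {..<h}) (map Y (bits n)) = map Y (bits n)"
  by (intro filter_True) (auto simp: set_bits)

lemma filter_low_digits: "n \<in> set ns \<Longrightarrow> filter (\<lambda>X. X \<in> Y ` {..<h}) (digits Y h n) = map Y (bits n)"
  using Y_h_not_low filter_low_bits by (simp add: digits_bits)

lemma distinct_map_bits: "distinct (map Y (bits n))"
proof -
  have "distinct (bits n)" by (simp add: bits_def)
  moreover have "inj_on Y (set (bits n))" using inj_Y by (rule inj_on_subset) (auto simp: set_bits)
  ultimately show ?thesis by (simp add: distinct_map)
qed

text \<open>As u contains a low symbol, the leading copies of Y_h end before or inside u, and all
  symbols behind u are low. The length of this rest then fixes the position of u.\<close>

lemma factor_bits:
  assumes n: "n \<in> set ns" and occ: "occurs_at u (digits Y h n) p" and u: "0 < low_count Y u"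
  shows "\<exists>x y. map Y (bits n) = x @ filter (\<lambda>X. X \<in> Y ` {..<h}) u @ y \<and> length (digits Y h n) = p + length u + length y"
proof -
  let ?P = "\<lambda>X. X \<in> Y ` {..<h}"
  obtain x y where xy: "digits Y h n = x @ u @ y" "length x = p" using occ by (auto simp: occurs_at_iff)
  then have e: "map Y (bits n) = filter ?P x @ filter ?P u @ filter ?P y"
    using filter_low_digits[OF n] by simp
  obtain c where c: "c \<in> set u" "?P c" using u unfolding low_count_def by (metis filter_empty_conv less_irrefl list.size(3))
  have "\<forall>X\<in>set y. ?P X"
  proof
    fix X assume "X \<in> set y"
    obtain u1 u2 where uu: "u = u1 @ c # u2" using c(1) by (meson split_list)
    have dec: "replicate (n div 64 ^ h) (Y h) @ map Y (bits n) = (x @ u1) @ c # (u2 @ y)"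
      using xy uu digits_bits[OF n] by simp
    have "n div 64 ^ h \<le> length (x @ u1)"
    proof (rule ccontr)
      assume "\<not> n div 64 ^ h \<le> length (x @ u1)"
      then have "(replicate (n div 64 ^ h) (Y h) @ map Y (bits n)) ! length (x @ u1) = Y h"
        by (simp add: nth_append)
      then have "c = Y h" unfolding dec by simp
      then show False using c(2) Y_h_not_low by simp
    qed
    moreover have "map Y (bits n) = drop (n div 64 ^ h) ((x @ u1) @ c # (u2 @ y))"
      unfolding dec[symmetric] by simp
    ultimately have "map Y (bits n) = drop (n div 64 ^ h) (x @ u1) @ c # u2 @ y"
      by (simp only: drop_append) simp
    then have "X \<in> set (map Y (bits n))" using \<open>X \<in> set y\<close> by simp
    then show "?P X" by (auto simp: set_bits)
  qed
  then have "filter ?P y = y" by (intro filter_True)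
  then show ?thesis using e xy by (intro exI[of _ "filter ?P x"] exI[of _ y]) simp
qed

text \<open>The low symbols of a target are distinct, so the low part of u has one place. The
  position of u is computed from the end, since u may begin with copies of Y_h.\<close>

lemma occurrence_unique:
  assumes n: "n \<in> set ns" and occ: "occurs_at u (digits Y h n) p" "occurs_at u (digits Y h n) q" and u: "0 < low_count Y u"
  shows "p = q"
proof -
  let ?w = "filter (\<lambda>X. X \<in> Y ` {..<h}) u"
  obtain x y where xy: "map Y (bits n) = x @ ?w @ y" "length (digits Y h n) = p + length u + length y"
    using factor_bits[OF n occ(1) u] by blast
  obtain x' y' where xy': "map Y (bits n) = x' @ ?w @ y'" "length (digits Y h n) = q + length u + length y'"
    using factor_bits[OF n occ(2) u] by blast
  have "?w \<noteq> []" using u by (auto simp: low_count_def)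
  then obtain c w where w: "?w = c # w" by (cases ?w) auto
  have nx: "(x @ ?w @ y) ! length x = c" "(x' @ ?w @ y') ! length x' = c" unfolding w by simp_all
  have l: "length x < length (map Y (bits n))" "length x' < length (map Y (bits n))" 
    unfolding xy(1) using w by simp (simp only: xy(1)[symmetric] xy'(1), simp add: w)
  have "length x = length x'"
    using nx xy(1) xy'(1) l distinct_map_bits[of n] nth_eq_iff_index_eq[of "map Y (bits n)"] by metis
  moreover have "length x + length ?w + length y = length x' + length ?w + length y'"
    using xy(1) xy'(1) by (metis add.assoc length_append)
  ultimately show ?thesis using xy(2) xy'(2) by linarith
qed

text \<open>The low symbols of u are the same places in both targets. More than K distinct places
  span a window of K places, and by \<open>sorted_between\<close> the two targets have the same
  digits there, against \<open>windows\<close>.\<close>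

lemma common_factor:
  assumes kl: "k < length ns" "l < length ns" "k \<noteq> l"
    and occ: "occurs_at u (digits Y h (ns ! k)) p" "occurs_at u (digits Y h (ns ! l)) q"
  shows "low_count Y u \<le> K"
proof (rule ccontr)
  assume "\<not> low_count Y u \<le> K"
  then have u: "K \<le> low_count Y u" "0 < low_count Y u" using K2 by auto
  let ?w = "filter (\<lambda>X. X \<in> Y ` {..<h}) u"
  have mem: "ns ! k \<in> set ns" "ns ! l \<in> set ns" using kl by auto
  obtain x y where "map Y (bits (ns ! k)) = x @ ?w @ y" using factor_bits[OF mem(1) occ(1) u(2)] by blast
  from map_eq_append3[OF this] obtain x1 g1 y1 where g1: "bits (ns ! k) = x1 @ g1 @ y1" "map Y g1 = ?w" by blast
  obtain x' y' where "map Y (bits (ns ! l)) = x' @ ?w @ y'" using factor_bits[OF mem(2) occ(2) u(2)] by blast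
  from map_eq_append3[OF this] obtain x2 g2 y2 where g2: "bits (ns ! l) = x2 @ g2 @ y2" "map Y g2 = ?w" by blast
  have sub: "set g1 \<subseteq> {..<h}" "set g2 \<subseteq> {..<h}"
    using set_bits[of _ "ns ! k"] set_bits[of _ "ns ! l"] g1(1) g2(1) by auto
  then have "inj_on Y (set g1 \<union> set g2)" using inj_Y by (intro inj_on_subset[OF inj_Y]) auto
  then have g: "g2 = g1" using map_inj_on[of Y g2 g1] g1(2) g2(2) by (simp add: Un_commute)
  have len: "K \<le> length g1" using u(1) g1(2) unfolding low_count_def by (metis length_map)
  then have ne: "g1 \<noteq> []" using K2 by auto
  have s1: "sorted_wrt (>) (x1 @ g1 @ y1)" "sorted_wrt (>) (x2 @ g1 @ y2)"
    using bits_sorted[of "ns ! k"] bits_sorted[of "ns ! l"] g1(1) g2(1) g by simp_all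
  then have sg: "sorted_wrt (>) g1" by (simp add: sorted_wrt_append)
  let ?a = "last g1"
  have hd: "hd g1 < h" using sub(1) ne hd_in_set by blast
  have aK: "?a + K \<le> hd g1 + 1" using sorted_length_le[OF sg ne] len by linarith
  have "?a + K \<le> h" using aK hd by linarith
  from windows[OF kl this] obtain t where t: "t < K"
    "(ns ! k) div 64 ^ (?a + t) mod 64 \<noteq> (ns ! l) div 64 ^ (?a + t) mod 64" by blast
  have b: "?a \<le> ?a + t" "?a + t \<le> hd g1" using t(1) aK by auto
  have "?a + t \<in> set (bits (ns ! k)) \<longleftrightarrow> ?a + t \<in> set (bits (ns ! l))"
    unfolding g1(1) g2(1) g using sorted_between[OF s1(1) ne b] sorted_between[OF s1(2) ne b] by simp
  moreover have ht: "?a + t < h" using b hd by linarith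
  ultimately have "(ns ! k) div 64 ^ (?a + t) mod 64 = 1 \<longleftrightarrow> (ns ! l) div 64 ^ (?a + t) mod 64 = 1"
    by (simp add: set_bits)
  then show False using t(2) binary[OF mem(1) ht] binary[OF mem(2) ht] by auto
qed

text \<open>Both places must lie in targets: private words have no factor of length 2 over Y_0, ...,
  Y_h, and a rule of 64 equal symbols cannot contain two distinct low ones. Within one target the
  places coincide; across two targets \<open>common_factor\<close> applies.\<close>

lemma two_places_low_count:
  assumes sub: "sublist u (sep_join 1 (map (digits Y h) ns))"
    and pq: "p \<in> places G0 u" "q \<in> places G0 u" "p \<noteq> q" and u0: "u \<noteq> []"
  shows "low_count Y u \<le> K"
proof (rule ccontr)
  assume big: "\<not> low_count Y u \<le> K"
  then have pos: "0 < low_count Y u" by simp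
  have ns': "no_sep u" using stage_two_places_no_sep[OF st, of "fst p" "snd p" u "fst q" "snd q"] pq
    by (simp add: prod_eq_iff)
  obtain n where n: "n \<in> set ns" "sublist u (digits Y h n)"
    using sublist_sep_join[OF sub ns' u0] by auto
  have setu: "set u \<subseteq> Y ` {..h}" using set_mono_sublist[OF n(2)] set_digits[of Y h n] by blast
  have len: "2 \<le> length u" using big K2 length_filter_le[of _ u] unfolding low_count_def
    by (meson le_trans not_less less_imp_le)
  obtain i where i: "occurs_at u (digits Y h n) i" using sublist_occurs_at[OF n(2)] by blast
  have not_run: "\<not> sublist u (replicate 64 (Y j))" for j
  proof
    assume "sublist u (replicate 64 (Y j))"
    then have "set u \<subseteq> {Y j}" using set_mono_sublist by fastforce
    then have "set (filter (\<lambda>X. X \<in> Y ` {..<h}) u) \<subseteq> {Y j}" by auto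
    moreover obtain x y where "map Y (bits n) = x @ filter (\<lambda>X. X \<in> Y ` {..<h}) u @ y"
      using factor_bits[OF n(1) i pos] by blast
    then have "distinct (filter (\<lambda>X. X \<in> Y ` {..<h}) u)"
      using distinct_map_bits[of n] by (metis distinct_append)
    then have "low_count Y u = card (set (filter (\<lambda>X. X \<in> Y ` {..<h}) u))"
      unfolding low_count_def by (rule distinct_card[symmetric])
    ultimately have "low_count Y u \<le> 1"
      using card_mono[of "{Y j}" "set (filter (\<lambda>X. X \<in> Y ` {..<h}) u)"] by simp
    then show False using big K2 by simp
  qed
  let ?segs = "map (digits Y h) ns @ cs @ map (aux_at Y h) [Suc h..<Suc h]"
  have place: "\<exists>k o'. k < length ns \<and> A = 0 \<and> occurs_at u (digits Y h (ns ! k)) o' \<and> x = sep_start ?segs k + o'"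
    if "(A, x) \<in> places G0 u" for A x
  proof -
    have "A \<in> dom (rules G0)" "occurs_at u (the (rules G0 A)) x" using that by (simp_all add: places_def)
    then obtain \<alpha> where \<alpha>: "rules G0 A = Some \<alpha>" "occurs_at u \<alpha> x" by (metis domD option.sel)
    have npw: "\<not> occurs_at u w z" if "private_word Y h G0 w" for w z
      using private_word_no_run[OF that setu len] max_nonoverlapping_pos_iff[of u w] occurs_at_sublist[of u w z] by auto
    have "A = 0 \<and> \<alpha> = sep_join 1 ?segs"
      using stage_rule_cases[OF st \<alpha>(1)] npw \<alpha>(2) not_run occurs_at_sublist[OF \<alpha>(2)] by blast
    then obtain k o' where k: "k < length ?segs" "occurs_at u (?segs ! k) o'" "x = sep_start ?segs k + o'" "A = 0"
      using occurs_at_sep_join[OF _ ns' u0] \<alpha>(2) by blast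
    have "k < length ns"
    proof (rule ccontr)
      assume "\<not> k < length ns"
      then have "?segs ! k \<in> set cs" using k(1) by (simp add: nth_append)
      then have "private_word Y h G0 (?segs ! k)" using st by (simp add: stage_def)
      then show False using npw k(2) by blast
    qed
    then show ?thesis using k by (auto simp: nth_append)
  qed
  obtain A a B b where ab: "p = (A, a)" "q = (B, b)" by (metis surj_pair)
  obtain k o1 where k: "k < length ns" "A = 0" "occurs_at u (digits Y h (ns ! k)) o1" "a = sep_start ?segs k + o1"
    using place pq(1) ab by blast
  obtain l o2 where l: "l < length ns" "B = 0" "occurs_at u (digits Y h (ns ! l)) o2" "b = sep_start ?segs l + o2"
    using place pq(2) ab by blast
  show False
  proof (cases "k = l")
    case True
    then have "o1 = o2" using occurrence_unique[OF nth_mem[OF k(1)] k(3) _ pos] l(3) by simp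
    then show False using True k l pq(3) ab by simp
  next
    case False
    then show False using common_factor[OF k(1) l(1) False k(3) l(3)] big by simp
  qed
qed

lemma low_count_sep_join: "low_count Y (sep_join k us) = (\<Sum>u\<leftarrow>us. low_count Y u)"
proof (induction k us rule: sep_join.induct)
  case (3 k u u' us)
  have "T (Sep k) \<notin> Y ` {..<h}"
  proof
    assume "T (Sep k) \<in> Y ` {..<h}"
    then obtain i where "i < h" "T (Sep k) = Y i" by blast
    then have "T (Sep k) \<in> Y ` {..h}" by (metis atMost_iff image_eqI less_imp_le)
    then show False using stage_Y_T[OF st] by blast
  qed
  then show ?case using 3 by (simp add: low_count_def)
qed (simp_all add: low_count_def)

text \<open>The separator behind the targets is only produced by itself, so a prefix of the start
  rule of G spells exactly the targets. A symbol of it is either kept or expands to a word with two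
  places, and covers at most K ones in both cases.\<close>

theorem refined_size_ge:
  assumes ref: "grammar_refines G0 f G" and ne: "ns \<noteq> []"
  shows "(\<Sum>n\<leftarrow>ns. length (bits n)) \<le> K * length (the (rules G 0))"
proof -
  let ?\<alpha> = "the (rules G 0)" and ?P = "sep_join 1 (map (digits Y h) ns)"
  have r0: "rules G0 0 = Some (sep_join 1 (map (digits Y h) ns @ cs))" and csl: "length cs = h"
    using st by (auto simp: stage_def)
  have cs0: "cs \<noteq> []" using csl h_pos by auto
  obtain l y where y: "sep_join 1 (map (digits Y h) ns @ cs) = ?P @ T (Sep l) # y"
    using sep_join_append[of "map (digits Y h) ns" cs 1] ne cs0 by blast
  have d0: "0 \<in> dom (rules G0)" using r0 by auto
  then have e: "concat (map f ?\<alpha>) = ?P @ T (Sep l) # y"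
  proof -
    have "concat (map f ?\<alpha>) = the (rules G0 0)" using ref d0 unfolding grammar_refines_def by blast
    then show ?thesis unfolding r0 y option.sel .
  qed
  have d0': "0 \<in> dom (rules G)" using ref d0 unfolding grammar_refines_def by blast
  have sym: "f X = [X] \<or> (\<exists>p\<in>places G0 (f X). \<exists>q\<in>places G0 (f X). p \<noteq> q)" if "X \<in> set ?\<alpha>" for X
  proof (cases X)
    case (T t)
    then show ?thesis using ref by (simp add: grammar_refines_def)
  next
    case (N A)
    then have "A \<in> dom (rules G)" using ref that d0' unfolding grammar_refines_def closed_def
      by (metis domD option.sel)
    then show ?thesis using ref N unfolding grammar_refines_def by (cases "A \<in> dom (rules G0)") auto
  qed
  have "f X = [T (Sep l)]" if "X \<in> set ?\<alpha>" "T (Sep l) \<in> set (f X)" for X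
    using sym[OF that(1)]
  proof
    assume "\<exists>p\<in>places G0 (f X). \<exists>q\<in>places G0 (f X). p \<noteq> q"
    then have "no_sep (f X)" using stage_two_places_no_sep[OF st] by (metis surj_pair)
    then show ?thesis using that(2) by (simp add: no_sep_def)
  qed (use that(2) in auto)
  from split_expansion[OF e this] obtain \<alpha>1 \<alpha>2 where \<alpha>: "?\<alpha> = \<alpha>1 @ \<alpha>2" "concat (map f \<alpha>1) = ?P" by blast
  have bound: "low_count Y (f X) \<le> K" if X: "X \<in> set \<alpha>1" for X
  proof -
    have X\<alpha>: "X \<in> set ?\<alpha>" using \<alpha>(1) X by simp
    show ?thesis using sym[OF X\<alpha>]
    proof
      assume "f X = [X]"
      then show ?thesis using K2 by (simp add: low_count_def)
    next
      assume "\<exists>p\<in>places G0 (f X). \<exists>q\<in>places G0 (f X). p \<noteq> q"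
      moreover have "sublist (f X) ?P"
        using X \<alpha>(2) by (metis concat.simps(2) concat_append list.map(2) map_append split_list sublist_appendI)
      moreover have "f X \<noteq> []" using ref by (simp add: grammar_refines_def)
      ultimately show ?thesis using two_places_low_count by blast
    qed
  qed
  have "(\<Sum>n\<leftarrow>ns. length (bits n)) = (\<Sum>n\<leftarrow>ns. low_count Y (digits Y h n))"
    using filter_low_digits by (intro arg_cong[where f = sum_list] map_cong) (simp_all add: low_count_def)
  also have "\<dots> = low_count Y ?P" unfolding low_count_sep_join by (simp add: o_def)
  also have "\<dots> = low_count Y (concat (map f \<alpha>1))" by (simp add: \<alpha>(2))
  also have "\<dots> \<le> K * length \<alpha>1"
    using bound by (induction \<alpha>1) (auto simp: low_count_def add_mono)
  also have "\<dots> \<le> K * length ?\<alpha>" unfolding \<alpha>(1) by simp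
  finally show ?thesis .
qed

end

end

section \<open>The cost of straight-line programs\<close>

lemma expands_append: "expands G \<alpha> u \<Longrightarrow> expands G \<beta> v \<Longrightarrow> expands G (\<alpha> @ \<beta>) (u @ v)"
proof (induction rule: expands.induct)
  case (expands_N A \<gamma> u \<alpha> u')
  then show ?case using expands.expands_N[of G A \<gamma> u "\<alpha> @ \<beta>" "u' @ v"] by simp
qed (auto intro: expands.intros)

lemma expands_mono:
  assumes "expands G \<alpha> u" "\<And>A \<beta>. rules G A = Some \<beta> \<Longrightarrow> rules G' A = Some \<beta>"
  shows "expands G' \<alpha> u"
  using assms(1) by induction (auto intro: expands.intros assms(2))

text \<open>A list of right-hand sides, each referring to earlier ones only, is a straight-line program
  whose start symbol is the last nonterminal.\<close>

definition list_grammar :: "'t symbol list list \<Rightarrow> 't grammar" where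
  "list_grammar rs = \<lparr>start = length rs - 1, rules = (\<lambda>i. if i < length rs then Some (rs ! i) else None)\<rparr>"

definition backward :: "'t symbol list list \<Rightarrow> bool" where
  "backward rs \<longleftrightarrow> (\<forall>i<length rs. rs ! i \<noteq> [] \<and> (\<forall>j. N j \<in> set (rs ! i) \<longrightarrow> j < i))"

text \<open>A cost calculus that hides the names of nonterminals: words are added one at a time,
  each at the price of the number of pieces it is composed of
  (\<open>slp_cost_insert\<close>).\<close>

definition slp_cost :: "'t list set \<Rightarrow> nat \<Rightarrow> bool" where
  "slp_cost S m \<longleftrightarrow> (\<exists>rs. backward rs \<and> sum_list (map length rs) \<le> m \<and>
    (\<forall>u\<in>S. \<exists>i<length rs. expands (list_grammar rs) [N i] u))"

definition formed :: "nat \<Rightarrow> 't list set \<Rightarrow> 't list \<Rightarrow> bool" where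
  "formed c S u \<longleftrightarrow> (\<exists>us. us \<noteq> [] \<and> length us \<le> c \<and> set us \<subseteq> S \<union> range (\<lambda>t. [t]) \<and> u = concat us)"

lemma formed_mono: "formed c S u \<Longrightarrow> c \<le> c' \<Longrightarrow> S \<subseteq> S' \<Longrightarrow> formed c' S' u"
proof -
  assume "formed c S u" "c \<le> c'" "S \<subseteq> S'"
  then obtain us where us: "us \<noteq> []" "length us \<le> c" "set us \<subseteq> S \<union> range (\<lambda>t. [t])" "u = concat us"
    unfolding formed_def by blast
  have "length us \<le> c'" "set us \<subseteq> S' \<union> range (\<lambda>t. [t])"
    using us \<open>c \<le> c'\<close> \<open>S \<subseteq> S'\<close> by (linarith, blast)
  then show ?thesis using us unfolding formed_def by blast
qed

lemma is_slp_list_grammar: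
  assumes "backward rs" "rs \<noteq> []"
  shows "is_slp (list_grammar rs)"
proof -
  have dom: "dom (rules (list_grammar rs)) = {..<length rs}"
    by (auto simp: list_grammar_def split: if_splits)
  have "depends (list_grammar rs) \<subseteq> less_than\<inverse>"
    using assms(1) by (auto simp: depends_def list_grammar_def backward_def split: if_splits)
  moreover have "acyclic (less_than\<inverse>)" by (simp add: wf_acyclic[OF wf_less_than])
  ultimately have "acyclic (depends (list_grammar rs))" by (rule acyclic_subset[rotated])
  moreover have "start (list_grammar rs) < length rs" using assms(2) by (simp add: list_grammar_def)
  moreover have "\<alpha> \<noteq> [] \<and> (\<forall>A'. N A' \<in> set \<alpha> \<longrightarrow> A' < length rs)"
    if "rules (list_grammar rs) A = Some \<alpha>" for A \<alpha>
    using that assms(1) unfolding list_grammar_def backward_def by (auto split: if_splits dest: less_trans)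
  ultimately show ?thesis unfolding is_slp_def dom by auto
qed

lemma grammar_size_list_grammar: "grammar_size (list_grammar rs) = sum_list (map length rs)"
proof -
  have "dom (rules (list_grammar rs)) = {..<length rs}"
    by (auto simp: list_grammar_def split: if_splits)
  then have "grammar_size (list_grammar rs) = (\<Sum>i<length rs. length (rs ! i))"
    unfolding grammar_size_def by (auto simp: list_grammar_def intro!: sum.cong)
  then show ?thesis by (simp add: sum_list_sum_nth atLeast0LessThan)
qed

lemma extend_program:
  assumes "backward rs" "\<forall>u\<in>S. \<exists>i<length rs. expands (list_grammar rs) [N i] u"
    and us: "us \<noteq> []" "set us \<subseteq> S \<union> range (\<lambda>t. [t])"
  shows "\<exists>r. backward (rs @ [r]) \<and> length r = length us \<and>
    expands (list_grammar (rs @ [r])) [N (length rs)] (concat us) \<and>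
    (\<forall>u\<in>S. \<exists>i<length (rs @ [r]). expands (list_grammar (rs @ [r])) [N i] u)"
proof -
  have "\<exists>r. length r = length us \<and> (\<forall>j. N j \<in> set r \<longrightarrow> j < length rs) \<and> expands (list_grammar rs) r (concat us)"
    using us(2)
  proof (induction us)
    case Nil
    then show ?case by (auto intro: expands.intros)
  next
    case (Cons u us)
    then obtain r where r: "length r = length us" "\<forall>j. N j \<in> set r \<longrightarrow> j < length rs"
      "expands (list_grammar rs) r (concat us)" by auto
    have "\<exists>X. (\<forall>j. X = N j \<longrightarrow> j < length rs) \<and> expands (list_grammar rs) [X] u"
    proof (cases "u \<in> S")
      case True
      then show ?thesis using assms(2) by blast
    next
      case False
      then obtain t where "u = [t]" using Cons.prems by auto
      then show ?thesis by (intro exI[of _ "T t"]) (auto intro: expands.intros)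
    qed
    then obtain X where X: "\<forall>j. X = N j \<longrightarrow> j < length rs" "expands (list_grammar rs) [X] u" by blast
    show ?case using r X expands_append[OF X(2) r(3)] by (intro exI[of _ "X # r"]) auto
  qed
  then obtain r where r: "length r = length us" "\<forall>j. N j \<in> set r \<longrightarrow> j < length rs"
    "expands (list_grammar rs) r (concat us)" by blast
  have mono: "rules (list_grammar rs) A = Some \<beta> \<Longrightarrow> rules (list_grammar (rs @ [r])) A = Some \<beta>" for A \<beta>
    by (auto simp: list_grammar_def nth_append split: if_splits)
  have "backward (rs @ [r])"
    using assms(1) r us(1) unfolding backward_def by (auto simp: nth_append less_Suc_eq)
  moreover have "expands (list_grammar (rs @ [r])) [N (length rs)] (concat us @ [])"
    by (rule expands.expands_N[OF _ expands_mono[OF r(3) mono] expands_Nil])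
      (simp_all add: list_grammar_def)
  moreover have "\<exists>i<length (rs @ [r]). expands (list_grammar (rs @ [r])) [N i] u" if "u \<in> S" for u
  proof -
    obtain i where "i < length rs" "expands (list_grammar rs) [N i] u" using assms(2) \<open>u \<in> S\<close> by blast
    then show ?thesis using expands_mono[OF _ mono] by (intro exI[of _ i]) auto
  qed
  ultimately show ?thesis using r(1) by (intro exI[of _ r]) auto
qed

lemma slp_cost_insert:
  assumes "slp_cost S m" "formed c S u"
  shows "slp_cost (insert u S) (m + c)"
proof -
  obtain rs where rs: "backward rs" "sum_list (map length rs) \<le> m"
    "\<forall>u\<in>S. \<exists>i<length rs. expands (list_grammar rs) [N i] u" using assms(1) unfolding slp_cost_def by blast
  obtain us where us: "us \<noteq> []" "length us \<le> c" "set us \<subseteq> S \<union> range (\<lambda>t. [t])" "u = concat us"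
    using assms(2) unfolding formed_def by blast
  obtain r where "backward (rs @ [r])" "length r = length us"
    "expands (list_grammar (rs @ [r])) [N (length rs)] (concat us)"
    "\<forall>u\<in>S. \<exists>i<length (rs @ [r]). expands (list_grammar (rs @ [r])) [N i] u"
    using extend_program[OF rs(1,3) us(1,3)] by blast
  then show ?thesis unfolding slp_cost_def using rs(2) us(2,4) by (intro exI[of _ "rs @ [r]"]) auto
qed

lemma slp_cost_empty: "slp_cost {} 0"
  unfolding slp_cost_def by (intro exI[of _ "[]"]) (simp add: backward_def)

lemma slp_cost_mono: "slp_cost S m \<Longrightarrow> S' \<subseteq> S \<Longrightarrow> m \<le> m' \<Longrightarrow> slp_cost S' m'"
  unfolding slp_cost_def by (meson le_trans subset_iff)

lemma slp_cost_chain: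
  assumes "slp_cost S m" "\<And>k. k < n \<Longrightarrow> formed c (S \<union> f ` {..<k}) (f k)"
  shows "slp_cost (S \<union> f ` {..<n}) (m + c * n)"
  using assms(2)
proof (induction n)
  case (Suc n)
  then have "slp_cost (insert (f n) (S \<union> f ` {..<n})) (m + c * n + c)"
    by (intro slp_cost_insert) auto
  moreover have "insert (f n) (S \<union> f ` {..<n}) = S \<union> f ` {..<Suc n}" by (auto simp: lessThan_Suc)
  ultimately show ?case by (simp add: algebra_simps)
qed (use assms(1) in simp)

text \<open>The step is required for every S' above S because the families of smaller index have
  been added by then.\<close>

lemma slp_cost_UN:
  assumes "slp_cost S m" "\<And>k S' m'. k < n \<Longrightarrow> S \<subseteq> S' \<Longrightarrow> slp_cost S' m' \<Longrightarrow> slp_cost (S' \<union> F k) (m' + c)"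
  shows "slp_cost (S \<union> (\<Union>k<n. F k)) (m + c * n)"
  using assms(2)
proof (induction n)
  case (Suc n)
  have "slp_cost (S \<union> (\<Union>k<n. F k)) (m + c * n)" by (rule Suc.IH) (use Suc.prems in simp)
  then have "slp_cost (S \<union> (\<Union>k<n. F k) \<union> F n) (m + c * n + c)" by (intro Suc.prems) auto
  moreover have "S \<union> (\<Union>k<n. F k) \<union> F n = S \<union> (\<Union>k<Suc n. F k)" by (auto simp: lessThan_Suc)
  ultimately show ?case by (simp add: algebra_simps)
qed (use assms(1) in simp)

lemma slp_cost_generates:
  assumes "slp_cost S m" "formed c S u"
  shows "\<exists>G. generates G u \<and> grammar_size G \<le> m + c"
proof -
  obtain rs where rs: "backward rs" "sum_list (map length rs) \<le> m"
    "\<forall>u\<in>S. \<exists>i<length rs. expands (list_grammar rs) [N i] u" using assms(1) unfolding slp_cost_def by blast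
  obtain us where us: "us \<noteq> []" "length us \<le> c" "set us \<subseteq> S \<union> range (\<lambda>t. [t])" "u = concat us"
    using assms(2) unfolding formed_def by blast
  obtain r where r: "backward (rs @ [r])" "length r = length us"
    "expands (list_grammar (rs @ [r])) [N (length rs)] (concat us)"
    using extend_program[OF rs(1,3) us(1,3)] by blast
  let ?G = "list_grammar (rs @ [r])"
  have slp: "is_slp ?G" using is_slp_list_grammar[OF r(1)] by simp
  have "val ?G (N (length rs)) = u"
    unfolding val_def us(4) using r(3) expands_unique by (intro the_equality) blast+
  then have "generates ?G u" using slp by (simp add: generates_def list_grammar_def)
  moreover have "grammar_size ?G \<le> m + c" using rs(2) us(2) r(2) by (simp add: grammar_size_list_grammar)
  ultimately show ?thesis by blast
qed

lemma min_slp_size_le: "generates G u \<Longrightarrow> min_slp_size u \<le> grammar_size G"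
  unfolding min_slp_size_def by (rule Least_le) blast

lemma expands_letters:
  "expands G \<alpha> u \<Longrightarrow> T ` set u \<subseteq> set \<alpha> \<union> (\<Union>\<beta>\<in>ran (rules G). set \<beta>)"
proof (induction rule: expands.induct)
  case (expands_N A \<beta> u \<alpha> v)
  have "set \<beta> \<subseteq> (\<Union>\<beta>\<in>ran (rules G). set \<beta>)" using expands_N.hyps(1) by (auto simp: ran_def)
  then show ?case using expands_N.IH by auto
qed auto

text \<open>Every letter of u has to be written in some right-hand side. This yields the lower bound
  for g(w).\<close>

lemma card_letters_le:
  assumes "generates G u"
  shows "card (set u) \<le> grammar_size G"
proof -
  have slp: "is_slp G" and u: "val G (N (start G)) = u" using assms by (auto simp: generates_def)
  have fin: "finite (dom (rules G))" and st: "start G \<in> dom (rules G)" using slp by (auto simp: is_slp_def)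
  have "expands G [N (start G)] u" using expands_val[OF slp st] u by simp
  then have "T ` set u \<subseteq> {N (start G)} \<union> (\<Union>\<beta>\<in>ran (rules G). set \<beta>)" using expands_letters by fastforce
  moreover have "ran (rules G) = (\<lambda>A. the (rules G A)) ` dom (rules G)" by (force simp: ran_def)
  ultimately have sub: "T ` set u \<subseteq> (\<Union>A\<in>dom (rules G). set (the (rules G A)))" by auto
  have "card (set u) = card (T ` set u)" by (simp add: card_image inj_on_def)
  also have "\<dots> \<le> card (\<Union>A\<in>dom (rules G). set (the (rules G A)))" using sub fin by (intro card_mono) auto
  also have "\<dots> \<le> (\<Sum>A\<in>dom (rules G). card (set (the (rules G A))))" using fin by (rule card_UN_le)
  also have "\<dots> \<le> grammar_size G" unfolding grammar_size_def by (intro sum_mono card_length)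
  finally show ?thesis .
qed

lemma le_min_slp_size:
  assumes "generates G u"
  shows "card (set u) \<le> min_slp_size u"
proof -
  have "\<exists>G'. generates G' u \<and> grammar_size G' = min_slp_size u"
    unfolding min_slp_size_def by (rule LeastI_ex) (use assms in blast)
  then show ?thesis using card_letters_le by metis
qed

section \<open>De Bruijn words\<close>

definition binary_words :: "nat \<Rightarrow> nat list set" where
  "binary_words n = {u. set u \<subseteq> {0, 1} \<and> length u = n}"

lemma finite_binary_words: "finite (binary_words n)"
  unfolding binary_words_def by (rule finite_lists_length_eq) simp

lemma card_binary_words: "card (binary_words n) = 2 ^ n"
  unfolding binary_words_def using card_lists_length_eq[of "{0, 1 :: nat}" n] by (simp add: numeral_2_eq_2)

text \<open>The de Bruijn graph, with words of length n + 1 as arcs from their prefix to their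
  suffix. An Eulerian circuit in it spells a cyclic de Bruijn word of order n + 1.\<close>

definition db_graph :: "nat \<Rightarrow> (nat list, nat list) pre_digraph" where
  "db_graph n = \<lparr>verts = binary_words n, arcs = binary_words (Suc n), tail = butlast, head = tl\<rparr>"

lemma db_graph_sel [simp]:
  "verts (db_graph n) = binary_words n" "arcs (db_graph n) = binary_words (Suc n)"
  "tail (db_graph n) = butlast" "head (db_graph n) = tl"
  by (simp_all add: db_graph_def)

lemma binary_words_butlast: "u \<in> binary_words (Suc n) \<Longrightarrow> butlast u \<in> binary_words n"
  by (auto simp: binary_words_def dest: in_set_butlastD)

lemma binary_words_tl: "u \<in> binary_words (Suc n) \<Longrightarrow> tl u \<in> binary_words n"
  by (cases u) (auto simp: binary_words_def)

interpretation db: fin_digraph "db_graph n"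
  by unfold_locales (simp_all add: binary_words_butlast binary_words_tl finite_binary_words)

lemma db_graph_degree:
  assumes "v \<in> binary_words n"
  shows "in_degree (db_graph n) v = out_degree (db_graph n) v"
proof -
  have "in_arcs (db_graph n) v = (\<lambda>c. c # v) ` {0, 1}"
  proof (intro set_eqI iffI)
    fix e assume "e \<in> in_arcs (db_graph n) v"
    then have "e \<in> binary_words (Suc n)" "tl e = v" by (auto simp: in_arcs_def)
    then show "e \<in> (\<lambda>c. c # v) ` {0, 1}" by (cases e) (auto simp: binary_words_def)
  qed (use assms in \<open>auto simp: in_arcs_def binary_words_def\<close>)
  moreover have "out_arcs (db_graph n) v = (\<lambda>c. v @ [c]) ` {0, 1}"
  proof (intro set_eqI iffI)
    fix e assume "e \<in> out_arcs (db_graph n) v"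
    then have "e \<in> binary_words (Suc n)" "butlast e = v" by (auto simp: out_arcs_def)
    then show "e \<in> (\<lambda>c. v @ [c]) ` {0, 1}" by (cases e rule: rev_cases) (auto simp: binary_words_def)
  qed (use assms in \<open>auto simp: out_arcs_def binary_words_def\<close>)
  ultimately show ?thesis unfolding in_degree_def out_degree_def
    by (simp add: card_insert_if)
qed

text \<open>Appending the letters of v one by one and dropping those of u leads from u to v in n
  steps.\<close>

lemma db_graph_strongly_connected: "strongly_connected (db_graph n)"
proof (rule strongly_connectedI)
  have "replicate n 0 \<in> binary_words n" by (auto simp: binary_words_def)
  then show "verts (db_graph n) \<noteq> {}" by auto
  fix u v assume uv: "u \<in> verts (db_graph n)" "v \<in> verts (db_graph n)"
  have "reachable (db_graph n) u (drop k u @ take k v)" if "k \<le> n" for k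
    using that
  proof (induction k)
    case 0
    then show ?case using uv by simp
  next
    case (Suc k)
    let ?x = "drop k u @ take k v"
    have len: "length u = n" "length v = n" using uv by (auto simp: binary_words_def)
    have mem: "?x @ [v ! k] \<in> binary_words (Suc n)"
    proof -
      have "v ! k \<in> set v" using Suc.prems len by simp
      moreover have "set u \<subseteq> {0, 1}" "set v \<subseteq> {0, 1}" using uv by (simp_all add: binary_words_def)
      ultimately have "set (?x @ [v ! k]) \<subseteq> {0, 1}"
        using set_drop_subset[of k u] set_take_subset[of k v] by (simp only: set_append) auto
      then show ?thesis using len Suc.prems unfolding binary_words_def by simp
    qed
    have "drop k u = u ! k # drop (Suc k) u" using Suc.prems len by (simp add: Cons_nth_drop_Suc)
    then have "tl (?x @ [v ! k]) = drop (Suc k) u @ take (Suc k) v"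
      using Suc.prems len by (simp add: take_Suc_conv_app_nth)
    then have "arc_to_ends (db_graph n) (?x @ [v ! k]) = (?x, drop (Suc k) u @ take (Suc k) v)"
      unfolding arc_to_ends_def db_graph_sel butlast_snoc by (simp only:)
    then have "(?x, drop (Suc k) u @ take (Suc k) v) \<in> arcs_ends (db_graph n)"
      by (rule db.dominatesI) (simp only: db_graph_sel mem)
    then show ?case using Suc by (meson Suc_leD db.reachable_adj_trans)
  qed
  from this[of n] show "reachable (db_graph n) u v" using uv by (simp add: binary_words_def)
qed

lemma cas_nth:
  assumes "pre_digraph.cas (db_graph n) u p v"
  shows "(\<forall>i. Suc i < length p \<longrightarrow> tl (p ! i) = butlast (p ! Suc i)) \<and>
    (p \<noteq> [] \<longrightarrow> butlast (hd p) = u \<and> tl (last p) = v)"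
  using assms
proof (induction p arbitrary: u)
  case (Cons e p)
  then have *: "butlast e = u" "pre_digraph.cas (db_graph n) (tl e) p v"
    by (simp_all add: pre_digraph.cas.simps)
  from Cons.IH[OF *(2)] show ?case using * by (cases p) (auto simp: nth_Cons pre_digraph.cas.simps split: nat.splits)
qed (simp add: pre_digraph.cas.simps)

text \<open>The word consists of the first letters of the arcs of an Eulerian circuit. Consecutive
  arcs overlap in n letters, so the cyclic window of length n + 1 at i is arc i, and each word of
  that length is an arc exactly once.\<close>

lemma ex_de_bruijn: "\<exists>d. de_bruijn (Suc n) d"
proof -
  have "connected (db_graph n)"
    using db_graph_strongly_connected[of n] db.reachable_mk_symmetricI[where n = n]
    unfolding connected_def strongly_connected_def by simp
  then obtain u p where "pre_digraph.euler_trail (db_graph n) u p u"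
    using db.closed_euler1 db_graph_degree by force
  then have p: "pre_digraph.cas (db_graph n) u p u" "distinct p" "set p = binary_words (Suc n)"
    by (auto simp: pre_digraph.euler_trail_def pre_digraph.trail_def pre_digraph.awalk_def)
  define L where "L = length p"
  have L: "L = 2 ^ Suc n" unfolding L_def using p(2,3) card_binary_words by (metis distinct_card)
  have L0: "0 < L" using L by simp
  then have pne: "p \<noteq> []" by (auto simp: L_def)
  have step: "tl (p ! (i mod L)) = butlast (p ! (Suc i mod L))" for i
  proof (cases "Suc (i mod L) < L")
    case True
    then have "Suc i mod L = Suc (i mod L)" by (simp add: mod_Suc)
    then show ?thesis using True cas_nth[OF p(1)] by (simp add: L_def)
  next
    case False
    then have e: "i mod L = L - 1" using mod_less_divisor[OF L0, of i] by linarith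
    then have "Suc i mod L = 0" using L0 by (simp add: mod_Suc)
    then show ?thesis using cas_nth[OF p(1)] pne e by (simp add: L_def hd_conv_nth last_conv_nth)
  qed
  define d where "d = map hd p"
  have len: "length (p ! (i mod L)) = Suc n" for i
  proof -
    have "p ! (i mod L) \<in> set p" using L0 by (simp add: L_def)
    then show ?thesis using p(3) by (simp add: binary_words_def)
  qed
  \<comment> \<open>Letter k of an arc is the first letter of the arc k steps further along the
    circuit.\<close>
  have win: "k \<le> n \<Longrightarrow> p ! (i mod L) ! k = d ! ((i + k) mod L)" for i k
  proof (induction k arbitrary: i)
    case 0
    have "i mod L < length p" using L0 by (simp add: L_def)
    then show ?case using len[of i] by (simp add: d_def hd_conv_nth[symmetric] length_greater_0_conv[symmetric] del: length_greater_0_conv)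
  next
    case (Suc k)
    have "p ! (i mod L) ! Suc k = tl (p ! (i mod L)) ! k" using len[of i] Suc.prems by (simp add: nth_tl)
    also have "\<dots> = p ! (Suc i mod L) ! k" unfolding step using len[of "Suc i"] Suc.prems by (simp add: nth_butlast)
    also have "\<dots> = d ! ((Suc i + k) mod L)" using Suc by simp
    finally show ?case by simp
  qed
  have window: "map (\<lambda>k. d ! ((i + k) mod length d)) [0..<Suc n] = p ! i" if "i < L" for i
  proof (rule nth_equalityI)
    show "length (map (\<lambda>k. d ! ((i + k) mod length d)) [0..<Suc n]) = length (p ! i)"
      using len[of i] that by simp
    fix k assume "k < length (map (\<lambda>k. d ! ((i + k) mod length d)) [0..<Suc n])"
    then have "k \<le> n" by simp
    moreover have "length d = L" by (simp add: d_def L_def)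
    ultimately show "map (\<lambda>k. d ! ((i + k) mod length d)) [0..<Suc n] ! k = p ! i ! k"
      using win[of k i] that by (simp del: upt_Suc)
  qed
  have "de_bruijn (Suc n) d"
    unfolding de_bruijn_def
  proof (intro conjI allI impI)
    show "set d \<subseteq> {0, 1}"
    proof
      fix x assume "x \<in> set d"
      then obtain e where "e \<in> binary_words (Suc n)" "x = hd e" using p(3) by (auto simp: d_def)
      then show "x \<in> {0, 1}" by (cases e) (auto simp: binary_words_def)
    qed
    show "length d = 2 ^ Suc n" using L by (simp add: d_def L_def)
    fix u :: "nat list" assume "set u \<subseteq> {0, 1} \<and> length u = Suc n"
    then have "u \<in> set p" using p(3) by (simp add: binary_words_def)
    then obtain i where i: "i < L" "p ! i = u" by (auto simp: in_set_conv_nth L_def)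
    have ld: "length d = L" by (simp add: d_def L_def)
    show "\<exists>!i. i < length d \<and> map (\<lambda>k. d ! ((i + k) mod length d)) [0..<Suc n] = u"
    proof (rule ex1I[of _ i])
      show "i < length d \<and> map (\<lambda>k. d ! ((i + k) mod length d)) [0..<Suc n] = u"
        using window[OF i(1)] i ld by simp
      fix i' assume "i' < length d \<and> map (\<lambda>k. d ! ((i' + k) mod length d)) [0..<Suc n] = u"
      then have "i' < L" "p ! i' = p ! i" using window[of i'] ld i by auto
      then show "i' = i" using p(2) i(1) by (simp add: nth_eq_iff_index_eq L_def)
    qed
  qed
  then show ?thesis by blast
qed

text \<open>All candidates have the same length, where \<open>lexord\<close> agrees with the
  well-founded \<open>lex\<close>. So a minimum exists, and asymmetry makes it unique.\<close>

lemma de_bruijn_least: "de_bruijn (Suc n) (least_de_bruijn (Suc n))"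
proof -
  let ?S = "{d. de_bruijn (Suc n) d}"
  let ?P = "\<lambda>d. de_bruijn (Suc n) d \<and> (\<forall>d'. de_bruijn (Suc n) d' \<longrightarrow> d = d' \<or> (d, d') \<in> lexord less_than)"
  have wf: "wf (lex (less_than))" by (rule wf_lex[OF wf_less_than])
  have lex: "(x, y) \<in> lex less_than \<longleftrightarrow> (x, y) \<in> lexord less_than" if "x \<in> ?S" "y \<in> ?S" for x y
    using that by (auto simp: lexord_lex de_bruijn_def)
  obtain d0 where "d0 \<in> ?S" using ex_de_bruijn by auto
  then obtain d where d: "d \<in> ?S" "\<And>y. (y, d) \<in> lex less_than \<Longrightarrow> y \<notin> ?S"
    using wfE_min[OF wf] by metis
  have "d = d' \<or> (d, d') \<in> lexord less_than" if "d' \<in> ?S" for d'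
  proof -
    have "\<forall>a b :: nat. (a, b) \<in> less_than \<or> a = b \<or> (b, a) \<in> less_than" by auto
    then show ?thesis using lexord_linear[of less_than d d'] d(2) that lex[OF that d(1)] by blast
  qed
  then have P: "?P d" using d(1) by simp
  have "d' = d" if "?P d'" for d'
  proof (rule ccontr)
    assume "d' \<noteq> d"
    then have "(d, d') \<in> lexord less_than" "(d', d) \<in> lexord less_than" using that P by blast+
    then have "(d, d') \<in> lex less_than" "(d', d) \<in> lex less_than" using lex that P by auto
    then show False using wf_asym[OF wf] by blast
  qed
  then have "?P (least_de_bruijn (Suc n))"
    unfolding least_de_bruijn_def using P by (rule theI[where P = ?P, rotated])
  then show ?thesis by blast
qed

lemma de_bruijn_window:
  assumes d: "de_bruijn q d" and ij: "i + q \<le> length d" "j + q \<le> length d" "0 < q"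
    and eq: "\<And>t. t < q \<Longrightarrow> d ! (i + t) = d ! (j + t)"
  shows "i = j"
proof -
  let ?w = "\<lambda>i. map (\<lambda>k. d ! ((i + k) mod length d)) [0..<q]"
  have w: "?w k = map (\<lambda>t. d ! (k + t)) [0..<q]" if "k + q \<le> length d" for k
    using that by (intro map_cong) auto
  have "set (?w i) \<subseteq> {0, 1}"
  proof -
    have "length d > 0" using ij by linarith
    then have "d ! (x mod length d) \<in> set d" for x by simp
    moreover have "set d \<subseteq> {0, 1}" using d by (simp add: de_bruijn_def)
    ultimately have "d ! (x mod length d) \<in> {0, 1}" for x by blast
    then show ?thesis by (simp only: set_map image_subset_iff) simp
  qed
  moreover have "length (?w i) = q" by simp
  ultimately have "\<exists>!k. k < length d \<and> ?w k = ?w i" using d unfolding de_bruijn_def by blast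
  moreover have "?w j = ?w i" unfolding w[OF ij(1)] w[OF ij(2)] using eq by simp
  moreover have "i < length d" "j < length d" using ij by linarith+
  ultimately show ?thesis by blast
qed

lemma length_morph_\<phi>: "length (morph \<phi> d) = 2 * length d"
  by (induction d) (auto simp: morph_def \<phi>_def)

lemma morph_\<phi>_nth:
  assumes "set d \<subseteq> {0, 1}" "k < length d"
  shows "morph \<phi> d ! (2 * k) = d ! k" "morph \<phi> d ! Suc (2 * k) = 1 - d ! k"
proof -
  have "morph \<phi> d ! (2 * k) = d ! k \<and> morph \<phi> d ! Suc (2 * k) = 1 - d ! k"
    using assms
  proof (induction d arbitrary: k)
    case (Cons x d)
    have m: "morph \<phi> (x # d) = \<phi> x @ morph \<phi> d" "length (\<phi> x) = 2" by (simp_all add: morph_def \<phi>_def)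
    show ?case
    proof (cases k)
      case 0
      then show ?thesis using Cons.prems unfolding m by (auto simp: \<phi>_def)
    next
      case (Suc k')
      then show ?thesis using Cons by (simp add: m nth_append)
    qed
  qed simp
  then show "morph \<phi> d ! (2 * k) = d ! k" "morph \<phi> d ! Suc (2 * k) = 1 - d ! k" by auto
qed

lemma morph_\<phi>_set: "set (morph \<phi> d) \<subseteq> {0, 1}"
  by (auto simp: morph_def \<phi>_def split: if_splits)

text \<open>Opposite parities make each letter of D the complement of a complement of the one
  before, so D is constant on the q + 1 letters from a on, and its windows at a and a + 1 agree. The
  last of these letters is read at offset 2q, hence the length 2q + 1.\<close>

lemma morph_\<phi>_window_even_odd:
  assumes d: "de_bruijn q d" and q: "0 < q"
    and ij: "2 * a + (2 * q + 1) \<le> 2 * length d" "Suc (2 * b) + (2 * q + 1) \<le> 2 * length d"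
    and eq: "\<And>t. t < 2 * q + 1 \<Longrightarrow> morph \<phi> d ! (2 * a + t) = morph \<phi> d ! (Suc (2 * b) + t)"
  shows False
proof -
  let ?W = "morph \<phi> d"
  have bin: "set d \<subseteq> {0, 1}" using d by (simp add: de_bruijn_def)
  have const: "d ! (a + t) = d ! a" if "t \<le> q" for t
    using that
  proof (induction t)
    case (Suc t)
    have "d ! (a + Suc t) = ?W ! (2 * (a + Suc t))"
      using morph_\<phi>_nth(1)[OF bin, of "a + Suc t"] Suc.prems ij by linarith
    also have "\<dots> = ?W ! (2 * a + (2 * t + 2))" by (simp add: algebra_simps)
    also have "\<dots> = ?W ! (Suc (2 * b) + (2 * t + 2))" using eq[of "2 * t + 2"] Suc.prems by (simp add: algebra_simps)
    also have "\<dots> = ?W ! Suc (2 * (b + t + 1))" by (simp add: algebra_simps)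
    also have "\<dots> = 1 - d ! (b + t + 1)" using morph_\<phi>_nth(2)[OF bin, of "b + t + 1"] Suc.prems ij by linarith
    also have "d ! (b + t + 1) = ?W ! (2 * (b + t + 1))"
      using morph_\<phi>_nth(1)[OF bin, of "b + t + 1"] Suc.prems ij by linarith
    also have "\<dots> = ?W ! (Suc (2 * b) + (2 * t + 1))" by (simp add: algebra_simps)
    also have "\<dots> = ?W ! (2 * a + (2 * t + 1))" using eq[of "2 * t + 1"] Suc.prems by simp
    also have "\<dots> = ?W ! Suc (2 * (a + t))" by (simp add: algebra_simps)
    also have "\<dots> = 1 - d ! (a + t)" using morph_\<phi>_nth(2)[OF bin, of "a + t"] Suc.prems ij by linarith
    finally have *: "d ! (a + Suc t) = 1 - (1 - d ! (a + t))" .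
    have "a + t < length d" using Suc.prems ij by simp
    then have "d ! (a + t) \<in> {0, 1}" using bin nth_mem by blast
    then show ?case using * Suc by auto
  qed simp
  have "a = Suc a"
  proof (rule de_bruijn_window[OF d])
    show "d ! (a + t) = d ! (Suc a + t)" if "t < q" for t
      using const[of t] const[of "Suc t"] that by simp
  qed (use ij q in linarith)+
  then show False by simp
qed

text \<open>With equal parities the common factor contains q whole images, and their preimages
  determine the position; opposite parities are excluded by the preceding lemma. For q = 2r the
  length is 4r + 1.\<close>

lemma morph_\<phi>_window:
  assumes d: "de_bruijn q d" and q: "0 < q"
    and ij: "i + (2 * q + 1) \<le> 2 * length d" "j + (2 * q + 1) \<le> 2 * length d"
    and eq: "\<And>t. t < 2 * q + 1 \<Longrightarrow> morph \<phi> d ! (i + t) = morph \<phi> d ! (j + t)"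
  shows "i = j"
proof -
  let ?W = "morph \<phi> d"
  have bin: "set d \<subseteq> {0, 1}" using d by (simp add: de_bruijn_def)
  consider a b where "i = 2 * a" "j = 2 * b" | a b where "i = Suc (2 * a)" "j = Suc (2 * b)" |
    a b where "i = 2 * a" "j = Suc (2 * b)" | a b where "i = Suc (2 * a)" "j = 2 * b"
    by (metis evenE oddE Suc_eq_plus1)
  then show ?thesis
  proof cases
    case 1
    have "a = b"
    proof (rule de_bruijn_window[OF d])
      fix t assume t: "t < q"
      have "?W ! (2 * (a + t)) = ?W ! (2 * (b + t))" using eq[of "2 * t"] t 1 by (simp add: algebra_simps)
      then show "d ! (a + t) = d ! (b + t)"
        using morph_\<phi>_nth(1)[OF bin, of "a + t"] morph_\<phi>_nth(1)[OF bin, of "b + t"] t ij 1 by simp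
    qed (use ij q 1 in linarith)+
    then show ?thesis using 1 by simp
  next
    case 2
    have "Suc a = Suc b"
    proof (rule de_bruijn_window[OF d])
      fix t assume t: "t < q"
      have "?W ! (2 * (Suc a + t)) = ?W ! (2 * (Suc b + t))"
        using eq[of "Suc (2 * t)"] t 2 by (simp add: algebra_simps)
      then show "d ! (Suc a + t) = d ! (Suc b + t)"
        using morph_\<phi>_nth(1)[OF bin, of "Suc a + t"] morph_\<phi>_nth(1)[OF bin, of "Suc b + t"] t ij 2 by simp
    qed (use ij q 2 in linarith)+
    then show ?thesis using 2 by simp
  next
    case 3
    then show ?thesis using morph_\<phi>_window_even_odd[OF d q, of a b] ij eq by metis
  next
    case 4
    then show ?thesis using morph_\<phi>_window_even_odd[OF d q, of b a] ij eq by metis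
  qed
qed

text \<open>Each image 01 or 10 has exactly one letter 1, and a window of length l contains at least
  (l - 1) div 2 whole images.\<close>

lemma morph_\<phi>_ones:
  assumes "set d \<subseteq> {0, 1}" "x + l \<le> 2 * length d"
  shows "(l - 1) div 2 \<le> card {t. t < l \<and> morph \<phi> d ! (x + t) = 1}"
proof -
  let ?W = "morph \<phi> d"
  define e where "e = x mod 2"
  \<comment> \<open>The place of the 1 in the j-th whole image of the window; e skips half an image
    when the window starts at an odd position.\<close>
  define f where "f j = e + 2 * j + (if ?W ! (x + (e + 2 * j)) = 1 then 0 else 1)" for j
  have "inj_on f {..<(l - 1) div 2}"
    by (rule inj_onI) (auto simp: f_def split: if_splits; presburger)
  moreover have "f ` {..<(l - 1) div 2} \<subseteq> {t. t < l \<and> ?W ! (x + t) = 1}"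
  proof (rule image_subsetI)
    fix j assume "j \<in> {..<(l - 1) div 2}"
    then have j: "2 * j + 2 < l" by (simp; linarith)
    have e: "e \<le> 1" by (simp add: e_def)
    have "even (x + e)" unfolding e_def by simp
    then obtain y where y: "x + e = 2 * y" by (elim evenE)
    have yl: "y + j < length d" using assms(2) y j e by linarith
    have dy: "d ! (y + j) \<in> {0, 1}" using assms(1) yl nth_mem by blast
    have "?W ! (x + (e + 2 * j)) = d ! (y + j)" "?W ! Suc (x + (e + 2 * j)) = 1 - d ! (y + j)"
    proof -
      have "x + (e + 2 * j) = 2 * (y + j)" using y by simp
      then show "?W ! (x + (e + 2 * j)) = d ! (y + j)" "?W ! Suc (x + (e + 2 * j)) = 1 - d ! (y + j)"
        using morph_\<phi>_nth[OF assms(1) yl] by (simp_all only:)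
    qed
    then show "f j \<in> {t. t < l \<and> ?W ! (x + t) = 1}" using dy j e by (auto simp: f_def)
  qed
  ultimately have "card {..<(l - 1) div 2} \<le> card {t. t < l \<and> ?W ! (x + t) = 1}"
    by (intro card_inj_on_le) auto
  then show ?thesis by simp
qed

section \<open>The targets\<close>

lemma least_de_bruijn_even:
  assumes "0 < r"
  shows "de_bruijn (2 * r) (least_de_bruijn (2 * r))"
    and "2 * length (least_de_bruijn (2 * r)) = 2 ^ r * (2 * 2 ^ r)"
proof -
  obtain n where n: "2 * r = Suc n" using assms by (cases r) auto
  show db: "de_bruijn (2 * r) (least_de_bruijn (2 * r))" using de_bruijn_least[of n] unfolding n .
  have "(2::nat) ^ (2 * r) = 2 ^ r * 2 ^ r" by (simp add: mult_2 power_add)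
  then show "2 * length (least_de_bruijn (2 * r)) = 2 ^ r * (2 * 2 ^ r)" using db by (simp add: de_bruijn_def)
qed

lemma length_block:
  assumes "1 \<le> s" "s \<le> 2 ^ r" "0 < r"
  shows "length (block r s) = 2 * 2 ^ r"
    and "k < 2 * 2 ^ r \<Longrightarrow> block r s ! k = morph \<phi> (least_de_bruijn (2 * r)) ! ((s - 1) * (2 * 2 ^ r) + k)"
proof -
  let ?W = "morph \<phi> (least_de_bruijn (2 * r))" and ?h = "2 ^ r :: nat"
  have len: "length ?W = ?h * (2 * ?h)"
    unfolding length_morph_\<phi> by (rule least_de_bruijn_even(2)[OF assms(3)])
  have "s * (2 * ?h) \<le> ?h * (2 * ?h)" using assms(2) by (rule mult_le_mono1)
  moreover have "s * (2 * ?h) = (s - 1) * (2 * ?h) + 2 * ?h" using assms(1) by (cases s) auto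
  ultimately have le: "(s - 1) * (2 * ?h) + 2 * ?h \<le> length ?W" using len by simp
  then show "length (block r s) = 2 * 2 ^ r" unfolding block_def by simp
  show "block r s ! k = ?W ! ((s - 1) * (2 * 2 ^ r) + k)" if "k < 2 * 2 ^ r"
    using that le unfolding block_def by simp
qed

lemma block_binary:
  assumes "1 \<le> s" "s \<le> 2 ^ r" "0 < r" "k < 2 * 2 ^ r"
  shows "block r s ! k \<in> {0, 1}"
proof -
  have "block r s ! k \<in> set (block r s)"
    by (rule nth_mem) (use length_block(1)[OF assms(1-3)] assms(4) in simp)
  also have "\<dots> \<subseteq> set (morph \<phi> (least_de_bruijn (2 * r)))"
    unfolding block_def using set_take_subset set_drop_subset by (meson subset_trans)
  finally show ?thesis using morph_\<phi>_set by blast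
qed

lemma target_exp_0: "target_exp r s 0 = 0"
  by (simp add: target_exp_def)

lemma target_exp_Suc: "target_exp r s (Suc i) = 64 * target_exp r s i + block r s ! i"
proof -
  have "(\<Sum>p = 1..i. block r s ! (p - 1) * base ^ (Suc i - p)) = (\<Sum>p = 1..i. 64 * (block r s ! (p - 1) * base ^ (i - p)))"
  proof (rule sum.cong)
    fix p assume "p \<in> {1..i}"
    then have "Suc i - p = Suc (i - p)" by auto
    then show "block r s ! (p - 1) * base ^ (Suc i - p) = 64 * (block r s ! (p - 1) * base ^ (i - p))"
      by (simp add: base_def)
  qed simp
  then show ?thesis unfolding target_exp_def by (simp add: sum_distrib_left)
qed

lemma target_exp_less:
  assumes "1 \<le> s" "s \<le> 2 ^ r" "0 < r" "i \<le> 2 * 2 ^ r"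
  shows "target_exp r s i < 64 ^ i"
  using assms(4)
proof (induction i)
  case (Suc i)
  have "block r s ! i \<in> {0, 1}" using block_binary[OF assms(1-3), of i] Suc.prems by simp
  then have "block r s ! i \<le> 1" by auto
  moreover have "target_exp r s i < 64 ^ i" using Suc by simp
  ultimately show ?case unfolding target_exp_Suc power_Suc by linarith
qed (simp add: target_exp_0)

lemma target_exp_digit:
  assumes "1 \<le> s" "s \<le> 2 ^ r" "0 < r" "i \<le> 2 * 2 ^ r" "t < i"
  shows "target_exp r s i div 64 ^ t mod 64 = block r s ! (i - Suc t)"
  using assms(4,5)
proof (induction i arbitrary: t)
  case (Suc i)
  have "block r s ! i \<in> {0, 1}" using block_binary[OF assms(1-3), of i] Suc.prems by simp
  then have b: "block r s ! i < 64" by auto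
  show ?case
  proof (cases t)
    case 0
    then show ?thesis using b by (simp add: target_exp_Suc)
  next
    case (Suc t')
    have "target_exp r s (Suc i) div 64 ^ t = target_exp r s (Suc i) div 64 div 64 ^ t'"
      unfolding Suc by (simp add: div_mult2_eq)
    also have "target_exp r s (Suc i) div 64 = target_exp r s i" using b by (simp add: target_exp_Suc)
    finally show ?thesis using Suc.IH[of t'] Suc.prems Suc by simp
  qed
qed simp

definition target_index :: "nat \<Rightarrow> (nat \<times> nat) list" where
  "target_index r = List.product [1..<2 ^ r + 1] [2 ^ r + 1..<2 * 2 ^ r + 1]"

definition target_exps :: "nat \<Rightarrow> nat list" where
  "target_exps r = map (\<lambda>(s, i). target_exp r s i) (target_index r)"

lemma targets_eq: "targets r = map (\<lambda>n. replicate n La) (target_exps r)"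
  unfolding targets_def target_exps_def target_index_def product_concat_map map_concat map_map o_def
  by (simp del: upt_Suc)

lemma set_target_index: "(s, i) \<in> set (target_index r) \<longleftrightarrow> s \<in> {1..2 ^ r} \<and> i \<in> {2 ^ r + 1..2 * 2 ^ r}"
  by (auto simp: target_index_def)

lemma length_target_index: "length (target_index r) = 2 ^ r * 2 ^ r"
  by (simp add: target_index_def)

lemma distinct_target_index: "distinct (target_index r)"
  unfolding target_index_def by (intro distinct_product) simp_all

lemma target_exps_le:
  assumes "0 < r" "n \<in> set (target_exps r)"
  shows "n \<le> 64 ^ (2 * 2 ^ r)"
proof -
  obtain s i where si: "(s, i) \<in> set (target_index r)" "n = target_exp r s i"
    using assms(2) by (auto simp: target_exps_def)
  then have "n < 64 ^ i" using target_exp_less[of s r i] assms(1) by (auto simp: set_target_index)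
  also have "(64 :: nat) ^ i \<le> 64 ^ (2 * 2 ^ r)" using si by (intro power_increasing) (auto simp: set_target_index)
  finally show ?thesis by simp
qed

lemma sum_target_exps_le:
  assumes "0 < r"
  shows "sum_list (target_exps r) \<le> 2 ^ r * 2 ^ r * 64 ^ (2 * 2 ^ r)"
proof -
  have "sum_list (target_exps r) \<le> (\<Sum>n\<leftarrow>target_exps r. 64 ^ (2 * 2 ^ r))"
    using sum_list_mono[of "target_exps r" "\<lambda>n. n" "\<lambda>_. 64 ^ (2 * 2 ^ r)"] target_exps_le[OF assms] by simp
  also have "\<dots> = length (target_exps r) * 64 ^ (2 * 2 ^ r)" by (simp only: sum_list_triv of_nat_id)
  also have "length (target_exps r) = 2 ^ r * 2 ^ r" by (simp add: target_exps_def length_target_index)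
  finally show ?thesis .
qed

text \<open>With h^2 \<le> 4^h the targets have total length at most (4 times 64^2)^h = 16384^h
  \<le> (19^4)^h, so e_h = 4h + 2 is large enough; the factor 19^2 = 361 pays for 64h + 64.\<close>

lemma greedy_input_targets:
  assumes "0 < r"
  shows "greedy_input (2 ^ r) (target_exps r)"
proof
  let ?h = "2 ^ r :: nat"
  show "0 < ?h" by simp
  have h2: "?h \<le> 2 ^ ?h" by (rule less_imp_le[OF less_exp])
  have "?h * ?h \<le> 4 ^ ?h" using mult_mono[OF h2 h2] by (simp add: power_mult_distrib[symmetric])
  then have "?h * ?h * 64 ^ (2 * ?h) \<le> 4 ^ ?h * 64 ^ (2 * ?h)" by simp
  also have "\<dots> = 16384 ^ ?h" by (simp add: power_mult power_mult_distrib[symmetric])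
  also have "(16384 :: nat) ^ ?h \<le> 130321 ^ ?h" by (rule power_mono) simp_all
  also have "\<dots> = 19 ^ (4 * ?h)" by (simp add: power_mult)
  finally have "sum_list (target_exps r) \<le> 19 ^ (4 * ?h)" using sum_target_exps_le[OF assms] by linarith
  moreover have "?h \<le> 19 ^ (4 * ?h)"
  proof -
    have "(2::nat) ^ ?h \<le> 19 ^ ?h" by (rule power_mono) simp_all
    also have "(19::nat) ^ ?h \<le> 19 ^ (4 * ?h)" by (rule power_increasing) simp_all
    finally show ?thesis using h2 by linarith
  qed
  moreover have "(1::nat) \<le> 19 ^ (4 * ?h)" by simp
  moreover have "(19::nat) ^ (4 * ?h + 2) = 361 * 19 ^ (4 * ?h)" by (simp add: power_add)
  ultimately show "sum_list (target_exps r) + 64 * ?h + 64 < 19 ^ (4 * ?h + 2)" by linarith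
qed

lemma auxiliary_eq:
  "auxiliary r i = concat (map (\<lambda>c. replicate (64 ^ i) La @ [Lb i c]) (map dejean [0..<19 ^ (7 * 2 ^ r + 2 - 3 * i)]))"
  by (simp add: auxiliary_def aux_word_def aux_word_eq base_def)

lemma input_word_eq:
  "input_word r = join_sep 1 (map (\<lambda>n. replicate n La) (target_exps r) @ map (\<lambda>i. concat (map
     (\<lambda>c. replicate (64 ^ i) La @ [Lb i c]) (map dejean [0..<19 ^ (7 * 2 ^ r + 2 - 3 * i)]))) [1..<Suc (2 ^ r)])"
  unfolding input_word_def targets_eq auxiliary_eq by simp

lemma finite_dom_greedy:
  assumes "greedy_step\<^sup>*\<^sup>* G G'" "finite (dom (rules G))"
  shows "finite (dom (rules G'))"
  using assms by (induction rule: rtranclp_induct) (auto simp: greedy_step_def dom_replace_step)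

lemma target_digit:
  assumes "0 < r" "(s, i) \<in> set (target_index r)" "t < 2 ^ r"
  shows "target_exp r s i div 64 ^ t mod 64 =
      morph \<phi> (least_de_bruijn (2 * r)) ! ((s - 1) * (2 * 2 ^ r) + (i - Suc t))"
    and "target_exp r s i div 64 ^ t mod 64 \<in> {0, 1}"
proof -
  have si: "1 \<le> s" "s \<le> 2 ^ r" "2 ^ r < i" "i \<le> 2 * 2 ^ r" using assms(2) by (auto simp: set_target_index)
  have d: "target_exp r s i div 64 ^ t mod 64 = block r s ! (i - Suc t)"
    using target_exp_digit[OF si(1,2) assms(1) si(4)] si assms(3) by simp
  have lt: "i - Suc t < 2 * 2 ^ r" using si by simp
  show "target_exp r s i div 64 ^ t mod 64 =
      morph \<phi> (least_de_bruijn (2 * r)) ! ((s - 1) * (2 * 2 ^ r) + (i - Suc t))"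
    unfolding d by (rule length_block(2)[OF si(1,2) assms(1) lt])
  show "target_exp r s i div 64 ^ t mod 64 \<in> {0, 1}"
    unfolding d by (rule block_binary[OF si(1,2) assms(1) lt])
qed

lemma mult_add_inj:
  assumes "x * d + a = y * d + b" "a < d" "b < (d::nat)"
  shows "x = y \<and> a = b"
proof -
  have "(x * d + a) div d = x" "(y * d + b) div d = y" using assms(2,3) by simp_all
  then have "x = y" using assms(1) by metis
  then show ?thesis using assms(1) by simp
qed

text \<open>The places a, ..., a + K - 1 of target (s, i) show, in reverse, the factor of \<phi>(D)
  of length K = 4r + 1 at position (s - 1)2h + i - a - K. Equal digits give equal positions, and a
  position determines s and i because i - a - K < 2h.\<close>

lemma target_windows:
  assumes r: "0 < r" and kl: "k < length (target_exps r)" "l < length (target_exps r)" "k \<noteq> l"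
    and a: "a + (4 * r + 1) \<le> 2 ^ r"
  shows "\<exists>t<4 * r + 1. (target_exps r ! k) div 64 ^ (a + t) mod 64 \<noteq> (target_exps r ! l) div 64 ^ (a + t) mod 64"
proof (rule ccontr)
  assume neg: "\<not> ?thesis"
  let ?K = "4 * r + 1" and ?h = "2 ^ r :: nat"
  let ?W = "morph \<phi> (least_de_bruijn (2 * r))"
  note db = least_de_bruijn_even(1)[OF r] and len = least_de_bruijn_even(2)[OF r]
  obtain s i s' i' where si: "target_index r ! k = (s, i)" "target_index r ! l = (s', i')" by (metis surj_pair)
  have lk: "k < length (target_index r)" "l < length (target_index r)" using kl by (simp_all add: target_exps_def)
  then have mem: "(s, i) \<in> set (target_index r)" "(s', i') \<in> set (target_index r)" using si by (metis nth_mem)+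
  have ne: "(s, i) \<noteq> (s', i')" using si lk kl(3) distinct_target_index by (metis nth_eq_iff_index_eq)
  have n': "target_exps r ! k = target_exp r s i" "target_exps r ! l = target_exp r s' i'"
    using si lk by (simp_all add: target_exps_def)
  have b: "1 \<le> s" "s \<le> ?h" "?h < i" "i \<le> 2 * ?h" "1 \<le> s'" "s' \<le> ?h" "?h < i'" "i' \<le> 2 * ?h"
    using mem by (auto simp: set_target_index)
  have bound: "(x - 1) * (2 * ?h) + (y - a - ?K) + ?K \<le> ?h * (2 * ?h)"
    if "1 \<le> x" "x \<le> ?h" "?h < y" "y \<le> 2 * ?h" for x y
  proof -
    have "x * (2 * ?h) \<le> ?h * (2 * ?h)" using that(2) by (rule mult_le_mono1)
    moreover have "x * (2 * ?h) = (x - 1) * (2 * ?h) + 2 * ?h" using that(1) by (cases x) auto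
    ultimately show ?thesis using that a by linarith
  qed
  have "(s - 1) * (2 * ?h) + (i - a - ?K) = (s' - 1) * (2 * ?h) + (i' - a - ?K)"
  proof (rule morph_\<phi>_window[OF db])
    show "0 < 2 * r" using r by simp
    show "(s - 1) * (2 * ?h) + (i - a - ?K) + (2 * (2 * r) + 1) \<le> 2 * length (least_de_bruijn (2 * r))"
      using bound[of s i] b len by simp
    show "(s' - 1) * (2 * ?h) + (i' - a - ?K) + (2 * (2 * r) + 1) \<le> 2 * length (least_de_bruijn (2 * r))"
      using bound[of s' i'] b len by simp
    fix t assume "t < 2 * (2 * r) + 1"
    then have t: "t < ?K" by simp
    \<comment> \<open>Digit places increase from right to left, so offset t of the factor is place K
      - 1 - t of the window.\<close>
    define u where "u = ?K - 1 - t"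
    have u: "u < ?K" "a + u < ?h" using t a unfolding u_def by linarith+
    have "(target_exp r s i) div 64 ^ (a + u) mod 64 = (target_exp r s' i') div 64 ^ (a + u) mod 64"
      using neg u(1) n' by auto
    then have "?W ! ((s - 1) * (2 * ?h) + (i - Suc (a + u))) = ?W ! ((s' - 1) * (2 * ?h) + (i' - Suc (a + u)))"
      using target_digit(1)[OF r mem(1) u(2)] target_digit(1)[OF r mem(2) u(2)] by simp
    moreover have "i - Suc (a + u) = i - a - ?K + t" "i' - Suc (a + u) = i' - a - ?K + t"
      using b a t unfolding u_def by linarith+
    ultimately show "?W ! ((s - 1) * (2 * ?h) + (i - a - ?K) + t) = ?W ! ((s' - 1) * (2 * ?h) + (i' - a - ?K) + t)"
      by (simp add: add.assoc)
  qed
  moreover have "i - a - ?K < 2 * ?h" "i' - a - ?K < 2 * ?h" using b by linarith+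
  ultimately have "s - 1 = s' - 1 \<and> i - a - ?K = i' - a - ?K" by (intro mult_add_inj)
  then have "s = s'" "i = i'" using b a by linarith+
  then show False using ne by simp
qed

text \<open>The low h digits are the last h letters of a prefix of C_s of length i > h, that is, h
  consecutive letters of \<phi>(D).\<close>

lemma length_bits_ge:
  assumes r: "0 < r" and n: "n \<in> set (target_exps r)"
  shows "(2 ^ r - 1) div 2 \<le> length (greedy_input.bits (2 ^ r) n)"
proof -
  interpret greedy_input "2 ^ r" "target_exps r" by (rule greedy_input_targets[OF r])
  let ?h = "2 ^ r :: nat" and ?W = "morph \<phi> (least_de_bruijn (2 * r))"
  note len = least_de_bruijn_even(2)[OF r]
  have bin: "set (least_de_bruijn (2 * r)) \<subseteq> {0, 1}"
    using least_de_bruijn_even(1)[OF r] by (simp add: de_bruijn_def)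
  obtain s i where si: "(s, i) \<in> set (target_index r)" "n = target_exp r s i"
    using n by (auto simp: target_exps_def)
  have b: "1 \<le> s" "s \<le> ?h" "?h < i" "i \<le> 2 * ?h" using si by (auto simp: set_target_index)
  let ?x = "(s - 1) * (2 * ?h) + (i - ?h)"
  have "s * (2 * ?h) \<le> ?h * (2 * ?h)" using b(2) by (rule mult_le_mono1)
  moreover have "s * (2 * ?h) = (s - 1) * (2 * ?h) + 2 * ?h" using b(1) by (cases s) auto
  ultimately have "?x + ?h \<le> 2 * length (least_de_bruijn (2 * r))" using b len by linarith
  then have "(?h - 1) div 2 \<le> card {t. t < ?h \<and> ?W ! (?x + t) = 1}" by (rule morph_\<phi>_ones[OF bin])
  also have "\<dots> \<le> card {t. t < ?h \<and> n div 64 ^ t mod 64 = 1}"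
  proof (rule card_inj_on_le)
    show "inj_on (\<lambda>t. ?h - 1 - t) {t. t < ?h \<and> ?W ! (?x + t) = 1}" by (auto simp: inj_on_def)
    show "(\<lambda>t. ?h - 1 - t) ` {t. t < ?h \<and> ?W ! (?x + t) = 1} \<subseteq> {t. t < ?h \<and> n div 64 ^ t mod 64 = 1}"
    proof (rule image_subsetI)
      fix t assume t: "t \<in> {t. t < ?h \<and> ?W ! (?x + t) = 1}"
      have lt: "?h - 1 - t < ?h" by simp
      have "i - Suc (?h - 1 - t) = i - ?h + t" using t b by simp
      then show "?h - 1 - t \<in> {t. t < ?h \<and> n div 64 ^ t mod 64 = 1}"
        using target_digit(1)[OF r si(1) lt] t lt si(2) by (simp add: add.assoc)
    qed
  qed simp
  also have "\<dots> = length (bits n)"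
    unfolding bits_def rev_filter[symmetric] length_rev by (rule filter_upt_card)
  finally show ?thesis .
qed

theorem greedy_size_ge:
  assumes r: "0 < r" and G: "greedy_terminal (input_word r) G"
  shows "2 ^ r * 2 ^ r * ((2 ^ r - 1) div 2) \<le> (4 * r + 1) * grammar_size G"
proof -
  interpret greedy_input "2 ^ r" "target_exps r" by (rule greedy_input_targets[OF r])
  let ?h = "2 ^ r :: nat"
  obtain G0 Y cs where st: "stage ?h Y cs G0" and steps: "greedy_step\<^sup>*\<^sup>* G0 G"
    using greedy_terminal_staged[of G] G unfolding input_word_eq M_def by blast
  have "closed G0"
    unfolding closed_def using stage_closed[OF st] by (metis domI option.sel)
  then obtain f where ref: "grammar_refines G0 f G" using grammar_refines_steps[OF steps] by blast
  have ne: "target_exps r \<noteq> []"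
  proof -
    have "0 < length (target_exps r)" by (simp add: target_exps_def length_target_index)
    then show ?thesis by blast
  qed
  have "(\<Sum>n\<leftarrow>target_exps r. length (bits n)) \<le> (4 * r + 1) * length (the (rules G 0))"
  proof (rule refined_size_ge[OF st _ _ _ ref ne])
    show "n div 64 ^ t mod 64 \<in> {0, 1}" if "n \<in> set (target_exps r)" "t < ?h" for n t
      using that target_digit(2)[OF r] by (auto simp: target_exps_def)
    show "2 \<le> 4 * r + 1" using r by simp
  qed (use target_windows[OF r] in blast)
  moreover have "(\<Sum>n\<leftarrow>target_exps r. (?h - 1) div 2) \<le> (\<Sum>n\<leftarrow>target_exps r. length (bits n))"
    by (rule sum_list_mono) (rule length_bits_ge[OF r])
  then have "length (target_exps r) * ((?h - 1) div 2) \<le> (\<Sum>n\<leftarrow>target_exps r. length (bits n))"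
    by (simp only: sum_list_triv of_nat_id)
  then have "?h * ?h * ((?h - 1) div 2) \<le> (\<Sum>n\<leftarrow>target_exps r. length (bits n))"
    by (simp add: target_exps_def length_target_index)
  moreover have "length (the (rules G 0)) \<le> grammar_size G"
  proof -
    have "finite (dom (rules G0))" using st by (simp add: stage_def)
    then have "finite (dom (rules G))" using finite_dom_greedy[OF steps] by simp
    moreover have "0 \<in> dom (rules G0)" using st by (auto simp: stage_def)
    then have "0 \<in> dom (rules G)" using ref by (auto simp: grammar_refines_def)
    ultimately show ?thesis unfolding grammar_size_def by (intro member_le_sum) auto
  qed
  ultimately show ?thesis by (meson le_trans mult_le_mono2)
qed

section \<open>The bounds\<close>

lemma set_join_sep_subset: "set (join_sep k us) \<subseteq> (\<Union>u\<in>set us. set u) \<union> Sep ` {k..<k + length us - 1}"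
  by (induction k us rule: join_sep.induct) auto

lemma set_join_sep_superset: "(\<Union>u\<in>set us. set u) \<union> Sep ` {k..<k + length us - 1} \<subseteq> set (join_sep k us)"
proof (induction k us rule: join_sep.induct)
  case (3 k u u' us)
  have "{k..<k + length (u # u' # us) - 1} = insert k {Suc k..<Suc k + length (u' # us) - 1}" by auto
  then show ?case using 3 by auto
qed auto

lemma length_join_sep_le: "length (join_sep k us) \<le> (\<Sum>u\<leftarrow>us. length u + 1)"
  by (induction k us rule: join_sep.induct) auto

lemma length_join_sep_ge: "u \<in> set us \<Longrightarrow> length u \<le> length (join_sep k us)"
  by (induction k us rule: join_sep.induct) auto

section \<open>A small straight-line program for the input\<close>

lemma formed_join_sep:
  assumes "us \<noteq> []" "set us \<subseteq> S"
  shows "formed (2 * length us) S (join_sep k us)"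
proof -
  have "\<exists>vs. vs \<noteq> [] \<and> length vs \<le> 2 * length us \<and> set vs \<subseteq> S \<union> range (\<lambda>t. [t]) \<and> join_sep k us = concat vs"
    using assms
  proof (induction k us rule: join_sep.induct)
    case (2 k u)
    then show ?case by (intro exI[of _ "[u]"]) auto
  next
    case (3 k u u' us)
    then obtain vs where "vs \<noteq> []" "length vs \<le> 2 * length (u' # us)" "set vs \<subseteq> S \<union> range (\<lambda>t. [t])"
      "join_sep (Suc k) (u' # us) = concat vs" by auto
    then show ?case using 3(3) by (intro exI[of _ "u # [Sep k] # vs"]) auto
  qed simp
  then show ?thesis unfolding formed_def .
qed

lemma concat_replicate_replicate: "concat (replicate n (replicate m a)) = replicate (n * m) a"
  by (induction n) (simp_all add: replicate_add)

lemma formed_replicate: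
  assumes "replicate m a \<in> S \<union> range (\<lambda>t. [t])" "0 < n"
  shows "formed n S (replicate (n * m) a)"
  unfolding formed_def using assms
  by (intro exI[of _ "replicate n (replicate m a)"]) (auto simp: concat_replicate_replicate)

lemma slp_cost_powers: "slp_cost ((\<lambda>k. replicate (64 ^ Suc k) a) ` {..<n}) (64 * n)"
proof -
  have "slp_cost ({} \<union> (\<lambda>k. replicate (64 ^ Suc k) a) ` {..<n}) (0 + 64 * n)"
  proof (rule slp_cost_chain[OF slp_cost_empty])
    fix k assume "k < n"
    have "replicate (64 ^ k) a \<in> ({} \<union> (\<lambda>k. replicate (64 ^ Suc k) a) ` {..<k}) \<union> range (\<lambda>t. [t])"
    proof (cases k)
      case (Suc k')
      then show ?thesis by blast
    qed simp
    from formed_replicate[OF this, of 64]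
    show "formed 64 ({} \<union> (\<lambda>k. replicate (64 ^ Suc k) a) ` {..<k}) (replicate (64 ^ Suc k) a)" by simp
  qed
  then show ?thesis by simp
qed

text \<open>C_s begins with 01 or 10. At i = 1 the exponent may be 0, and right-hand sides cannot be
  empty; from i = 2 on it is positive, so \<open>target_chain\<close> starts there.\<close>

lemma target_exp_2:
  assumes "1 \<le> s" "s \<le> 2 ^ r" "0 < r"
  shows "target_exp r s 2 \<in> {1, 64}"
proof -
  let ?d = "least_de_bruijn (2 * r)" and ?y = "(s - 1) * 2 ^ r"
  have bin: "set ?d \<subseteq> {0, 1}" using least_de_bruijn_even(1)[OF assms(3)] by (simp add: de_bruijn_def)
  have len: "length ?d = 2 ^ r * 2 ^ r" using least_de_bruijn_even(2)[OF assms(3)] by simp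
  have "s * 2 ^ r \<le> 2 ^ r * 2 ^ r" using assms(2) by (rule mult_le_mono1)
  moreover have "s * 2 ^ r = ?y + 2 ^ r" using assms(1) by (cases s) auto
  moreover have "(0::nat) < 2 ^ r" by simp
  ultimately have y: "?y < length ?d" using len by linarith
  have "1 \<le> (2::nat) ^ r" by simp
  then have lt: "0 < 2 * (2::nat) ^ r" "1 < 2 * (2::nat) ^ r" by linarith+
  have "(s - 1) * (2 * 2 ^ r) + 0 = 2 * ?y" "(s - 1) * (2 * 2 ^ r) + 1 = Suc (2 * ?y)" by simp_all
  then have b: "block r s ! 0 = ?d ! ?y" "block r s ! 1 = 1 - ?d ! ?y"
    using length_block(2)[OF assms lt(1)] length_block(2)[OF assms lt(2)] morph_\<phi>_nth[OF bin y] by (simp_all only:)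
  have "?d ! ?y \<in> {0, 1}" using bin y nth_mem by blast
  moreover have "target_exp r s 2 = 64 * (block r s ! 0) + block r s ! 1"
    unfolding numeral_2_eq_2 target_exp_Suc target_exp_0 by simp
  ultimately show ?thesis using b by auto
qed

definition target_chain :: "nat \<Rightarrow> nat \<Rightarrow> nat \<Rightarrow> letter list" where
  "target_chain r s k = replicate (target_exp r (Suc s) (k + 2)) La"

text \<open>Appending a digit multiplies the exponent by 64 and adds at most 1, which costs at most
  65 symbols; the chain has 2h - 1 words.\<close>

lemma slp_cost_targets:
  assumes r: "0 < r" and s: "s < 2 ^ r" and S: "slp_cost S m"
  shows "slp_cost (S \<union> target_chain r s ` {..<2 * 2 ^ r - 1}) (m + 130 * 2 ^ r)"
proof -
  have sb: "1 \<le> Suc s" "Suc s \<le> 2 ^ r" using s by auto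
  have "slp_cost (S \<union> target_chain r s ` {..<2 * 2 ^ r - 1}) (m + 65 * (2 * 2 ^ r - 1))"
  proof (rule slp_cost_chain[OF S])
    fix k :: nat assume k: "k < 2 * 2 ^ r - 1"
    show "formed 65 (S \<union> target_chain r s ` {..<k}) (target_chain r s k)"
    proof (cases k)
      case 0
      have t: "target_exp r (Suc s) 2 \<in> {1, 64}" by (rule target_exp_2[OF sb r])
      have "formed (target_exp r (Suc s) 2) (S \<union> target_chain r s ` {..<k}) (replicate (target_exp r (Suc s) 2 * 1) La)"
        by (rule formed_replicate) (use t in auto)
      moreover have "target_chain r s k = replicate (target_exp r (Suc s) 2 * 1) La"
        unfolding target_chain_def 0 by (simp only: add_0 mult_1_right)
      moreover have "target_exp r (Suc s) 2 \<le> 65" using t by auto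
      ultimately show ?thesis by (simp only: formed_mono[OF _ _ subset_refl])
    next
      case (Suc k')
      let ?b = "block r (Suc s) ! (k' + 2)"
      have "k' + 2 < 2 * 2 ^ r" using k Suc by linarith
      from block_binary[OF sb r this] have b: "?b \<le> 1" by auto
      have e: "target_exp r (Suc s) (k + 2) = 64 * target_exp r (Suc s) (k' + 2) + ?b"
        unfolding Suc using target_exp_Suc[of r "Suc s" "k' + 2"] by simp
      have "target_chain r s k = concat (replicate 64 (target_chain r s k') @ replicate ?b [La])"
        unfolding target_chain_def e replicate_add concat_append concat_replicate_replicate
        using concat_replicate_replicate[of ?b 1 La] by simp
      moreover have "target_chain r s k' \<in> S \<union> target_chain r s ` {..<k}" using Suc by simp
      ultimately show ?thesis unfolding formed_def using b
        by (intro exI[of _ "replicate 64 (target_chain r s k') @ replicate ?b [La]"]) auto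
    qed
  qed
  then show ?thesis by (rule slp_cost_mono) auto
qed

definition aux_image :: "nat \<Rightarrow> nat list \<Rightarrow> letter list" where
  "aux_image j v = concat (map (\<lambda>c. replicate (64 ^ j) La @ [Lb j c]) v)"

lemma funpow_morph_concat: "(morph f ^^ e) (concat vs) = concat (map (morph f ^^ e) vs)"
proof (induction e arbitrary: vs)
  case (Suc e)
  have "morph f (concat vs) = concat (map (morph f) vs)"
    unfolding morph_def by (induction vs) auto
  then show ?case using Suc by (simp add: funpow_swap1 o_def)
qed simp

lemma funpow_morph_Suc: "(morph f ^^ Suc e) [x] = concat (map (\<lambda>y. (morph f ^^ e) [y]) (f x))"
proof -
  have "(morph f ^^ Suc e) [x] = (morph f ^^ e) (f x)"
    unfolding funpow_Suc_right by (simp add: morph_def)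
  also have "f x = concat (map (\<lambda>y. [y]) (f x))" by simp
  finally show ?thesis unfolding funpow_morph_concat map_map o_def .
qed

lemma aux_image_concat: "aux_image j (concat vs) = concat (map (aux_image j) vs)"
  unfolding aux_image_def by (induction vs) auto

text \<open>Index k = 3e + c stands for the image of \<mu>^e(c). For e \<ge> 1 this is a product of
  19 words of smaller index.\<close>

definition aux_chain :: "nat \<Rightarrow> nat \<Rightarrow> letter list" where
  "aux_chain j k = aux_image j ((morph \<mu> ^^ (k div 3)) [k mod 3])"

lemma slp_cost_aux:
  assumes S: "slp_cost S m" and j: "replicate (64 ^ j) La \<in> S"
  shows "slp_cost (S \<union> aux_chain j ` {..<n}) (m + 19 * n)"
proof (rule slp_cost_chain[OF S])
  fix k
  show "formed 19 (S \<union> aux_chain j ` {..<k}) (aux_chain j k)"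
  proof (cases "k < 3")
    case True
    then have "aux_chain j k = concat [replicate (64 ^ j) La, [Lb j k]]"
      by (simp add: aux_chain_def aux_image_def)
    then show ?thesis unfolding formed_def using j
      by (intro exI[of _ "[replicate (64 ^ j) La, [Lb j k]]"]) auto
  next
    case False
    then obtain e where e: "k div 3 = Suc e" by (metis div_greater_zero_iff gr0_conv_Suc not_less zero_less_numeral)
    let ?us = "map (\<lambda>y. aux_chain j (3 * e + y)) (\<mu> (k mod 3))"
    have lt: "y < 3" if "y \<in> set (\<mu> (k mod 3))" for y
      using that by (auto simp: \<mu>_def split: if_splits)
    have "aux_chain j (3 * e + y) = aux_image j ((morph \<mu> ^^ e) [y])" if "y < 3" for y
      using that by (simp add: aux_chain_def)
    then have "concat ?us = aux_chain j k"
      unfolding aux_chain_def[of j k] e funpow_morph_Suc aux_image_concat map_map o_def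
      using lt by (intro arg_cong[where f = concat] map_cong) simp_all
    moreover have "3 * e + y < k" if "y < 3" for y
    proof -
      have "3 * (k div 3) \<le> k" by simp
      then show ?thesis using e that by linarith
    qed
    then have "set ?us \<subseteq> aux_chain j ` {..<k}" using lt by auto
    moreover have "length ?us = 19" by (simp add: \<mu>_def)
    ultimately show ?thesis unfolding formed_def
      by (intro exI[of _ ?us]) (auto simp del: length_map set_map)
  qed
qed

text \<open>The costs are 64h for powers of a, 130h^2 for targets, 399h^2 for auxiliaries and 2(h^2
  + h) for the start rule; with h \<le> h^2 they add up to at most 597h^2.\<close>

lemma input_word_slp:
  assumes r: "0 < r"
  shows "\<exists>G. generates G (input_word r) \<and> grammar_size G \<le> 600 * (2 ^ r)\<^sup>2"
proof -
  let ?h = "2 ^ r :: nat"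
  let ?P = "(\<lambda>k. replicate (64 ^ Suc k) La) ` {..<?h}"
  let ?T = "\<Union>s<?h. target_chain r s ` {..<2 * ?h - 1}"
  \<comment> \<open>Three letters at each of the levels 0, ..., e for the auxiliary of index
    \<open>Suc j\<close>: at most 21h words, and 19 times 21 = 399.\<close>
  let ?n = "\<lambda>j. 3 * (7 * ?h + 3 - 3 * Suc j)"
  let ?A = "\<Union>j<?h. aux_chain (Suc j) ` {..<?n j}"
  have 1: "slp_cost ?P (64 * ?h)" by (rule slp_cost_powers)
  have 2: "slp_cost (?P \<union> ?T) (64 * ?h + 130 * ?h * ?h)"
    by (rule slp_cost_UN[OF 1]) (rule slp_cost_targets[OF r])
  have 3: "slp_cost (?P \<union> ?T \<union> ?A) (64 * ?h + 130 * ?h * ?h + 399 * ?h * ?h)"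
  proof (rule slp_cost_UN[OF 2])
    fix k S' m' assume k: "k < ?h" "?P \<union> ?T \<subseteq> S'" "slp_cost S' m'"
    have "replicate (64 ^ Suc k) La \<in> S'" using k by blast
    from slp_cost_aux[OF k(3) this, of "?n k"]
    show "slp_cost (S' \<union> aux_chain (Suc k) ` {..<?n k}) (m' + 399 * ?h)"
      by (rule slp_cost_mono) auto
  qed
  let ?S = "?P \<union> ?T \<union> ?A"
  let ?us = "targets r @ map (auxiliary r) [1..<?h + 1]"
  have len: "length ?us = ?h * ?h + ?h"
    by (simp add: targets_eq target_exps_def length_target_index)
  have t: "set (targets r) \<subseteq> ?T"
  proof
    fix u assume "u \<in> set (targets r)"
    then obtain s i where si: "(s, i) \<in> set (target_index r)" "u = replicate (target_exp r s i) La"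
      by (auto simp: targets_eq target_exps_def)
    then have b: "1 \<le> s" "s \<le> ?h" "?h < i" "i \<le> 2 * ?h" by (auto simp: set_target_index)
    have h2: "2 \<le> ?h" using r by (cases r) auto
    have "Suc (s - 1) = s" "i - 2 + 2 = i" using b h2 by linarith+
    then have "u = target_chain r (s - 1) (i - 2)" using si(2) by (simp only: target_chain_def)
    moreover have "s - 1 < ?h" "i - 2 < 2 * ?h - 1" using b h2 by linarith+
    ultimately show "u \<in> ?T" by blast
  qed
  have a: "auxiliary r j \<in> ?A" if "j \<in> set [1..<?h + 1]" for j
  proof -
    have j: "1 \<le> j" "j \<le> ?h" using that by auto
    let ?e = "7 * ?h + 2 - 3 * j"
    have eq: "auxiliary r j = aux_chain j (3 * ?e)"
      by (simp add: auxiliary_def aux_word_def aux_chain_def aux_image_def base_def)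
    have j': "Suc (j - 1) = j" "j - 1 < ?h" using j by linarith+
    obtain d where "7 * ?h = 3 * j + d" using j(2) le_Suc_ex[of "3 * j" "7 * ?h"] by auto
    then have "3 * ?e < 3 * (7 * ?h + 3 - 3 * j)" by simp
    then have "auxiliary r j \<in> aux_chain (Suc (j - 1)) ` {..<?n (j - 1)}"
      unfolding j'(1) eq by blast
    then show ?thesis using j'(2) by blast
  qed
  have "set ?us \<subseteq> ?S" using t a by auto
  moreover have "?us \<noteq> []" using len by auto
  ultimately have "formed (2 * length ?us) ?S (input_word r)"
    unfolding input_word_def by (intro formed_join_sep)
  from slp_cost_generates[OF 3 this] obtain G where
    G: "generates G (input_word r)" "grammar_size G \<le> 64 * ?h + 130 * ?h * ?h + 399 * ?h * ?h + 2 * (?h * ?h + ?h)"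
    unfolding len by blast
  have "?h \<le> ?h * ?h" by simp
  moreover have "g \<le> 600 * y" if "x \<le> y" "g \<le> 64 * x + 130 * y + 399 * y + 2 * (y + x)" for g x y :: nat
  proof -
    have "64 * x + 2 * (y + x) \<le> 64 * y + 2 * (y + y)" using that(1) by (intro add_mono mult_le_mono2) simp_all
    then show ?thesis using that(2) by simp
  qed
  moreover have "grammar_size G \<le> 64 * ?h + 130 * (?h * ?h) + 399 * (?h * ?h) + 2 * (?h * ?h + ?h)"
    using G(2) by (simp only: mult.assoc)
  ultimately have "grammar_size G \<le> 600 * (?h * ?h)" by blast
  then show ?thesis using G(1) by (auto simp: power2_eq_square)
qed

lemma set_input_word:
  assumes r: "0 < r"
  shows "set (input_word r) = input_alphabet (2 ^ r)"
proof -
  let ?h = "2 ^ r :: nat"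
  let ?us = "targets r @ map (auxiliary r) [1..<?h + 1]"
  have len: "length ?us = ?h * ?h + ?h"
    by (simp add: targets_eq target_exps_def length_target_index)
  have t: "set u \<subseteq> {La}" if "u \<in> set (targets r)" for u
    using that by (auto simp: targets_eq)
  have a: "set (auxiliary r j) = {La} \<union> {Lb j c | c. c \<in> {0, 1, 2}}" if "j \<le> ?h" for j
  proof -
    define m where "m = (19::nat) ^ (7 * ?h + 2 - 3 * j)"
    have "(19::nat) ^ 1 \<le> m" unfolding m_def by (rule power_increasing) (use that in simp_all)
    then have m: "3 \<le> m" by simp
    have "dejean ` {0..<m} = {0, 1, 2}"
    proof
      show "dejean ` {0..<m} \<subseteq> {0, 1, 2}"
      proof (rule image_subsetI)
        fix x
        show "dejean x \<in> {0, 1, 2}" using less_3_cases[OF dejean_lt[of x]] by simp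
      qed
      have d: "dejean 0 = 0" "dejean 1 = 1" "dejean 2 = 2"
        using dejean_block[of 0 0] dejean_block[of 1 0] dejean_block[of 2 0] dejean.simps[of 0]
        by (simp_all add: \<mu>_def numeral_2_eq_2)
      have "dejean i \<in> dejean ` {0..<m}" if "i < 3" for i
        using that m by (intro imageI) simp
      from this[of 0] this[of 1] this[of 2] show "{0, 1, 2} \<subseteq> dejean ` {0..<m}" unfolding d by simp
    qed
    then have d: "set (map dejean [0..<m]) = {0, 1, 2}" by simp
    have "set (concat (map (\<lambda>c. replicate l La @ [b c]) xs)) = {La} \<union> b ` set xs"
      if "0 < l" "xs \<noteq> []" for l b and xs :: "nat list"
      using that(2) by (induction xs rule: list_nonempty_induct) (use that(1) in auto)
    then have "set (auxiliary r j) = {La} \<union> Lb j ` set (map dejean [0..<m])"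
      unfolding auxiliary_eq m_def[symmetric] using m by (metis gr0I length_map length_upt list.size(3) minus_nat.diff_0
        not_numeral_le_zero power_not_zero zero_neq_numeral)
    then have "set (auxiliary r j) = {La} \<union> Lb j ` {0, 1, 2}" unfolding d .
    also have "Lb j ` {0, 1, 2} = {Lb j c | c. c \<in> {0, 1, 2}}" by blast
    finally show ?thesis .
  qed
  have "(\<Union>u\<in>set ?us. set u) = {La} \<union> {Lb j c | j c. j \<in> {1..?h} \<and> c \<in> {0, 1, 2}}"
  proof
    show "(\<Union>u\<in>set ?us. set u) \<subseteq> {La} \<union> {Lb j c | j c. j \<in> {1..?h} \<and> c \<in> {0, 1, 2}}"
    proof
      fix x assume "x \<in> (\<Union>u\<in>set ?us. set u)"
      then consider u where "u \<in> set (targets r)" "x \<in> set u" | j where "1 \<le> j" "j \<le> ?h" "x \<in> set (auxiliary r j)"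
        unfolding set_append set_map set_upt by (auto simp del: One_nat_def)
      then show "x \<in> {La} \<union> {Lb j c | j c. j \<in> {1..?h} \<and> c \<in> {0, 1, 2}}"
      proof cases
        case 1
        then show ?thesis using t by blast
      next
        case 2
        then show ?thesis using a[OF 2(2)] by fastforce
      qed
    qed
    have "{La} \<union> {Lb j c | c. c \<in> {0, 1, 2}} \<subseteq> (\<Union>u\<in>set ?us. set u)" if "j \<in> {1..?h}" for j
    proof -
      have "j \<in> {1..<?h + 1}" using that by simp
      then have "auxiliary r j \<in> set ?us" unfolding set_append set_map set_upt by blast
      moreover have "set (auxiliary r j) = {La} \<union> {Lb j c | c. c \<in> {0, 1, 2}}" by (rule a) (use that in simp)
      ultimately show ?thesis by blast
    qed
    moreover have "(1::nat) \<in> {1..?h}" by simp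
    ultimately show "{La} \<union> {Lb j c | j c. j \<in> {1..?h} \<and> c \<in> {0, 1, 2}} \<subseteq> (\<Union>u\<in>set ?us. set u)"
      by (intro subsetI) (elim UnE CollectE exE conjE; blast)
  qed
  moreover have "{1..<1 + length ?us - 1} = {1..?h\<^sup>2 + ?h - 1}"
  proof -
    have "0 < ?h" by simp
    then show ?thesis unfolding len power2_eq_square by auto
  qed
  ultimately show ?thesis
    using set_join_sep_subset[of 1 ?us] set_join_sep_superset[of ?us 1]
    unfolding input_word_def input_alphabet_def by auto
qed

lemma card_input_alphabet:
  assumes "0 < h"
  shows "card (input_alphabet h) = h\<^sup>2 + 4 * h"
proof -
  let ?B = "{Lb j c | j c. j \<in> {1..h} \<and> c \<in> {0, 1, 2}}" and ?S = "Sep ` {1..h\<^sup>2 + h - 1}"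
  have B: "?B = (\<lambda>(j, c). Lb j c) ` ({1..h} \<times> {0, 1, 2})" by auto
  have "card ?B = card ({1..h} \<times> {0, 1, 2 :: nat})" unfolding B by (rule card_image) (auto simp: inj_on_def)
  then have cB: "card ?B = 3 * h" by (simp add: card_cartesian_product)
  have fB: "finite ?B" unfolding B by simp
  have cS: "card ?S = h\<^sup>2 + h - 1" by (subst card_image) (auto simp: inj_on_def)
  have "card ({La} \<union> ?B) = 1 + 3 * h" using fB cB by (subst card_Un_disjoint) auto
  then have "card ({La} \<union> ?B \<union> ?S) = 1 + 3 * h + (h\<^sup>2 + h - 1)"
    using fB cS by (subst card_Un_disjoint) auto
  then show ?thesis unfolding input_alphabet_def using assms by simp
qed

lemma length_input_word_ge:
  assumes r: "0 < r"
  shows "2 ^ (2 ^ r) \<le> length (input_word r)"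
proof -
  let ?h = "2 ^ r :: nat"
  have len: "length (concat (map (\<lambda>c. replicate l La @ [b c]) xs)) = length xs * (l + 1)"
    for l b and xs :: "nat list" by (induction xs) auto
  have "(2::nat) ^ ?h \<le> 19 ^ ?h" by (rule power_mono) simp_all
  also have "\<dots> \<le> 19 ^ (7 * ?h + 2 - 3 * 1)" by (rule power_increasing) simp_all
  also have "\<dots> \<le> length (auxiliary r 1)" unfolding auxiliary_eq len by simp
  also have "\<dots> \<le> length (input_word r)"
  proof -
    have "(1::nat) \<in> set [1..<?h + 1]" by (simp del: upt_Suc)
    then have "auxiliary r 1 \<in> set (targets r @ map (auxiliary r) [1..<?h + 1])"
      unfolding set_append set_map by blast
    then show ?thesis unfolding input_word_def by (rule length_join_sep_ge)
  qed
  finally show ?thesis .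
qed

text \<open>19 \<le> 32 bounds the length of F_j by 2^(35h) times 2^(6h + 1) = 2^(41h + 1), which
  also covers the targets; the number of words is h^2 + h \<le> 2^(2h + 1).\<close>

lemma length_input_word_le:
  assumes r: "0 < r"
  shows "length (input_word r) \<le> 2 ^ (50 * 2 ^ r)"
proof -
  let ?h = "2 ^ r :: nat" and ?c = "2 ^ (41 * 2 ^ r + 2) :: nat"
  let ?us = "targets r @ map (auxiliary r) [1..<?h + 1]"
  have len: "length (concat (map (\<lambda>c. replicate l La @ [b c]) xs)) = length xs * (l + 1)"
    for l b and xs :: "nat list" by (induction xs) auto
  have one: "(1::nat) \<le> 2 ^ (41 * ?h + 1)" by simp
  have cc: "?c = 2 ^ (41 * ?h + 1) + 2 ^ (41 * ?h + 1)" by simp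
  have "length u + 1 \<le> ?c" if "u \<in> set ?us" for u
  proof -
    have "u \<in> set (targets r) \<or> (\<exists>j. 1 \<le> j \<and> j \<le> ?h \<and> u = auxiliary r j)"
      using that unfolding set_append set_map set_upt by (auto simp del: One_nat_def)
    then have "length u \<le> 2 ^ (41 * ?h + 1)"
    proof (elim disjE exE conjE)
      assume "u \<in> set (targets r)"
      then have "length u \<le> 64 ^ (2 * ?h)" using target_exps_le[OF r] by (auto simp: targets_eq)
      also have "(64::nat) ^ (2 * ?h) = 2 ^ (12 * ?h)" by (simp add: power_mult)
      also have "\<dots> \<le> 2 ^ (41 * ?h + 1)" by (rule power_increasing) simp_all
      finally show ?thesis .
    next
      fix j assume j: "1 \<le> j" "j \<le> ?h" "u = auxiliary r j"
      have "length u = 19 ^ (7 * ?h + 2 - 3 * j) * (64 ^ j + 1)" unfolding j(3) auxiliary_eq len by simp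
      also have "\<dots> \<le> 32 ^ (7 * ?h) * (2 * 64 ^ ?h)"
      proof (rule mult_le_mono)
        have "(19::nat) ^ (7 * ?h + 2 - 3 * j) \<le> 19 ^ (7 * ?h)" by (rule power_increasing) (use j in simp_all)
        also have "\<dots> \<le> 32 ^ (7 * ?h)" by (rule power_mono) simp_all
        finally show "(19::nat) ^ (7 * ?h + 2 - 3 * j) \<le> 32 ^ (7 * ?h)" .
        have "(64::nat) ^ j \<le> 64 ^ ?h" by (rule power_increasing) (use j in simp_all)
        moreover have "(1::nat) \<le> 64 ^ ?h" by simp
        ultimately show "(64::nat) ^ j + 1 \<le> 2 * 64 ^ ?h" by linarith
      qed
      also have "\<dots> = 2 ^ (41 * ?h + 1)"
      proof -
        have "(32::nat) ^ (7 * ?h) = 2 ^ (35 * ?h)" "(64::nat) ^ ?h = 2 ^ (6 * ?h)" by (simp_all add: power_mult)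
        moreover have "41 * ?h + 1 = 35 * ?h + (6 * ?h + 1)" by simp
        then have "(2::nat) ^ (41 * ?h + 1) = 2 ^ (35 * ?h) * (2 ^ (6 * ?h) * 2)" by (simp only: power_add power_one_right)
        ultimately show ?thesis by simp
      qed
      finally show ?thesis .
    qed
    then show ?thesis using one cc by linarith
  qed
  then have "(\<Sum>u\<leftarrow>?us. length u + 1) \<le> (\<Sum>u\<leftarrow>?us. ?c)" by (intro sum_list_mono) blast
  also have "\<dots> = length ?us * ?c" by (simp only: sum_list_triv of_nat_id)
  also have "length ?us = ?h * ?h + ?h" by (simp add: targets_eq target_exps_def length_target_index)
  finally have "length (input_word r) \<le> (?h * ?h + ?h) * ?c"
    unfolding input_word_def using length_join_sep_le[of 1 ?us] by linarith
  also have "\<dots> \<le> 2 ^ (2 * ?h + 1) * ?c"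
  proof (rule mult_le_mono1)
    have "?h \<le> ?h * ?h" by simp
    moreover have "?h \<le> 2 ^ ?h" by (rule less_imp_le[OF less_exp])
    then have "?h * ?h \<le> 2 ^ ?h * 2 ^ ?h" by (intro mult_le_mono)
    moreover have "(2::nat) ^ (2 * ?h + 1) = 2 * (2 ^ ?h * 2 ^ ?h)" by (simp add: power_add mult_2)
    ultimately show "?h * ?h + ?h \<le> 2 ^ (2 * ?h + 1)" by linarith
  qed
  also have "\<dots> = 2 ^ (43 * ?h + 3)"
  proof -
    have "43 * ?h + 3 = (2 * ?h + 1) + (41 * ?h + 2)" by simp
    then show ?thesis by (metis power_add)
  qed
  also have "\<dots> \<le> 2 ^ (50 * ?h)"
  proof (rule power_increasing)
    have "1 \<le> ?h" by simp
    then show "43 * ?h + 3 \<le> 50 * ?h" by linarith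
  qed simp
  finally show ?thesis .
qed

theorem theorem1:
  fixes r h n :: nat and w :: "letter list"
  assumes "10 \<le> r" and "h = 2 ^ r" and "w = input_word r" and "n = length w"
  shows "set w \<subseteq> input_alphabet h \<and> card (input_alphabet h) = h\<^sup>2 + 4 * h \<and>
    h\<^sup>2 + 4 * h \<le> min_slp_size w \<and> min_slp_size w \<le> 600 * h\<^sup>2 \<and>
    2 ^ h \<le> n \<and> n \<le> 2 ^ (50 * h) \<and>
    (\<forall>G. greedy_terminal w G \<longrightarrow>
       real (grammar_size G) \<ge> real h ^ 3 / (8 * (4 * real r + 1)) \<and>
       real (grammar_size G) / real (min_slp_size w) \<ge> real h / (4800 * (4 * real r + 1))) \<and>
    real h / (4800 * (4 * real r + 1)) \<ge> log 2 (real n) / (1200000 * log 2 (log 2 (real n)))"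
proof -
  have r: "0 < r" using assms(1) by simp
  have h0: "0 < h" using assms(2) by simp
  have alph: "set w = input_alphabet h" unfolding assms(2,3) by (rule set_input_word[OF r])
  have card: "card (input_alphabet h) = h\<^sup>2 + 4 * h" by (rule card_input_alphabet[OF h0])
  obtain G0 where G0: "generates G0 w" "grammar_size G0 \<le> 600 * h\<^sup>2"
    using input_word_slp[OF r] unfolding assms(2,3) by blast
  have upper: "min_slp_size w \<le> 600 * h\<^sup>2" using min_slp_size_le[OF G0(1)] G0(2) by simp
  have lower: "h\<^sup>2 + 4 * h \<le> min_slp_size w" using le_min_slp_size[OF G0(1)] alph card by simp
  have n_ge: "2 ^ h \<le> n" using length_input_word_ge[OF r] unfolding assms(2-4) .
  have n_le: "n \<le> 2 ^ (50 * h)" using length_input_word_le[OF r] unfolding assms(2-4) .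
  have pos: "0 < 4 * real r + 1" by simp
  have greedy: "real (grammar_size G) \<ge> real h ^ 3 / (8 * (4 * real r + 1)) \<and>
      real (grammar_size G) / real (min_slp_size w) \<ge> real h / (4800 * (4 * real r + 1))"
    if "greedy_terminal w G" for G
  proof -
    have size: "h * h * ((h - 1) div 2) \<le> (4 * r + 1) * grammar_size G"
      using greedy_size_ge[OF r] that unfolding assms(2,3) by blast
    have "(2::nat) ^ 2 \<le> h" unfolding assms(2) by (rule power_increasing) (use assms(1) in simp_all)
    \<comment> \<open>A generous estimate of the ones per target for h \<ge> 4; it is the source of
      the 8 in the bound.\<close>
    then have "h \<le> 8 * ((h - 1) div 2)" by simp
    then have "h * h * h \<le> h * h * (8 * ((h - 1) div 2))" by (rule mult_le_mono2)
    also have "\<dots> \<le> 8 * ((4 * r + 1) * grammar_size G)" using size by simp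
    finally have "real (h * h * h) \<le> real (8 * ((4 * r + 1) * grammar_size G))" by (simp only: of_nat_le_iff)
    then have main: "real h ^ 3 \<le> real (grammar_size G) * (8 * (4 * real r + 1))"
      by (simp add: power3_eq_cube algebra_simps)
    then have first: "real h ^ 3 / (8 * (4 * real r + 1)) \<le> real (grammar_size G)"
      by (simp add: divide_le_eq)
    have m0: "0 < real (min_slp_size w)" using lower h0 by simp
    have m1: "real (min_slp_size w) \<le> 600 * real h ^ 2"
    proof -
      have "real (min_slp_size w) \<le> real (600 * h\<^sup>2)" using upper by (simp only: of_nat_le_iff)
      then show ?thesis by simp
    qed
    \<comment> \<open>The quotient combines both constants: 4800 = 600 times 8.\<close>
    have "real h * real (min_slp_size w) \<le> real h * (600 * real h ^ 2)" using m1 by (rule mult_left_mono) simp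
    also have "\<dots> = 600 * real h ^ 3" by (simp add: power3_eq_cube power2_eq_square)
    also have "\<dots> \<le> 600 * (real (grammar_size G) * (8 * (4 * real r + 1)))" using main by simp
    also have "\<dots> = real (grammar_size G) * (4800 * (4 * real r + 1))" by simp
    finally have "real h / (4800 * (4 * real r + 1)) \<le> real (grammar_size G) / real (min_slp_size w)"
      using m0 pos by (simp add: divide_le_eq le_divide_eq field_simps)
    then show ?thesis using first by simp
  qed
  have log: "log 2 (real n) / (1200000 * log 2 (log 2 (real n))) \<le> real h / (4800 * (4 * real r + 1))"
  proof -
    have n0: "0 < real n" using n_ge by (metis less_le_trans of_nat_0_less_iff zero_less_numeral zero_less_power)
    have "real (2 ^ h) \<le> real n" using n_ge by (simp only: of_nat_le_iff)
    then have "log 2 (2 ^ h) \<le> log 2 (real n)" using n0 by (intro log_mono) simp_all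
    then have l1: "real h \<le> log 2 (real n)" by (simp add: log_nat_power)
    have "real n \<le> real (2 ^ (50 * h))" using n_le by (simp only: of_nat_le_iff)
    then have "log 2 (real n) \<le> log 2 (2 ^ (50 * h))" using n0 by (intro log_mono) simp_all
    then have l2: "log 2 (real n) \<le> 50 * real h" by (simp add: log_nat_power)
    have "log 2 (real h) \<le> log 2 (log 2 (real n))" using l1 h0 by (intro log_mono) simp_all
    then have l3: "real r \<le> log 2 (log 2 (real n))" unfolding assms(2) by (simp add: log_nat_power)
    have r1: "1 \<le> real r" using assms(1) by simp
    \<comment> \<open>Uses log n \<le> 50h and log log n \<ge> r. The constant is 1200000 = 50 times
      24000, and 4r + 1 \<le> 5r gives 4800(4r + 1) \<le> 24000r.\<close>
    have "log 2 (real n) / (1200000 * log 2 (log 2 (real n))) \<le> 50 * real h / (1200000 * real r)"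
      using l2 l3 r1 by (intro frac_le) simp_all
    also have "\<dots> = real h / (24000 * real r)" by simp
    also have "\<dots> \<le> real h / (4800 * (4 * real r + 1))" using r1 by (intro frac_le) simp_all
    finally show ?thesis .
  qed
  show ?thesis using alph card lower upper n_ge n_le greedy log by blast
qed

end
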